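(* Let $\mathcal{G}$ be a species of graphs and let $\mathcal{N}$ be a symmetric species of networks. Then the generating function $(\mathcal{G}\uparrow\mathcal{N})^{\sim}(x,y)$ of unlabelled $(\mathcal{G}\uparrow\mathcal{N})$-structures is given by $$(\mathcal{G}\uparrow\mathcal{N})^{\sim}(x,y)=W_{\mathcal{G}}\big(x,x^2,\ldots;\ \widetilde{\mathcal{N}}(x,y),\widetilde{\mathcal{N}}(x^2,y^2),\ldots;\ \widetilde{\mathcal{N}}_\tau(x,y),\widetilde{\mathcal{N}}_\tau(x^2,y^2),\ldots\big).$$
   Context: All graphs are finite and simple. $K_2$ is considered 2-connected. A species of graphs is a class of (labelled) graphs closed under isomorphism; the underlying set of a graph is its vertex set. A (2-pole) network is a connected graph $N$ with two distinguished vertices $0,1$ (the poles) such that the graph $N\cup 01$, obtained by adding the edge $01$ if it is not already there, is 2-connected; the other vertices are internal. The underlying set of a network is its set of internal vertices. Isomorphisms of networks are graph isomorphisms fixing $0$ and $1$. A species of networks is a class of networks closed under isomorphism. The opposite network $\tau\cdot N$ is obtained from $N$ by interchanging the poles $0$ and $1$; $\mathcal{N}$ is symmetric if $N\in\mathcal{N}\Rightarrow\tau\cdot N\in\mathcal{N}$. $\mathcal{N}_\tau$ is the subclass of those $N\in\mathcal{N}$ with $\tau\cdot N$ isomorphic to $N$. The class $\mathcal{G}\uparrow\mathcal{N}$ consists of the pairs of graphs $(G,G_0)$ such that: $G_0\in\mathcal{G}$ (the core); $V(G_0)\subseteq V(G)$; and there is a family $\{N_e: e\in E(G_0)\}$ of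 networks in $\mathcal{N}$ such that $G$ is obtained from $G_0$ by substituting $N_e$ for each edge $e$ of $G_0$, identifying the poles of $N_e$ with the extremities of $e$ according to some orientation (the internal vertex sets of the $N_e$ being pairwise disjoint and disjoint from $V(G_0)$). Isomorphisms of such pairs are core-preserving graph isomorphisms. Tilde generating functions: $(\mathcal{G}\uparrow\mathcal{N})^{\sim}(x,y)=\sum x^{n}y^{m}$, the sum over isomorphism classes of pairs $(G,G_0)\in\mathcal{G}\uparrow\mathcal{N}$, where $n=|V(G)|$ and $m=|E(G)|$. Similarly $\widetilde{\mathcal{N}}(x,y)$ (resp. $\widetilde{\mathcal{N}}_\tau(x,y)$) is $\sum x^ny^m$ over isomorphism classes of networks in $\mathcal{N}$ (resp. in $\mathcal{N}_\tau$), where $n$ is the number of internal vertices and $m$ the number of edges. Edge cycles: an automorphism $\sigma$ of a graph $G$ induces a permutation of $E(G)$. A cycle of length $l$ of this permutation is cylindrical if $\sigma^l(a)=a$, $\sigma^l(b)=b$ for each edge $ab$ of the cycle, and Möbius if $\sigma^l(a)=b$, $\sigma^l(b)=a$ for each edge $ab$ of the cycle. Let $\sigma_k$ be the number of cycles of length $k$ of $\sigma$ (on vertices), and $\mathrm{cyl}_k(G,\sigma)$, $\mathrm{m\ddot{o}b}_k(G,\sigma)$ the numbers of cylindrical and Möbius edge cycles of length $k$. Put $w(G,\sigma)=\prod_{k\ge1}a_k^{\sigma_k}\,b_k^{\mathrm{cyl}_k(G,\sigma)}\,c_k^{\mathrm{m\ddot{o}b}_k(G,\sigma)}$. The Walsh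 index series of $\mathcal{G}$ is $$W_{\mathcal{G}}(a_1,a_2,\ldots;b_1,b_2,\ldots;c_1,c_2,\ldots)=\sum_{G}\frac{1}{|\mathrm{Aut}(G)|}\sum_{\sigma\in\mathrm{Aut}(G)}w(G,\sigma),$$ where $G$ runs over a set of representatives of the isomorphism classes of graphs in $\mathcal{G}$. *)

theory Defs
  imports
    "HOL-Analysis.Infinite_Sum"
    "HOL-Combinatorics.Permutations"
    "HOL-Combinatorics.Orbits"
    "HOL-Computational_Algebra.Formal_Power_Series"
    "HOL-Library.Disjoint_Sets"
    "HOL-Library.Infinite_Typeclass"
begin

section \<open>Graphs\<close>

datatype 'a graph = Graph (verts: "'a set") (edges: "'a set set")

definition simple_graph :: "'a graph \<Rightarrow> bool" where
  "simple_graph G \<longleftrightarrow>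
     finite (verts G) \<and> (\<forall>e\<in>edges G. e \<subseteq> verts G \<and> card e = 2)"

definition graph_connected :: "'a graph \<Rightarrow> bool" where
  "graph_connected G \<longleftrightarrow>
     verts G \<noteq> {} \<and>
     (\<forall>u\<in>verts G. \<forall>v\<in>verts G. (u, v) \<in> {(a, b). {a, b} \<in> edges G}\<^sup>*)"

definition del_vertex :: "'a \<Rightarrow> 'a graph \<Rightarrow> 'a graph" where
  "del_vertex v G = Graph (verts G - {v}) {e \<in> edges G. v \<notin> e}"

definition add_edge :: "'a \<Rightarrow> 'a \<Rightarrow> 'a graph \<Rightarrow> 'a graph" where
  "add_edge u v G = Graph (verts G) (insert {u, v} (edges G))"

text \<open>The second disjunct is the convention that \<open>K\<^sub>2\<close> is 2-connected.\<close>

definition two_connected :: "'a graph \<Rightarrow> bool" where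
  "two_connected G \<longleftrightarrow>
     (card (verts G) \<ge> 3 \<and> graph_connected G \<and>
       (\<forall>v\<in>verts G. graph_connected (del_vertex v G))) \<or>
     (card (verts G) = 2 \<and> edges G = {verts G})"

definition graph_iso :: "('a \<Rightarrow> 'a) \<Rightarrow> 'a graph \<Rightarrow> 'a graph \<Rightarrow> bool" where
  "graph_iso f G H \<longleftrightarrow>
     bij_betw f (verts G) (verts H) \<and> (\<lambda>e. f ` e) ` edges G = edges H"

definition graph_iso_rel :: "('a graph \<times> 'a graph) set" where
  "graph_iso_rel = {(G, H). \<exists>f. graph_iso f G H}"

text \<open>Classes of labelled objects are sets of objects whose vertices are drawn from a type
  \<open>'a\<close> of labels. Results about species take \<open>'a\<close> to be infinite, so that every finite
  graph has a labelled copy and there is always room for disjoint copies.\<close>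

definition graph_species :: "'a graph set \<Rightarrow> bool" where
  "graph_species \<G> \<longleftrightarrow>
     (\<forall>G\<in>\<G>. simple_graph G) \<and>
     (\<forall>G\<in>\<G>. \<forall>H. simple_graph H \<and> (G, H) \<in> graph_iso_rel \<longrightarrow> H \<in> \<G>)"


section \<open>Networks\<close>

datatype 'a network = Network (ngraph: "'a graph") (pole0: 'a) (pole1: 'a)

definition internal :: "'a network \<Rightarrow> 'a set" where
  "internal N = verts (ngraph N) - {pole0 N, pole1 N}"

definition network :: "'a network \<Rightarrow> bool" where
  "network N \<longleftrightarrow>
     simple_graph (ngraph N) \<and> graph_connected (ngraph N) \<and>
     pole0 N \<in> verts (ngraph N) \<and> pole1 N \<in> verts (ngraph N) \<and> pole0 N \<noteq> pole1 N \<and>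
     two_connected (add_edge (pole0 N) (pole1 N) (ngraph N))"

definition network_iso :: "('a \<Rightarrow> 'a) \<Rightarrow> 'a network \<Rightarrow> 'a network \<Rightarrow> bool" where
  "network_iso f N M \<longleftrightarrow>
     graph_iso f (ngraph N) (ngraph M) \<and> f (pole0 N) = pole0 M \<and> f (pole1 N) = pole1 M"

definition network_iso_rel :: "('a network \<times> 'a network) set" where
  "network_iso_rel = {(N, M). \<exists>f. network_iso f N M}"

definition network_species :: "'a network set \<Rightarrow> bool" where
  "network_species \<N> \<longleftrightarrow>
     (\<forall>N\<in>\<N>. network N) \<and>
     (\<forall>N\<in>\<N>. \<forall>M. network M \<and> (N, M) \<in> network_iso_rel \<longrightarrow> M \<in> \<N>)"

definition opposite :: "'a network \<Rightarrow> 'a network" where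
  "opposite N = Network (ngraph N) (pole1 N) (pole0 N)"

definition symmetric_networks :: "'a network set \<Rightarrow> bool" where
  "symmetric_networks \<N> \<longleftrightarrow> (\<forall>N\<in>\<N>. opposite N \<in> \<N>)"

definition self_opposite :: "'a network set \<Rightarrow> 'a network set" where
  "self_opposite \<N> = {N \<in> \<N>. (opposite N, N) \<in> network_iso_rel}"


section \<open>Substitution of networks for edges\<close>

text \<open>\<open>is_substitution G0 N G\<close>: the graph \<open>G\<close> results from \<open>G0\<close> by replacing each edge \<open>e\<close> with
  the network \<open>N e\<close>. The poles of \<open>N e\<close> are already the extremities of \<open>e\<close>, in either order; since
  species of networks are closed under isomorphism, this amounts to identifying poles with
  extremities. The edge \<open>e\<close> itself lies in \<open>G\<close> only if it is an edge of \<open>N e\<close>.\<close>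

definition is_substitution :: "'a graph \<Rightarrow> ('a set \<Rightarrow> 'a network) \<Rightarrow> 'a graph \<Rightarrow> bool" where
  "is_substitution G0 N G \<longleftrightarrow>
     (\<forall>e\<in>edges G0. {pole0 (N e), pole1 (N e)} = e \<and> internal (N e) \<inter> verts G0 = {}) \<and>
     disjoint_family_on (\<lambda>e. internal (N e)) (edges G0) \<and>
     verts G = verts G0 \<union> (\<Union>e\<in>edges G0. internal (N e)) \<and>
     edges G = (\<Union>e\<in>edges G0. edges (ngraph (N e)))"

definition subst_class :: "'a graph set \<Rightarrow> 'a network set \<Rightarrow> ('a graph \<times> 'a graph) set"
    (infix \<open>\<up>\<close> 70) where
  "\<G> \<up> \<N> =
     {(G, G0). G0 \<in> \<G> \<and> (\<exists>N. (\<forall>e\<in>edges G0. N e \<in> \<N>) \<and> is_substitution G0 N G)}"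

definition core_iso_rel :: "(('a graph \<times> 'a graph) \<times> ('a graph \<times> 'a graph)) set" where
  "core_iso_rel = {((G, G0), (H, H0)). \<exists>f. graph_iso f G H \<and> graph_iso f G0 H0}"


section \<open>Generating functions\<close>

text \<open>Series in \<open>x, y\<close> live in \<^typ>\<open>rat fps fps\<close>, with \<open>x\<close> the outer and \<open>y\<close> the inner
  indeterminate: the coefficient of \<open>x\<^sup>n y\<^sup>m\<close> in \<open>f\<close> is \<open>fps_nth (fps_nth f n) m\<close>.
  The quotients counted below are finite, as only finitely many isomorphism types of graphs have
  a given number of vertices.\<close>

definition class_gf :: "'s set \<Rightarrow> ('s \<times> 's) set \<Rightarrow> ('s \<Rightarrow> nat) \<Rightarrow> ('s \<Rightarrow> nat) \<Rightarrow> rat fps fps" where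
  "class_gf S R p q =
     Abs_fps (\<lambda>n. Abs_fps (\<lambda>m. of_nat (card ({s \<in> S. p s = n \<and> q s = m} // R))))"

definition subst_gf :: "('a graph \<times> 'a graph) set \<Rightarrow> rat fps fps" where
  "subst_gf \<P> =
     class_gf \<P> core_iso_rel (\<lambda>(G, G0). card (verts G)) (\<lambda>(G, G0). card (edges G))"

definition network_gf :: "'a network set \<Rightarrow> rat fps fps" where
  "network_gf \<N> =
     class_gf \<N> network_iso_rel (\<lambda>N. card (internal N)) (\<lambda>N. card (edges (ngraph N)))"

text \<open>\<open>f(x\<^sup>k, y\<^sup>k)\<close>, for \<open>k \<ge> 1\<close>.\<close>

definition subst_pow :: "nat \<Rightarrow> rat fps fps \<Rightarrow> rat fps fps" where
  "subst_pow k f = fps_compose (Abs_fps (\<lambda>n. fps_compose (fps_nth f n) (fps_X ^ k))) (fps_X ^ k)"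


section \<open>The Walsh index series\<close>

definition automorphisms :: "'a graph \<Rightarrow> ('a \<Rightarrow> 'a) set" where
  "automorphisms G = {\<sigma>. \<sigma> permutes verts G \<and> graph_iso \<sigma> G G}"

definition vertex_cycles :: "'a graph \<Rightarrow> ('a \<Rightarrow> 'a) \<Rightarrow> 'a set set" where
  "vertex_cycles G \<sigma> = orbit \<sigma> ` verts G"

definition edge_cycles :: "'a graph \<Rightarrow> ('a \<Rightarrow> 'a) \<Rightarrow> 'a set set set" where
  "edge_cycles G \<sigma> = orbit (\<lambda>e. \<sigma> ` e) ` edges G"

definition cylindrical :: "('a \<Rightarrow> 'a) \<Rightarrow> 'a set set \<Rightarrow> bool" where
  "cylindrical \<sigma> C \<longleftrightarrow>
     (\<forall>a b. {a, b} \<in> C \<longrightarrow> (\<sigma> ^^ card C) a = a \<and> (\<sigma> ^^ card C) b = b)"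

definition moebius :: "('a \<Rightarrow> 'a) \<Rightarrow> 'a set set \<Rightarrow> bool" where
  "moebius \<sigma> C \<longleftrightarrow>
     (\<forall>a b. {a, b} \<in> C \<longrightarrow> (\<sigma> ^^ card C) a = b \<and> (\<sigma> ^^ card C) b = a)"

definition cyc :: "nat \<Rightarrow> 'a graph \<Rightarrow> ('a \<Rightarrow> 'a) \<Rightarrow> nat" where
  "cyc k G \<sigma> = card {C \<in> vertex_cycles G \<sigma>. card C = k}"

definition cyl :: "nat \<Rightarrow> 'a graph \<Rightarrow> ('a \<Rightarrow> 'a) \<Rightarrow> nat" where
  "cyl k G \<sigma> = card {C \<in> edge_cycles G \<sigma>. card C = k \<and> cylindrical \<sigma> C}"

definition moeb :: "nat \<Rightarrow> 'a graph \<Rightarrow> ('a \<Rightarrow> 'a) \<Rightarrow> nat" where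
  "moeb k G \<sigma> = card {C \<in> edge_cycles G \<sigma>. card C = k \<and> moebius \<sigma> C}"

text \<open>All exponents beyond the bounds of the two products vanish.\<close>

definition walsh_weight ::
    "(nat \<Rightarrow> 'r) \<Rightarrow> (nat \<Rightarrow> 'r) \<Rightarrow> (nat \<Rightarrow> 'r) \<Rightarrow> 'a graph \<Rightarrow> ('a \<Rightarrow> 'a) \<Rightarrow> 'r::comm_semiring_1" where
  "walsh_weight a b c G \<sigma> =
     (\<Prod>k=1..card (verts G). a k ^ cyc k G \<sigma>) *
     (\<Prod>k=1..card (edges G). b k ^ cyl k G \<sigma> * c k ^ moeb k G \<sigma>)"

definition graph_reps :: "'a graph set \<Rightarrow> 'a graph set" where
  "graph_reps \<G> = (\<lambda>C. SOME G. G \<in> C) ` (\<G> // graph_iso_rel)"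

definition walsh_term ::
    "(nat \<Rightarrow> rat fps fps) \<Rightarrow> (nat \<Rightarrow> rat fps fps) \<Rightarrow> (nat \<Rightarrow> rat fps fps) \<Rightarrow> 'a graph \<Rightarrow> rat fps fps"
  where
  "walsh_term a b c G =
     fps_const (fps_const (1 / of_nat (card (automorphisms G)))) *
     (\<Sum>\<sigma>\<in>automorphisms G. walsh_weight a b c G \<sigma>)"

text \<open>The value of the series at sequences \<open>a, b, c\<close> of bivariate series (only the entries with
  index at least 1 matter). The infinite sum is taken in the \<open>x\<close>-adic topology; it converges
  whenever \<open>x\<^sup>k\<close> divides \<open>a k\<close> for all \<open>k\<close>, see \<open>walsh_term_summable\<close> below.\<close>

definition walsh_index ::
    "'a graph set \<Rightarrow> (nat \<Rightarrow> rat fps fps) \<Rightarrow> (nat \<Rightarrow> rat fps fps) \<Rightarrow> (nat \<Rightarrow> rat fps fps) \<Rightarrow> rat fps fps"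
  where
  "walsh_index \<G> a b c = (\<Sum>\<^sub>\<infinity>G\<in>graph_reps \<G>. walsh_term a b c G)"


subsection \<open>Convergence\<close>

lemma sum_cyc:
  assumes fin: "finite (verts G)" and p: "\<sigma> permutes verts G"
  shows "(\<Sum>k=1..card (verts G). k * cyc k G \<sigma>) = card (verts G)"
proof -
  let ?V = "verts G" and ?C = "vertex_cycles G \<sigma>"
  have perm: "permutation \<sigma>" using fin p permutation_permutes by blast
  have sub: "C \<subseteq> ?V" "C \<noteq> {}" if "C \<in> ?C" for C
    using that permutes_orbit_subset[OF p] orbit_nonempty[of \<sigma>]
    by (auto simp: vertex_cycles_def)
  have cyc: "cyclic_on \<sigma> C" if "C \<in> ?C" for C
    using that cyclic_on_orbit'[OF perm] by (auto simp: vertex_cycles_def)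
  have disj: "C = D" if "C \<in> ?C" "D \<in> ?C" "x \<in> C" "x \<in> D" for C D x
    using cyc[OF that(1)] cyc[OF that(2)] that(3,4) by (metis cyclic_on_alldef)
  have fC: "finite ?C" using fin by (simp add: vertex_cycles_def)
  have Un: "\<Union>?C = ?V"
    using sub(1) permutation_self_in_orbit[OF perm] by (fastforce simp: vertex_cycles_def)
  have finC: "finite C" if "C \<in> ?C" for C
    using sub(1)[OF that] fin by (rule finite_subset)
  have "pairwise disjnt ?C"
    using disj by (force simp: pairwise_def disjnt_def)
  then have "card (\<Union>?C) = (\<Sum>C\<in>?C. card C)"
    using finC by (rule card_Union_disjoint)
  then have "card ?V = (\<Sum>C\<in>?C. card C)"
    by (simp add: Un)
  also have "\<dots> = (\<Sum>k\<in>{1..card ?V}. \<Sum>C | C \<in> ?C \<and> card C = k. card C)"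
  proof (rule sum.group[symmetric])
    have "card C \<in> {1..card ?V}" if "C \<in> ?C" for C
      using sub[OF that] finC[OF that] card_mono[OF fin] by (simp add: Suc_le_eq card_gt_0_iff)
    then show "card ` ?C \<subseteq> {1..card ?V}" by blast
  qed (use fC in simp_all)
  also have "\<dots> = (\<Sum>k=1..card ?V. k * cyc k G \<sigma>)"
    by (rule sum.cong) (auto simp: cyc_def)
  finally show ?thesis ..
qed

lemma X_power_dvd_walsh_term:
  assumes fin: "finite (verts G)" and dvd: "\<And>k. k \<ge> 1 \<Longrightarrow> fps_X ^ k dvd a k"
  shows "fps_X ^ card (verts G) dvd walsh_term a b c G"
proof -
  have "fps_X ^ card (verts G) dvd walsh_weight a b c G \<sigma>" if "\<sigma> \<in> automorphisms G" for \<sigma>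
  proof -
    have p: "\<sigma> permutes verts G" using that by (simp add: automorphisms_def)
    have "fps_X ^ card (verts G) = (\<Prod>k=1..card (verts G). (fps_X ^ k :: rat fps fps) ^ cyc k G \<sigma>)"
      by (subst sum_cyc[OF fin p, symmetric]) (simp add: power_sum power_mult)
    also have "\<dots> dvd (\<Prod>k=1..card (verts G). a k ^ cyc k G \<sigma>)"
      by (rule prod_dvd_prod) (auto intro!: dvd_power_same dvd)
    finally show ?thesis by (simp add: walsh_weight_def)
  qed
  then have "fps_X ^ card (verts G) dvd (\<Sum>\<sigma>\<in>automorphisms G. walsh_weight a b c G \<sigma>)"
    by (rule dvd_sum)
  then show ?thesis by (simp add: walsh_term_def)
qed

lemma graph_iso_rel_card:
  assumes "(G, H) \<in> graph_iso_rel"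
  shows "card (verts G) = card (verts H)"
  using assms by (auto simp: graph_iso_rel_def graph_iso_def bij_betw_same_card)

lemma graph_iso_rel_refl: "(G, G) \<in> graph_iso_rel"
  unfolding graph_iso_rel_def graph_iso_def by (auto intro!: exI[of _ id])

lemma graph_iso_rel_sym:
  assumes "(G, H) \<in> graph_iso_rel" "simple_graph G"
  shows "(H, G) \<in> graph_iso_rel"
proof -
  from assms obtain f where b: "bij_betw f (verts G) (verts H)"
    and e: "(\<lambda>e. f ` e) ` edges G = edges H"
    unfolding graph_iso_rel_def graph_iso_def by blast
  let ?g = "inv_into (verts G) f"
  have "?g ` f ` x = x" if "x \<in> edges G" for x
    using that assms(2) b unfolding simple_graph_def bij_betw_def
    by (metis inv_into_image_cancel)
  then have "(\<lambda>e. ?g ` e) ` edges H = edges G"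
    unfolding e[symmetric] by (force simp: image_image)
  with bij_betw_inv_into[OF b] show ?thesis
    unfolding graph_iso_rel_def graph_iso_def by blast
qed

lemma graph_iso_rel_trans:
  assumes "(G, H) \<in> graph_iso_rel" "(H, K) \<in> graph_iso_rel"
  shows "(G, K) \<in> graph_iso_rel"
proof -
  from assms obtain f g where "graph_iso f G H" "graph_iso g H K"
    unfolding graph_iso_rel_def by blast
  then have "bij_betw (g \<circ> f) (verts G) (verts K)"
      "(\<lambda>e. g ` e) ` (\<lambda>e. f ` e) ` edges G = edges K"
    by (auto simp: graph_iso_def intro: bij_betw_trans)
  then have "graph_iso (g \<circ> f) G K"
    by (simp add: graph_iso_def image_image image_comp)
  then show ?thesis unfolding graph_iso_rel_def by blast
qed

lemma graph_reps_props:
  assumes "graph_species \<G>" "C \<in> \<G> // graph_iso_rel"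
  obtains G where "G \<in> \<G>" "simple_graph G" "C = graph_iso_rel `` {G}"
    "(G, SOME H. H \<in> C) \<in> graph_iso_rel"
proof -
  from assms obtain G where G: "G \<in> \<G>" "C = graph_iso_rel `` {G}" by (auto elim: quotientE)
  then have "G \<in> C" using graph_iso_rel_refl by blast
  then have "(SOME H. H \<in> C) \<in> C" by (rule someI)
  then have "(G, SOME H. H \<in> C) \<in> graph_iso_rel" using G(2) by auto
  moreover have "simple_graph G" using G(1) assms(1) by (simp add: graph_species_def)
  ultimately show ?thesis using that G by blast
qed

lemma finite_graph_reps:
  fixes \<G> :: "'a::infinite graph set"
  assumes \<G>: "graph_species \<G>"
  shows "finite {G \<in> graph_reps \<G>. card (verts G) = n}"
proof -
  obtain A :: "'a set" where A: "finite A" "card A = n"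
    using infinite_arbitrarily_large[OF infinite_UNIV] by blast
  let ?K = "{K :: 'a graph. verts K = A \<and> edges K \<subseteq> Pow A}"
  have "?K \<subseteq> (\<lambda>(V, E). Graph V E) ` ({A} \<times> Pow (Pow A))"
  proof
    fix K assume "K \<in> ?K"
    then show "K \<in> (\<lambda>(V, E). Graph V E) ` ({A} \<times> Pow (Pow A))"
      by (intro image_eqI[of _ _ "(verts K, edges K)"]) auto
  qed
  then have finK: "finite ?K" using A by (meson finite_Pow_iff finite_SigmaI finite.intros finite_imageI finite_subset)
  have "{G \<in> graph_reps \<G>. card (verts G) = n} \<subseteq> (\<lambda>K. SOME H. H \<in> graph_iso_rel `` {K}) ` ?K"
  proof
    fix H assume "H \<in> {G \<in> graph_reps \<G>. card (verts G) = n}"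
    then obtain C where C: "C \<in> \<G> // graph_iso_rel" "H = (SOME H. H \<in> C)" "card (verts H) = n"
      by (auto simp: graph_reps_def)
    from graph_reps_props[OF \<G> C(1)] obtain G where
      G: "simple_graph G" "C = graph_iso_rel `` {G}" "(G, H) \<in> graph_iso_rel"
      using C(2) by metis
    have "card (verts G) = n" using graph_iso_rel_card[OF G(3)] C(3) by simp
    then obtain f where f: "bij_betw f (verts G) A"
      using A G(1) by (metis finite_same_card_bij simple_graph_def)
    define K where "K = Graph A ((\<lambda>e. f ` e) ` edges G)"
    have iso: "(G, K) \<in> graph_iso_rel"
      using f by (auto simp: K_def graph_iso_rel_def graph_iso_def)
    have "K \<in> ?K"
      using f G(1) by (fastforce simp: K_def simple_graph_def bij_betw_def)
    moreover have "C = graph_iso_rel `` {K}"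
      unfolding G(2) using iso graph_iso_rel_sym[OF iso G(1)] graph_iso_rel_trans by blast
    ultimately show "H \<in> (\<lambda>K. SOME H. H \<in> graph_iso_rel `` {K}) ` ?K"
      using C(2) by blast
  qed
  then show ?thesis by (rule finite_surj[OF finK])
qed

lemma walsh_term_summable:
  fixes \<G> :: "'a::infinite graph set"
  assumes \<G>: "graph_species \<G>" and dvd: "\<And>k. k \<ge> 1 \<Longrightarrow> fps_X ^ k dvd a k"
  shows "walsh_term a b c summable_on graph_reps \<G>"
proof -
  let ?t = "walsh_term a b c" and ?R = "graph_reps \<G>"
  define F where "F n = {G \<in> ?R. card (verts G) \<le> n}" for n
  have finF: "finite (F n)" for n
  proof -
    have "F n = (\<Union>i\<le>n. {G \<in> ?R. card (verts G) = i})" by (auto simp: F_def)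
    then show ?thesis using finite_graph_reps[OF \<G>] by simp
  qed
  have zero: "fps_nth (?t G) n = 0" if "G \<in> ?R" "n < card (verts G)" for G n
  proof -
    have "finite (verts G)" using that(2) by (intro card_ge_0_finite) simp
    from X_power_dvd_walsh_term[where a = a and b = b and c = c, OF this dvd]
    show ?thesis using that(2) by (auto elim!: dvdE simp: fps_X_power_mult_nth)
  qed
  define S where "S = Abs_fps (\<lambda>n. \<Sum>G\<in>F n. fps_nth (?t G) n)"
  have "(?t has_sum S) ?R"
    unfolding has_sum_def
  proof (rule tendsto_fpsI)
    fix n
    show "\<forall>\<^sub>F X in finite_subsets_at_top ?R. fps_nth (sum ?t X) n = fps_nth S n"
      unfolding eventually_finite_subsets_at_top
    proof (intro exI[of _ "F n"] conjI allI impI)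
      fix Y assume Y: "finite Y \<and> F n \<subseteq> Y \<and> Y \<subseteq> ?R"
      have "(\<Sum>G\<in>F n. fps_nth (?t G) n) = (\<Sum>G\<in>Y. fps_nth (?t G) n)"
      proof (rule sum.mono_neutral_left)
        show "\<forall>G\<in>Y - F n. fps_nth (?t G) n = 0"
          using Y zero unfolding F_def by (metis (mono_tags, lifting) DiffE linorder_not_le
            mem_Collect_eq subsetD)
      qed (use Y in simp_all)
      then show "fps_nth (sum ?t Y) n = fps_nth S n" by (simp add: S_def fps_sum_nth)
    qed (use finF in \<open>auto simp: F_def\<close>)
  qed
  then show ?thesis by (auto simp: summable_on_def)
qed

end

theory Submission
  imports Defs "HOL-Combinatorics.Cycles"
begin

text \<open>Since adding the edge \<open>01\<close> makes a network 2-connected, each of its internal vertices is joined to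
  either pole by a path that avoids the other pole. Hence \<open>G\<close> and its core determine the network
  \<open>N\<^sub>e\<close> on each core edge up to orientation, and the pairs with core \<open>G\<^sub>0\<close>, up to isomorphism, are the
  orbits of \<open>Aut(G\<^sub>0)\<close> on colourings of the arcs of \<open>G\<^sub>0\<close> by isomorphism types of networks in which
  opposite arcs carry opposite types. By Burnside's lemma it remains to count the colourings fixed by
  an automorphism \<open>\<sigma>\<close>: on a cylindrical edge cycle of length \<open>l\<close> any type can be chosen on one arc, on
  a Moebius cycle only a self-opposite one, and the choice is copied \<open>l\<close> times.\<close>

section \<open>Counting orbits and bivariate counting series\<close>

text \<open>An edge of the core has no preferred direction and an automorphism may reverse it, so
  networks indexed by edges with a free choice of orientation carry no natural action of the
  automorphism group. Indexing them by arcs, with opposite networks on opposite arcs, removes the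
  choice; symmetry of the species keeps the opposite types available. A pair whose core is merely
  isomorphic to the representative \<open>G0\<close> yields a colouring of \<open>G0\<close> only
  after an identification of the two cores. Pairs and colourings are therefore matched by a
  relation, \<open>realizes\<close>, under which isomorphic pairs correspond to colourings in one
  orbit. The set of all colourings may be infinite, so Burnside's lemma is applied to each bidegree
  \<open>(n, m)\<close> separately and the theorem is proved as an equality of coefficients.\<close>

lemma burnside:
  fixes G :: "('b \<Rightarrow> 'b) set" and act :: "('b \<Rightarrow> 'b) \<Rightarrow> 'x \<Rightarrow> 'x"
  assumes finG: "finite G" and finX: "finite X"
    and one: "id \<in> G" and comp: "\<And>g h. g \<in> G \<Longrightarrow> h \<in> G \<Longrightarrow> g \<circ> h \<in> G"
    and inv: "\<And>g. g \<in> G \<Longrightarrow> inv g \<in> G" and bij: "\<And>g. g \<in> G \<Longrightarrow> bij g"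
    and act_in: "\<And>g x. g \<in> G \<Longrightarrow> x \<in> X \<Longrightarrow> act g x \<in> X"
    and act_id: "\<And>x. x \<in> X \<Longrightarrow> act id x = x"
    and act_comp: "\<And>g h x. g \<in> G \<Longrightarrow> h \<in> G \<Longrightarrow> x \<in> X \<Longrightarrow> act (g \<circ> h) x = act h (act g x)"
  defines "Q \<equiv> {(x, y). x \<in> X \<and> y \<in> X \<and> (\<exists>g\<in>G. act g x = y)}"
  shows "equiv X Q" and "card (X // Q) * card G = (\<Sum>g\<in>G. card {x \<in> X. act g x = x})"
proof -
  have inv_act: "act (inv g) (act g x) = x" if "g \<in> G" "x \<in> X" for g x
    using act_comp[OF that(1) inv[OF that(1)] that(2)] bij[OF that(1)] act_id[OF that(2)]
    by (metis bij_is_surj surj_iff)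
  show eq: "equiv X Q"
  proof (rule equivI)
    show "Q \<subseteq> X \<times> X" by (auto simp: Q_def)
    show "refl_on X Q" using one act_id by (auto simp: Q_def refl_on_def)
    show "sym Q" using inv inv_act by (fastforce simp: Q_def sym_def)
    show "trans Q" using comp act_comp unfolding Q_def trans_def
      by (smt (verit) case_prod_conv mem_Collect_eq)
  qed
  let ?stab = "\<lambda>x. {g \<in> G. act g x = x}"
  \<comment> \<open>\<open>act\<close> is a right action, as pullback of colourings is:
    \<open>k\<close> fixes \<open>act h x\<close> exactly if \<open>h \<circ> k\<close> carries
    \<open>x\<close> to \<open>act h x\<close>. So the stabilisers along the orbit of
    \<open>x\<close> have the sizes of the pieces into which the group splits according to the image
    of \<open>x\<close>.\<close>
  have stab: "card (?stab (act h x)) = card {g \<in> G. act g x = act h x}"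
    if "h \<in> G" "x \<in> X" for h x
  proof (rule bij_betw_same_card[of "\<lambda>k. h \<circ> k"], rule bij_betwI[where g = "\<lambda>k. inv h \<circ> k"])
    show "(\<lambda>k. h \<circ> k) \<in> ?stab (act h x) \<rightarrow> {g \<in> G. act g x = act h x}"
      using that comp act_comp by auto
    show "(\<lambda>k. inv h \<circ> k) \<in> {g \<in> G. act g x = act h x} \<rightarrow> ?stab (act h x)"
      using that comp inv act_comp act_in inv_act by auto
  qed (use bij[OF that(1)] in \<open>auto simp: fun_eq_iff bij_is_inj surj_f_inv_f bij_is_surj\<close>)
  have orb: "(\<Sum>x\<in>K. card (?stab x)) = card G" if K: "K \<in> X // Q" for K
  proof -
    obtain x where x: "x \<in> X" "K = Q `` {x}" using K by (auto elim: quotientE)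
    have sub: "K \<subseteq> X" using x by (auto simp: Q_def)
    have O_eq: "K = (\<lambda>g. act g x) ` G" using x act_in by (auto simp: Q_def)
    have "(\<Sum>y\<in>K. card (?stab y)) = (\<Sum>y\<in>K. \<Sum>g | g \<in> G \<and> act g x = y. 1)"
      using stab x(1) by (intro sum.cong) (auto simp: O_eq)
    also have "\<dots> = (\<Sum>g\<in>G. 1)"
      using finG finX sub by (intro sum.group) (auto simp: O_eq finite_subset)
    finally show ?thesis by simp
  qed
  have "(\<Sum>g\<in>G. card {x \<in> X. act g x = x}) = (\<Sum>g\<in>G. \<Sum>x\<in>X. if act g x = x then 1 else 0)"
    using finX by (simp add: sum.If_cases Int_def)
  also have "\<dots> = (\<Sum>x\<in>X. \<Sum>g\<in>G. if act g x = x then 1 else 0)"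
    by (rule sum.swap)
  also have "\<dots> = (\<Sum>x\<in>X. card (?stab x))"
    using finG by (simp add: sum.If_cases Int_def)
  also have "\<dots> = (\<Sum>x\<in>\<Union>(X // Q). card (?stab x))"
    using eq by (simp add: Union_quotient)
  also have "\<dots> = (\<Sum>K\<in>X // Q. \<Sum>x\<in>K. card (?stab x))"
  proof (rule sum.Union_disjoint[unfolded comp_def])
    show "\<forall>A\<in>X // Q. finite A" using eq finX by (meson finite_equiv_class equivE)
    show "\<forall>A\<in>X // Q. \<forall>B\<in>X // Q. A \<noteq> B \<longrightarrow> A \<inter> B = {}" using eq quotient_disj by fast
  qed
  also have "\<dots> = card (X // Q) * card G" using orb by simp
  finally show "card (X // Q) * card G = (\<Sum>g\<in>G. card {x \<in> X. act g x = x})" ..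
qed

lemma ex_bij_betw_images:
  assumes "\<And>s t. s \<in> S \<Longrightarrow> t \<in> S \<Longrightarrow> f s = f t \<longleftrightarrow> g s = g t"
  shows "\<exists>h. bij_betw h (f ` S) (g ` S)"
proof
  have inv: "g (inv_into S f (f s)) = g s" if "s \<in> S" for s
    using that by (metis assms f_inv_into_f image_eqI inv_into_into)
  show "bij_betw (\<lambda>c. g (inv_into S f c)) (f ` S) (g ` S)"
    unfolding bij_betw_def inj_on_def using assms inv by (auto simp: image_image)
qed

text \<open>Objects on the two sides determine each other only up to equivalence, hence a relation
  \<open>\<rho>\<close> in place of a function. The hypotheses on \<open>R\<close> and
  \<open>Q\<close> compare classes of members only, because \<open>core_iso_rel\<close> fails to be
  symmetric on values that are not simple graphs.\<close>

lemma quotient_bij_of_relation: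
  assumes R: "\<And>s s'. s \<in> S \<Longrightarrow> s' \<in> S \<Longrightarrow> R `` {s} = R `` {s'} \<longleftrightarrow> (s, s') \<in> R"
    and Q: "\<And>t t'. t \<in> T \<Longrightarrow> t' \<in> T \<Longrightarrow> Q `` {t} = Q `` {t'} \<longleftrightarrow> (t, t') \<in> Q"
    and total: "\<And>s. s \<in> S \<Longrightarrow> \<exists>t\<in>T. \<rho> s t"
    and surj: "\<And>t. t \<in> T \<Longrightarrow> \<exists>s\<in>S. \<rho> s t"
    and iff: "\<And>s t s' t'. s \<in> S \<Longrightarrow> t \<in> T \<Longrightarrow> s' \<in> S \<Longrightarrow> t' \<in> T \<Longrightarrow> \<rho> s t \<Longrightarrow> \<rho> s' t' \<Longrightarrow>
      (s, s') \<in> R \<longleftrightarrow> (t, t') \<in> Q"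
  shows "\<exists>h. bij_betw h (S // R) (T // Q)"
proof -
  obtain g where g: "\<And>s. s \<in> S \<Longrightarrow> g s \<in> T \<and> \<rho> s (g s)" using total by metis
  have "(\<lambda>s. Q `` {g s}) ` S = T // Q"
  proof
    show "(\<lambda>s. Q `` {g s}) ` S \<subseteq> T // Q" using g by (auto intro: quotientI)
    show "T // Q \<subseteq> (\<lambda>s. Q `` {g s}) ` S"
    proof
      fix C assume "C \<in> T // Q"
      then obtain t where t: "t \<in> T" "C = Q `` {t}" by (auto elim: quotientE)
      obtain s where s: "s \<in> S" "\<rho> s t" using surj t(1) by blast
      \<comment> \<open>Applied to \<open>s\<close> twice, \<open>iff\<close> says that any two
        partners of \<open>s\<close> are related; so the arbitrary choice made by \<open>g\<close>
        does not affect the class.\<close>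
      have "(s, s) \<in> R" using R s(1) by blast
      then have "(t, g s) \<in> Q" using iff g s t(1) by blast
      then have "C = Q `` {g s}" using Q g s(1) t by blast
      then show "C \<in> (\<lambda>s. Q `` {g s}) ` S" using s(1) by blast
    qed
  qed
  moreover have "S // R = (\<lambda>s. R `` {s}) ` S" by (auto simp: quotient_def)
  moreover have "R `` {s} = R `` {s'} \<longleftrightarrow> Q `` {g s} = Q `` {g s'}" if "s \<in> S" "s' \<in> S" for s s'
    using R[OF that] Q[of "g s" "g s'"] iff[of s "g s" s' "g s'"] g[of s] g[of s'] that by simp
  ultimately show ?thesis using ex_bij_betw_images[of S "\<lambda>s. R `` {s}" "\<lambda>s. Q `` {g s}"] by simp
qed

section \<open>Bivariate counting series of sets with two sizes\<close>

unbundle fps_syntax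

definition gf :: "'s set \<Rightarrow> ('s \<Rightarrow> nat) \<Rightarrow> ('s \<Rightarrow> nat) \<Rightarrow> rat fps fps" where
  "gf S p q = Abs_fps (\<lambda>n. Abs_fps (\<lambda>m. of_nat (card {s \<in> S. p s = n \<and> q s = m})))"

text \<open>An infinite set has \<open>card\<close> 0, so the coefficients of \<open>gf\<close>
  count faithfully, and products of such series can be taken, only under this condition.\<close>

definition finite_fibres :: "'s set \<Rightarrow> ('s \<Rightarrow> nat) \<Rightarrow> ('s \<Rightarrow> nat) \<Rightarrow> bool" where
  "finite_fibres S p q \<longleftrightarrow> (\<forall>n m. finite {s \<in> S. p s = n \<and> q s = m})"

lemma gf_nth [simp]: "gf S p q $ n $ m = of_nat (card {s \<in> S. p s = n \<and> q s = m})"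
  by (simp add: gf_def)

lemma bij_betw_fibres:
  assumes "bij_betw h A B" "\<And>a. a \<in> A \<Longrightarrow> p' (h a) = p a" "\<And>a. a \<in> A \<Longrightarrow> q' (h a) = q a"
  shows "bij_betw h {a \<in> A. p a = n \<and> q a = m} {b \<in> B. p' b = n \<and> q' b = m}"
  using assms by (force simp: bij_betw_def inj_on_def)

lemma gf_bij_betw:
  assumes "bij_betw h A B" "\<And>a. a \<in> A \<Longrightarrow> p' (h a) = p a" "\<And>a. a \<in> A \<Longrightarrow> q' (h a) = q a"
  shows "gf A p q = gf B p' q'"
  using bij_betw_same_card[OF bij_betw_fibres[where p' = p' and q' = q', OF assms]]
  by (simp add: fps_eq_iff)

lemma finite_fibres_bij_betw:
  assumes "bij_betw h A B" "\<And>a. a \<in> A \<Longrightarrow> p' (h a) = p a" "\<And>a. a \<in> A \<Longrightarrow> q' (h a) = q a"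
  shows "finite_fibres A p q \<longleftrightarrow> finite_fibres B p' q'"
  using bij_betw_finite[OF bij_betw_fibres[where p' = p' and q' = q', OF assms]]
  by (simp add: finite_fibres_def)

text \<open>Sorting pairs by the bidegree \<open>(i, j)\<close> of the first component gives a
  disjoint union of rectangles; both finiteness and the Cauchy product are read off from it.\<close>

lemma fibres_Times:
  fixes p q :: "'s \<Rightarrow> nat" and p' q' :: "'t \<Rightarrow> nat"
  shows "{s \<in> A \<times> B. p (fst s) + p' (snd s) = n \<and> q (fst s) + q' (snd s) = m} =
    (\<Union>(i, j)\<in>{..n} \<times> {..m}. {a \<in> A. p a = i \<and> q a = j} \<times> {b \<in> B. p' b = n - i \<and> q' b = m - j})"
  by auto

lemma finite_fibres_Times:
  assumes "finite_fibres A p q" "finite_fibres B p' q'"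
  shows "finite_fibres (A \<times> B) (\<lambda>s. p (fst s) + p' (snd s)) (\<lambda>s. q (fst s) + q' (snd s))"
  using assms unfolding finite_fibres_def fibres_Times by auto

lemma gf_Times:
  assumes "finite_fibres A p q" "finite_fibres B p' q'"
  shows "gf (A \<times> B) (\<lambda>s. p (fst s) + p' (snd s)) (\<lambda>s. q (fst s) + q' (snd s)) =
    gf A p q * gf B p' q'"
proof (intro fps_ext)
  fix n m
  let ?F = "\<lambda>i j. {a \<in> A. p a = i \<and> q a = j}" and ?F' = "\<lambda>i j. {b \<in> B. p' b = i \<and> q' b = j}"
  have "card {s \<in> A \<times> B. p (fst s) + p' (snd s) = n \<and> q (fst s) + q' (snd s) = m}
      = (\<Sum>(i, j)\<in>{..n} \<times> {..m}. card (?F i j \<times> ?F' (n - i) (m - j)))"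
    unfolding fibres_Times using assms
    by (subst card_UN_disjoint) (auto simp: finite_fibres_def case_prod_unfold)
  also have "\<dots> = (\<Sum>i\<le>n. \<Sum>j\<le>m. card (?F i j) * card (?F' (n - i) (m - j)))"
    by (simp add: card_cartesian_product sum.cartesian_product)
  finally show "gf (A \<times> B) (\<lambda>s. p (fst s) + p' (snd s)) (\<lambda>s. q (fst s) + q' (snd s)) $ n $ m
      = (gf A p q * gf B p' q') $ n $ m"
    by (simp add: fps_mult_nth fps_sum_nth atLeast0AtMost)
qed

lemma gf_PiE:
  assumes "finite I" and "\<And>i. i \<in> I \<Longrightarrow> finite_fibres (A i) (p i) (q i)"
  shows "finite_fibres (PiE I A) (\<lambda>f. \<Sum>i\<in>I. p i (f i)) (\<lambda>f. \<Sum>i\<in>I. q i (f i))"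
    and "gf (PiE I A) (\<lambda>f. \<Sum>i\<in>I. p i (f i)) (\<lambda>f. \<Sum>i\<in>I. q i (f i)) = (\<Prod>i\<in>I. gf (A i) (p i) (q i))"
proof -
  let ?p = "\<lambda>I f. \<Sum>i\<in>I. p i (f i)" and ?q = "\<lambda>I f. \<Sum>i\<in>I. q i (f i)"
  \<comment> \<open>Both claims share one induction, since the product formula for the next factor
    needs finite fibres of the product so far.\<close>
  have "finite_fibres (PiE I A) (?p I) (?q I) \<and>
      gf (PiE I A) (?p I) (?q I) = (\<Prod>i\<in>I. gf (A i) (p i) (q i))"
    using assms
  proof (induction I)
    case empty
    \<comment> \<open>The empty product has one element, of bidegree \<open>(0, 0)\<close>, hence
      the series 1.\<close>
    have "{s. s = (\<lambda>x. undefined) \<and> n = 0 \<and> m = 0} =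
        (if n = 0 \<and> m = 0 then {\<lambda>x. undefined} else {})" for n m :: nat
      by auto
    then show ?case
      by (auto simp: finite_fibres_def fps_eq_iff)
  next
    case (insert k I)
    let ?h = "\<lambda>(y, g). g(k := y)"
    have bij: "bij_betw ?h (A k \<times> PiE I A) (PiE (insert k I) A)"
      using insert.hyps by (simp add: bij_betw_def inj_combinator PiE_insert_eq)

    have weight: "(\<Sum>i\<in>insert k I. r i (?h s i)) = r k (fst s) + (\<Sum>i\<in>I. r i (snd s i))"
      for r :: "'a \<Rightarrow> 'b \<Rightarrow> nat" and s
      using insert.hyps by (auto simp: case_prod_unfold intro!: sum.cong)
    have IH: "finite_fibres (PiE I A) (?p I) (?q I)"
      "gf (PiE I A) (?p I) (?q I) = (\<Prod>i\<in>I. gf (A i) (p i) (q i))"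
      using insert.IH insert.prems by auto
    have k: "finite_fibres (A k) (p k) (q k)" using insert.prems by simp
    have "finite_fibres (PiE (insert k I) A) (?p (insert k I)) (?q (insert k I))"
      using finite_fibres_Times[OF k IH(1)]
      by (subst (asm) finite_fibres_bij_betw[OF bij]) (use weight in auto)
    moreover have "gf (PiE (insert k I) A) (?p (insert k I)) (?q (insert k I)) =
        gf (A k) (p k) (q k) * gf (PiE I A) (?p I) (?q I)"
      unfolding gf_Times[OF k IH(1), symmetric]
      by (rule gf_bij_betw[OF bij, symmetric]) (use weight in auto)
    ultimately show ?case
      using IH(2) insert.hyps by simp
  qed
  then show "finite_fibres (PiE I A) (?p I) (?q I)"
    "gf (PiE I A) (?p I) (?q I) = (\<Prod>i\<in>I. gf (A i) (p i) (q i))" by auto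
qed

section \<open>Scaled sizes and series of quotients\<close>

lemma fps_compose_X_power_nth:
  fixes f :: "'r::comm_ring_1 fps"
  assumes "k \<ge> 1"
  shows "fps_compose f (fps_X ^ k) $ n = (if k dvd n then f $ (n div k) else 0)"
proof -
  have "fps_compose f (fps_X ^ k) $ n = (\<Sum>i=0..n. if n = k * i then f $ i else 0)"
    by (simp add: fps_compose_nth flip: power_mult) (auto intro!: sum.cong)
  also have "\<dots> = (\<Sum>i | i \<in> {0..n} \<and> n = k * i. f $ i)"
    by (rule sum.inter_filter [symmetric]) simp
  also have "{i. i \<in> {0..n} \<and> n = k * i} = (if k dvd n then {n div k} else {})"
    using assms by auto
  finally show ?thesis by simp
qed

text \<open>One choice copied along a cycle of \<open>k\<close> edges contributes \<open>k\<close>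
  times to both sizes; this is how \<open>subst_pow k\<close> enters the count.\<close>

lemma subst_pow_gf:
  assumes "k \<ge> 1"
  shows "subst_pow k (gf S p q) = gf S (\<lambda>s. k * p s) (\<lambda>s. k * q s)"
proof (intro fps_ext)
  fix n m
  have "{s \<in> S. k * p s = n \<and> k * q s = m} =
      (if k dvd n \<and> k dvd m then {s \<in> S. p s = n div k \<and> q s = m div k} else {})"
    using assms by auto
  then show "subst_pow k (gf S p q) $ n $ m = gf S (\<lambda>s. k * p s) (\<lambda>s. k * q s) $ n $ m"
    using assms by (simp add: subst_pow_def fps_compose_X_power_nth)
qed

lemma X_power_mult_gf: "fps_X ^ c * gf S p q = gf S (\<lambda>s. c + p s) q"
proof (intro fps_ext)
  fix n m
  have "{s \<in> S. c + p s = n \<and> q s = m} = (if n < c then {} else {s \<in> S. p s = n - c \<and> q s = m})"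
    by auto
  then show "(fps_X ^ c * gf S p q) $ n $ m = gf S (\<lambda>s. c + p s) q $ n $ m"
    by (simp add: fps_X_power_mult_nth)
qed

text \<open>Turns the isomorphism classes themselves into the counted objects, so that they can
  serve as colours. The sizes must be invariant for every \<open>s'\<close> related to
  \<open>s\<close>, as the representative picked by SOME is known only to lie in the class.\<close>

lemma class_gf_eq_gf:
  assumes refl: "\<And>s. s \<in> S \<Longrightarrow> (s, s) \<in> R"
    and inv: "\<And>s s'. s \<in> S \<Longrightarrow> (s, s') \<in> R \<Longrightarrow> p s' = p s \<and> q s' = q s"
  shows "class_gf S R p q = gf (S // R) (\<lambda>C. p (SOME s. s \<in> C)) (\<lambda>C. q (SOME s. s \<in> C))"
proof -
  have some: "p (SOME t. t \<in> R `` {s}) = p s \<and> q (SOME t. t \<in> R `` {s}) = q s" if "s \<in> S" for s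
    using inv[OF that] someI[of "\<lambda>t. t \<in> R `` {s}" s] refl[OF that] by blast
  have "{s \<in> S. p s = n \<and> q s = m} // R =
      {C \<in> S // R. p (SOME s. s \<in> C) = n \<and> q (SOME s. s \<in> C) = m}" for n m
    using some by (auto simp: quotient_def)
  then show ?thesis by (simp add: class_gf_def gf_def)
qed

section \<open>Isomorphisms of graphs and networks\<close>

lemma simple_graph_edge_subset: "simple_graph G \<Longrightarrow> e \<in> edges G \<Longrightarrow> e \<subseteq> verts G"
  by (simp add: simple_graph_def)

lemma graph_iso_verts: "graph_iso f G H \<Longrightarrow> verts H = f ` verts G"
  and graph_iso_inj: "graph_iso f G H \<Longrightarrow> inj_on f (verts G)"
  and graph_iso_edges: "graph_iso f G H \<Longrightarrow> edges H = (\<lambda>e. f ` e) ` edges G"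
  by (auto simp: graph_iso_def bij_betw_def)

lemma graph_iso_id: "graph_iso id G G"
  by (simp add: graph_iso_def)

lemma graph_iso_comp:
  assumes "graph_iso f G H" "graph_iso g H K"
  shows "graph_iso (g \<circ> f) G K"
  using assms bij_betw_trans[of f "verts G" "verts H" g "verts K"]
  by (simp add: graph_iso_def graph_iso_edges[OF assms(1)] graph_iso_edges[OF assms(2)]
      image_image image_comp)

lemma graph_iso_cong:
  assumes "graph_iso f G H" "simple_graph G" "\<And>v. v \<in> verts G \<Longrightarrow> f v = g v"
  shows "graph_iso g G H"
proof -
  have "(\<lambda>e. f ` e) ` edges G = (\<lambda>e. g ` e) ` edges G"
    using assms(3) simple_graph_edge_subset[OF assms(2)] by (intro image_cong refl) (meson image_cong subsetD)
  then show ?thesis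
    using assms by (simp add: graph_iso_def bij_betw_cong[of _ f g])
qed

text \<open>Stated for any left inverse on the vertices, so that a single map can invert an
  isomorphism on a graph and on its core at once.\<close>

lemma graph_iso_inverse:
  assumes "graph_iso f G H" "simple_graph G" "\<And>v. v \<in> verts G \<Longrightarrow> g (f v) = v"
  shows "graph_iso g H G"
proof -
  have "g ` f ` e = e" if "e \<in> edges G" for e
    unfolding image_image using simple_graph_edge_subset[OF assms(2) that] assms(3)
    by (simp add: subset_iff)
  then have "(\<lambda>e. g ` e) ` edges H = edges G"
    unfolding graph_iso_edges[OF assms(1)] image_image[of "\<lambda>e. g ` e"] by simp
  moreover have "bij_betw g (verts H) (verts G)"
    unfolding graph_iso_verts[OF assms(1)] using assms(3) by (auto simp: bij_betw_def inj_on_def image_image)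
  ultimately show ?thesis by (simp add: graph_iso_def)
qed

lemma graph_iso_inv_into:
  assumes "graph_iso f G H" "simple_graph G"
  shows "graph_iso (inv_into (verts G) f) H G"
  using assms by (intro graph_iso_inverse[OF assms]) (auto simp: graph_iso_def bij_betw_def)

lemma graph_iso_simple:
  assumes "graph_iso f G H" "simple_graph G"
  shows "simple_graph H"
proof -
  have "f ` e \<subseteq> verts H \<and> card (f ` e) = 2" if "e \<in> edges G" for e
    using assms that unfolding graph_iso_def simple_graph_def bij_betw_def
    by (metis card_image image_mono inj_on_subset)
  moreover have "finite (verts H)"
    using assms by (auto simp: graph_iso_def simple_graph_def dest: bij_betw_finite)
  ultimately show ?thesis
    by (auto simp: simple_graph_def graph_iso_edges[OF assms(1)])
qed

lemma graph_iso_card_edges: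
  assumes "graph_iso f G H" "simple_graph G"
  shows "card (edges H) = card (edges G)"
proof -
  have "inj_on (\<lambda>e. f ` e) (edges G)"
    using inj_on_image_eq_iff[OF graph_iso_inj[OF assms(1)]] simple_graph_edge_subset[OF assms(2)]
    by (simp add: inj_on_def)
  then show ?thesis by (simp add: graph_iso_edges[OF assms(1)] card_image)
qed

lemma graph_iso_connected:
  assumes "graph_iso f G H" "graph_connected G"
  shows "graph_connected H"
proof -
  have step: "(f u, f v) \<in> {(a, b). {a, b} \<in> edges H}\<^sup>*" if "(u, v) \<in> {(a, b). {a, b} \<in> edges G}\<^sup>*" for u v
    using that
  proof induction
    case (step y z)
    have "f ` {y, z} \<in> edges H"
      unfolding graph_iso_edges[OF assms(1)] using step.hyps(2) by blast
    then show ?case using step.IH by (simp add: rtrancl.rtrancl_into_rtrancl)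
  qed simp
  have V: "verts H = f ` verts G" using assms(1) by (auto simp: graph_iso_def bij_betw_def)
  show ?thesis
    using assms(2) step unfolding graph_connected_def V by auto
qed

lemma graph_iso_del_vertex:
  assumes "graph_iso f G H" "simple_graph G" "v \<in> verts G"
  shows "graph_iso f (del_vertex v G) (del_vertex (f v) H)"
proof -
  have inj: "inj_on f (verts G)" and V: "f ` verts G = verts H"
    and E: "(\<lambda>e. f ` e) ` edges G = edges H"
    using assms(1) by (auto simp: graph_iso_def bij_betw_def)
  have "f v \<in> f ` e \<longleftrightarrow> v \<in> e" if "e \<in> edges G" for e
    using inj_on_image_mem_iff[OF inj assms(3) simple_graph_edge_subset[OF assms(2) that]] .
  then have "(\<lambda>e. f ` e) ` {e \<in> edges G. v \<notin> e} = {e \<in> edges H. f v \<notin> e}"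
    unfolding E[symmetric] by auto
  moreover have "f ` (verts G - {v}) = verts H - {f v}"
    using inj assms(3) by (auto simp: V[symmetric] inj_on_eq_iff)
  ultimately show ?thesis
    using inj by (simp add: graph_iso_def del_vertex_def bij_betw_def inj_on_diff)
qed

lemma graph_iso_add_edge:
  assumes "graph_iso f G H"
  shows "graph_iso f (add_edge u v G) (add_edge (f u) (f v) H)"
  using assms by (simp add: graph_iso_def add_edge_def)

lemma simple_graph_add_edge:
  assumes "simple_graph G" "u \<in> verts G" "v \<in> verts G" "u \<noteq> v"
  shows "simple_graph (add_edge u v G)"
  using assms by (simp add: simple_graph_def add_edge_def)

lemma graph_iso_two_connected:
  assumes "graph_iso f G H" "simple_graph G" "two_connected G"
  shows "two_connected H"
proof -
  have inj: "inj_on f (verts G)" and V: "f ` verts G = verts H"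
    and E: "(\<lambda>e. f ` e) ` edges G = edges H"
    using assms(1) by (auto simp: graph_iso_def bij_betw_def)
  have card: "card (verts H) = card (verts G)" using inj V card_image by metis
  have "graph_connected (del_vertex w H)"
    if "\<forall>v\<in>verts G. graph_connected (del_vertex v G)" "w \<in> verts H" for w
    using that graph_iso_connected[OF graph_iso_del_vertex[OF assms(1,2)]] by (auto simp: V[symmetric])
  moreover have "edges H = {verts H}" if "edges G = {verts G}"
    using that V E by auto
  ultimately show ?thesis
    using assms(3) graph_iso_connected[OF assms(1)] unfolding two_connected_def card by blast
qed

section \<open>Isomorphisms, opposites and relabelling of networks\<close>

lemma network_iso_id: "network_iso id N N"
  by (simp add: network_iso_def graph_iso_id)

lemma network_iso_comp: "network_iso f N M \<Longrightarrow> network_iso g M K \<Longrightarrow> network_iso (g \<circ> f) N K"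
  by (auto simp: network_iso_def graph_iso_comp)

lemma network_iso_inv_into:
  assumes "network_iso f N M" "network N"
  shows "network_iso (inv_into (verts (ngraph N)) f) M N"
proof -
  have "simple_graph (ngraph N)" "inj_on f (verts (ngraph N))"
    "pole0 N \<in> verts (ngraph N)" "pole1 N \<in> verts (ngraph N)"
    using assms by (auto simp: network_def network_iso_def graph_iso_def bij_betw_def)
  then show ?thesis
    using assms(1) graph_iso_inv_into[of f "ngraph N" "ngraph M"]
    by (auto simp: network_iso_def) (metis inv_into_f_f)+
qed

lemma network_iso_network:
  assumes "network_iso f N M" "network N"
  shows "network M"
proof -
  let ?G = "ngraph N" and ?H = "ngraph M"
  have iso: "graph_iso f ?G ?H" and p: "f (pole0 N) = pole0 M" "f (pole1 N) = pole1 M"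
    using assms(1) by (auto simp: network_iso_def)
  have N: "simple_graph ?G" "graph_connected ?G" "pole0 N \<in> verts ?G" "pole1 N \<in> verts ?G"
    "pole0 N \<noteq> pole1 N" "two_connected (add_edge (pole0 N) (pole1 N) ?G)"
    using assms(2) by (auto simp: network_def)
  have inj: "inj_on f (verts ?G)" "f ` verts ?G = verts ?H"
    using iso by (auto simp: graph_iso_def bij_betw_def)
  have "pole0 M \<in> verts ?H" "pole1 M \<in> verts ?H" "pole0 M \<noteq> pole1 M"
    using N(3-5) inj by (auto simp: p[symmetric] inj_on_eq_iff)
  moreover have "two_connected (add_edge (pole0 M) (pole1 M) ?H)"
    using graph_iso_two_connected[OF graph_iso_add_edge[OF iso] simple_graph_add_edge[OF N(1,3,4,5)] N(6)]
    by (simp add: p)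
  ultimately show ?thesis
    using graph_iso_simple[OF iso N(1)] graph_iso_connected[OF iso N(2)] by (simp add: network_def)
qed

lemma network_iso_rel_refl: "(N, N) \<in> network_iso_rel"
  using network_iso_id by (auto simp: network_iso_rel_def)

lemma network_iso_rel_sym: "(N, M) \<in> network_iso_rel \<Longrightarrow> network N \<Longrightarrow> (M, N) \<in> network_iso_rel"
  using network_iso_inv_into by (auto simp: network_iso_rel_def)

lemma network_iso_rel_trans:
  "(N, M) \<in> network_iso_rel \<Longrightarrow> (M, K) \<in> network_iso_rel \<Longrightarrow> (N, K) \<in> network_iso_rel"
  using network_iso_comp by (fastforce simp: network_iso_rel_def)

lemma network_iso_rel_class_eq:
  assumes "network N"
  shows "network_iso_rel `` {N} = network_iso_rel `` {M} \<longleftrightarrow> (N, M) \<in> network_iso_rel"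
  using network_iso_rel_refl[of M] network_iso_rel_sym[OF _ assms] network_iso_rel_trans by blast

lemma opposite_simps [simp]:
  "ngraph (opposite N) = ngraph N" "pole0 (opposite N) = pole1 N" "pole1 (opposite N) = pole0 N"
  "opposite (opposite N) = N" "internal (opposite N) = internal N"
  by (auto simp: opposite_def internal_def)

lemma network_iso_opposite: "network_iso f N M \<Longrightarrow> network_iso f (opposite N) (opposite M)"
  by (auto simp: network_iso_def)

lemma network_opposite: "network N \<Longrightarrow> network (opposite N)"
  by (auto simp: network_def add_edge_def insert_commute)

text \<open>Lets the exchange of poles act on isomorphism types as \<open>image opposite\<close>,
  which becomes the involution of the colours.\<close>

lemma opposite_class: "opposite ` (network_iso_rel `` {N}) = network_iso_rel `` {opposite N}"
proof
  show "opposite ` (network_iso_rel `` {N}) \<subseteq> network_iso_rel `` {opposite N}"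
    using network_iso_opposite by (auto simp: network_iso_rel_def)
  show "network_iso_rel `` {opposite N} \<subseteq> opposite ` (network_iso_rel `` {N})"
    using network_iso_opposite[of _ "opposite N"]
    by (force simp: network_iso_rel_def image_iff intro: exI[of _ "opposite _"])
qed

lemma network_iso_card:
  assumes "network_iso f N M" "network N"
  shows "card (internal M) = card (internal N)" "card (edges (ngraph M)) = card (edges (ngraph N))"
proof -
  have "bij_betw f (verts (ngraph N)) (verts (ngraph M))"
    using assms(1) by (simp add: network_iso_def graph_iso_def)
  moreover have "{pole0 N, pole1 N} \<subseteq> verts (ngraph N)" using assms(2) by (simp add: network_def)
  moreover have "f ` {pole0 N, pole1 N} = {pole0 M, pole1 M}"
    using assms(1) by (simp add: network_iso_def)
  ultimately have "bij_betw f (internal N) (internal M)"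
    unfolding internal_def bij_betw_def
    by (metis (no_types, lifting) Diff_subset inj_on_image_set_diff inj_on_subset)
  then show "card (internal M) = card (internal N)" by (simp add: bij_betw_same_card)
  show "card (edges (ngraph M)) = card (edges (ngraph N))"
    using assms graph_iso_card_edges by (auto simp: network_iso_def network_def)
qed

text \<open>Serves two ends: planting networks on the arcs of a core with prescribed internal
  vertices, and moving all networks of one size to a common vertex set, where finiteness of the
  number of types is visible.\<close>

lemma relabel_network:
  assumes N: "network N" and A: "finite A" "card A = card (internal N)" "a \<notin> A" "b \<notin> A" "a \<noteq> b"
  obtains M f where "network M" "network_iso f N M" "pole0 M = a" "pole1 M = b" "internal M = A"
    "verts (ngraph M) = insert a (insert b A)"
proof -
  have fin: "finite (internal N)" and p: "pole0 N \<noteq> pole1 N"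
    "verts (ngraph N) = insert (pole0 N) (insert (pole1 N) (internal N))"
    using N by (auto simp: network_def simple_graph_def internal_def)
  obtain h where h: "bij_betw h (internal N) A" using finite_same_card_bij[OF fin A(1)] A(2) by auto
  define f where "f = h(pole0 N := a, pole1 N := b)"
  define M where "M = Network (Graph (insert a (insert b A)) ((\<lambda>e. f ` e) ` edges (ngraph N))) a b"
  have f: "f (pole0 N) = a" "f (pole1 N) = b" using p(1) by (auto simp: f_def)
  have "bij_betw f (internal N) A"
    using h by (subst bij_betw_cong[of _ f h]) (auto simp: f_def internal_def)
  then have "bij_betw f (insert (pole1 N) (internal N)) (insert b A)"
    using f A(4) notIn_Un_bij_betw[of "pole1 N" "internal N" f A] by (simp add: internal_def)
  then have "bij_betw f (insert (pole0 N) (insert (pole1 N) (internal N))) (insert a (insert b A))"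
    using f A p(1) notIn_Un_bij_betw[of "pole0 N" "insert (pole1 N) (internal N)" f "insert b A"]
    by (simp add: internal_def)
  then have iso: "network_iso f N M"
    using f p(2) by (simp add: network_iso_def graph_iso_def M_def)
  show ?thesis
  proof (rule that[OF network_iso_network[OF iso N] iso])
    show "internal M = A" using A(3,4) by (auto simp: M_def internal_def)
  qed (simp_all add: M_def)
qed

section \<open>Substitution along arcs\<close>

definition ends :: "'a \<times> 'a \<Rightarrow> 'a set" where
  "ends p = {fst p, snd p}"

definition arcs :: "'a graph \<Rightarrow> ('a \<times> 'a) set" where
  "arcs G = {p. ends p \<in> edges G}"

definition arc_of :: "'a set \<Rightarrow> 'a \<times> 'a" where
  "arc_of e = (SOME p. ends p = e)"

text \<open>Substitution with a network for each direction of a core edge, the two being opposite to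
  each other. No orientation is chosen, and an isomorphism of cores acts on the index set
  directly.\<close>

definition arc_subst :: "'a graph \<Rightarrow> ('a \<times> 'a \<Rightarrow> 'a network) \<Rightarrow> 'a graph \<Rightarrow> bool" where
  "arc_subst H M G \<longleftrightarrow>
     (\<forall>p\<in>arcs H. network (M p) \<and> pole0 (M p) = fst p \<and> pole1 (M p) = snd p \<and>
        M (prod.swap p) = opposite (M p) \<and> internal (M p) \<inter> verts H = {}) \<and>
     (\<forall>p\<in>arcs H. \<forall>q\<in>arcs H. ends p \<noteq> ends q \<longrightarrow> internal (M p) \<inter> internal (M q) = {}) \<and>
     verts G = verts H \<union> (\<Union>p\<in>arcs H. internal (M p)) \<and>
     edges G = (\<Union>p\<in>arcs H. edges (ngraph (M p)))"

lemma ends_swap [simp]: "ends (prod.swap p) = ends p"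
  by (auto simp: ends_def)

lemma ends_map_prod [simp]: "ends (map_prod f f p) = f ` ends p"
  by (auto simp: ends_def)

lemma ends_eq_iff: "ends p = ends q \<longleftrightarrow> p = q \<or> p = prod.swap q"
  by (cases p; cases q) (auto simp: ends_def doubleton_eq_iff)

lemma swap_in_arcs [simp]: "prod.swap p \<in> arcs G \<longleftrightarrow> p \<in> arcs G"
  by (simp add: arcs_def)

lemma ends_arc_of:
  assumes "simple_graph G" "e \<in> edges G"
  shows "ends (arc_of e) = e"
proof -
  obtain a b where "e = {a, b}" using assms by (auto simp: simple_graph_def card_2_iff)
  then have "ends (a, b) = e" by (simp add: ends_def)
  then show ?thesis unfolding arc_of_def by (rule someI)
qed

lemma arc_of_in_arcs:
  assumes "simple_graph G" "e \<in> edges G"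
  shows "arc_of e \<in> arcs G"
  using assms ends_arc_of[OF assms] by (simp add: arcs_def)

lemma ends_image_arcs:
  assumes "simple_graph G"
  shows "ends ` arcs G = edges G"
proof
  show "edges G \<subseteq> ends ` arcs G"
    using ends_arc_of[OF assms] arc_of_in_arcs[OF assms] by (metis image_eqI subsetI)
qed (auto simp: arcs_def)

lemma arc_neq:
  assumes "simple_graph G" "p \<in> arcs G"
  shows "fst p \<noteq> snd p"
  using assms by (auto simp: simple_graph_def arcs_def ends_def)

lemma ends_subset_verts:
  assumes "simple_graph G" "p \<in> arcs G"
  shows "ends p \<subseteq> verts G"
  using assms by (auto simp: simple_graph_def arcs_def)

lemma arc_in_verts:
  assumes "simple_graph G" "p \<in> arcs G"
  shows "fst p \<in> verts G" "snd p \<in> verts G"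
  using ends_subset_verts[OF assms] by (auto simp: ends_def)

lemma arc_cases:
  assumes "simple_graph G" "p \<in> arcs G"
  obtains "p = arc_of (ends p)" | "p = prod.swap (arc_of (ends p))"
proof -
  have "ends p = ends (arc_of (ends p))"
    using ends_arc_of[OF assms(1), of "ends p"] assms(2) by (simp add: arcs_def)
  then show ?thesis using that unfolding ends_eq_iff[of p "arc_of (ends p)"] by blast
qed

lemma map_prod_in_arcs: "graph_iso f G H \<Longrightarrow> p \<in> arcs G \<Longrightarrow> map_prod f f p \<in> arcs H"
  by (auto simp: arcs_def graph_iso_edges)

lemma finite_arcs:
  assumes "simple_graph G"
  shows "finite (arcs G)"
proof -
  have "arcs G \<subseteq> verts G \<times> verts G" using arc_in_verts[OF assms] by (auto simp: mem_Times_iff)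
  then show ?thesis using assms finite_subset by (fastforce simp: simple_graph_def)
qed

lemma simple_graph_finite_edges:
  assumes "simple_graph G"
  shows "finite (edges G)"
proof -
  have "edges G \<subseteq> Pow (verts G)" using assms by (auto simp: simple_graph_def)
  then show ?thesis using assms finite_subset by (fastforce simp: simple_graph_def)
qed

lemma network_verts: "network N \<Longrightarrow> verts (ngraph N) = {pole0 N, pole1 N} \<union> internal N"
  by (auto simp: network_def internal_def)

lemma arc_substD:
  assumes "arc_subst H M G"
  shows "p \<in> arcs H \<Longrightarrow> network (M p)"
    and "p \<in> arcs H \<Longrightarrow> pole0 (M p) = fst p"
    and "p \<in> arcs H \<Longrightarrow> pole1 (M p) = snd p"
    and "p \<in> arcs H \<Longrightarrow> M (prod.swap p) = opposite (M p)"
    and "p \<in> arcs H \<Longrightarrow> internal (M p) \<inter> verts H = {}"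
    and "p \<in> arcs H \<Longrightarrow> q \<in> arcs H \<Longrightarrow> ends p \<noteq> ends q \<Longrightarrow> internal (M p) \<inter> internal (M q) = {}"
    and "verts G = verts H \<union> (\<Union>p\<in>arcs H. internal (M p))"
    and "edges G = (\<Union>p\<in>arcs H. edges (ngraph (M p)))"
  using assms by (auto simp: arc_subst_def)

lemma arc_subst_verts_network:
  assumes "arc_subst H M G" "p \<in> arcs H"
  shows "verts (ngraph (M p)) = ends p \<union> internal (M p)"
  using network_verts[of "M p"] arc_substD(1-3)[OF assms(1,2)] by (simp add: ends_def)

lemma arc_subst_same_ends:
  assumes "arc_subst H M G" "p \<in> arcs H" "q \<in> arcs H" "ends p = ends q"
  shows "internal (M p) = internal (M q)" "ngraph (M p) = ngraph (M q)"
  using arc_substD(4)[OF assms(1,3)] assms(4) unfolding ends_eq_iff by (elim disjE; simp)+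

lemma arc_subst_verts_Int:
  assumes "arc_subst H M G" "simple_graph H" "p \<in> arcs H" "q \<in> arcs H" "ends p \<noteq> ends q"
  shows "verts (ngraph (M p)) \<inter> verts (ngraph (M q)) \<subseteq> ends p \<inter> ends q"
  using arc_substD(5)[OF assms(1)] arc_substD(6)[OF assms(1,3,4,5)] assms(3,4)
    ends_subset_verts[OF assms(2)]
  unfolding arc_subst_verts_network[OF assms(1,3)] arc_subst_verts_network[OF assms(1,4)] by blast

text \<open>Networks on distinct core edges share only common ends of these edges, hence at most one
  vertex, while an edge of a network has two.\<close>

lemma arc_subst_edge_ends:
  assumes "arc_subst H M G" "simple_graph H" "p \<in> arcs H" "q \<in> arcs H"
    and "x \<subseteq> verts (ngraph (M p))" "x \<in> edges (ngraph (M q))"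
  shows "ends p = ends q"
proof (rule ccontr)
  assume neq: "ends p \<noteq> ends q"
  have x: "x \<subseteq> verts (ngraph (M q))" "card x = 2"
    using arc_substD(1)[OF assms(1,4)] assms(6) by (auto simp: network_def simple_graph_def)
  then have "x \<subseteq> ends p" "x \<subseteq> ends q"
    using arc_subst_verts_Int[OF assms(1-4) neq] assms(5) by auto
  moreover have "card (ends p) = 2" "card (ends q) = 2"
    using assms(2-4) by (auto simp: arcs_def simple_graph_def)
  ultimately show False using x(2) neq card_subset_eq[of "ends p" x] card_subset_eq[of "ends q" x]
    by (metis card.infinite zero_neq_numeral)
qed

text \<open>No foreign network has an edge inside these vertices, so each network is an induced
  subgraph of \<open>G\<close>: its vertex set determines it.\<close>

lemma arc_subst_edges_induced:
  assumes "arc_subst H M G" "simple_graph H" "p \<in> arcs H"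
  shows "edges (ngraph (M p)) = {e \<in> edges G. e \<subseteq> verts (ngraph (M p))}"
proof
  show "edges (ngraph (M p)) \<subseteq> {e \<in> edges G. e \<subseteq> verts (ngraph (M p))}"
    using arc_substD(1)[OF assms(1,3)] arc_substD(8)[OF assms(1)] assms(3)
      simple_graph_edge_subset[of "ngraph (M p)"]
    unfolding network_def by blast
  show "{e \<in> edges G. e \<subseteq> verts (ngraph (M p))} \<subseteq> edges (ngraph (M p))"
  proof safe
    fix e assume e: "e \<in> edges G" "e \<subseteq> verts (ngraph (M p))"
    then obtain q where q: "q \<in> arcs H" "e \<in> edges (ngraph (M q))"
      using arc_substD(8)[OF assms(1)] by auto
    then show "e \<in> edges (ngraph (M p))"
      using arc_subst_same_ends(2)[OF assms(1,3) q(1)] arc_subst_edge_ends[OF assms q(1) e(2) q(2)]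
      by simp
  qed
qed

lemma UN_arcs:
  assumes "simple_graph H" "\<And>p q. p \<in> arcs H \<Longrightarrow> q \<in> arcs H \<Longrightarrow> ends p = ends q \<Longrightarrow> F p = F q"
  shows "(\<Union>p\<in>arcs H. F p) = (\<Union>e\<in>edges H. F (arc_of e))"
proof
  show "(\<Union>p\<in>arcs H. F p) \<subseteq> (\<Union>e\<in>edges H. F (arc_of e))"
  proof
    fix x assume "x \<in> (\<Union>p\<in>arcs H. F p)"
    then obtain p where p: "p \<in> arcs H" "x \<in> F p" by blast
    then have e: "ends p \<in> edges H" by (simp add: arcs_def)
    then have "F p = F (arc_of (ends p))"
      using assms(2)[OF p(1) arc_of_in_arcs[OF assms(1) e]] ends_arc_of[OF assms(1) e] by simp
    then show "x \<in> (\<Union>e\<in>edges H. F (arc_of e))" using p(2) e by blast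
  qed
  show "(\<Union>e\<in>edges H. F (arc_of e)) \<subseteq> (\<Union>p\<in>arcs H. F p)"
    using arc_of_in_arcs[OF assms(1)] by blast
qed

lemma arc_subst_verts:
  assumes "arc_subst H M G" "simple_graph H"
  shows "verts G = verts H \<union> (\<Union>e\<in>edges H. internal (M (arc_of e)))"
  unfolding arc_substD(7)[OF assms(1)]
  by (simp only: UN_arcs[OF assms(2), of "\<lambda>p. internal (M p)", OF arc_subst_same_ends(1)[OF assms(1)]])

lemma arc_subst_edges:
  assumes "arc_subst H M G" "simple_graph H"
  shows "edges G = (\<Union>e\<in>edges H. edges (ngraph (M (arc_of e))))"
  unfolding arc_substD(8)[OF assms(1)]
  by (rule UN_arcs[OF assms(2)]) (rule arg_cong[OF arc_subst_same_ends(2)[OF assms(1)]])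

lemma arc_subst_simple:
  assumes "arc_subst H M G" "simple_graph H"
  shows "simple_graph G"
proof -
  have net: "simple_graph (ngraph (M p))" if "p \<in> arcs H" for p
    using arc_substD(1)[OF assms(1) that] by (simp add: network_def)
  then have "finite (internal (M p))" if "p \<in> arcs H" for p
    using that by (simp add: simple_graph_def internal_def)
  then have "finite (verts G)"
    using assms(2) finite_arcs[OF assms(2)] arc_substD(7)[OF assms(1)] by (simp add: simple_graph_def)
  moreover have "verts (ngraph (M p)) \<subseteq> verts G" if "p \<in> arcs H" for p
    using that ends_subset_verts[OF assms(2) that] arc_subst_verts_network[OF assms(1) that]
      arc_substD(7)[OF assms(1)] by auto
  ultimately show ?thesis
    using net arc_substD(8)[OF assms(1)] unfolding simple_graph_def
    by (metis (no_types, lifting) UN_E subset_trans)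
qed

lemma arc_subst_card:
  assumes "arc_subst H M G" "simple_graph H"
  shows "card (verts G) = card (verts H) + (\<Sum>e\<in>edges H. card (internal (M (arc_of e))))"
    and "card (edges G) = (\<Sum>e\<in>edges H. card (edges (ngraph (M (arc_of e)))))"
proof -
  note arc = arc_of_in_arcs[OF assms(2)] and E = ends_arc_of[OF assms(2)]
  have fin: "finite (internal (M (arc_of e)))" "finite (edges (ngraph (M (arc_of e))))"
    if "e \<in> edges H" for e
  proof -
    have "simple_graph (ngraph (M (arc_of e)))"
      using arc_substD(1)[OF assms(1) arc[OF that]] by (simp add: network_def)
    then show "finite (internal (M (arc_of e)))" "finite (edges (ngraph (M (arc_of e))))"
      using simple_graph_finite_edges by (auto simp: simple_graph_def internal_def)
  qed
  have "card (\<Union>e\<in>edges H. internal (M (arc_of e))) = (\<Sum>e\<in>edges H. card (internal (M (arc_of e))))"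
    using simple_graph_finite_edges[OF assms(2)] fin arc E arc_substD(6)[OF assms(1)]
    by (intro card_UN_disjoint) auto
  moreover have "verts H \<inter> (\<Union>e\<in>edges H. internal (M (arc_of e))) = {}"
    using arc arc_substD(5)[OF assms(1)] by blast
  ultimately show "card (verts G) = card (verts H) + (\<Sum>e\<in>edges H. card (internal (M (arc_of e))))"
    unfolding arc_subst_verts[OF assms] using assms(2) simple_graph_finite_edges[OF assms(2)] fin
    by (subst card_Un_disjoint) (auto simp: simple_graph_def)
  have "edges (ngraph (M (arc_of e))) \<inter> edges (ngraph (M (arc_of d))) = {}"
    if "e \<in> edges H" "d \<in> edges H" "e \<noteq> d" for e d
    using arc_subst_edge_ends[OF assms arc[OF that(1)] arc[OF that(2)]] E that
      arc_subst_edges_induced[OF assms arc[OF that(1)]] by blast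
  then show "card (edges G) = (\<Sum>e\<in>edges H. card (edges (ngraph (M (arc_of e)))))"
    unfolding arc_subst_edges[OF assms] using simple_graph_finite_edges[OF assms(2)] fin
    by (intro card_UN_disjoint) auto
qed

lemma arc_subst_of_substitution:
  assumes "is_substitution H N G" "\<And>e. e \<in> edges H \<Longrightarrow> N e \<in> \<N>" "simple_graph H"
    and "network_species \<N>" "symmetric_networks \<N>"
  shows "\<exists>M. arc_subst H M G \<and> (\<forall>p\<in>arcs H. M p \<in> \<N>)"
proof -
  \<comment> \<open>The poles of \<open>N (ends p)\<close> are the two distinct ends of
    \<open>p\<close>, so exactly one of the network and its opposite is oriented along
    \<open>p\<close>.\<close>
  define M where "M p = (if pole0 (N (ends p)) = fst p then N (ends p) else opposite (N (ends p)))" for p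
  have net: "M p \<in> \<N>" if "p \<in> arcs H" for p
    using that assms(2,5) by (simp add: M_def arcs_def symmetric_networks_def)
  have sub: "{pole0 (N e), pole1 (N e)} = e" "internal (N e) \<inter> verts H = {}" if "e \<in> edges H" for e
    using assms(1) that by (auto simp: is_substitution_def)
  have poles: "pole0 (M p) = fst p \<and> pole1 (M p) = snd p \<and> M (prod.swap p) = opposite (M p)"
    if "p \<in> arcs H" for p
    using sub(1)[of "ends p"] that arc_neq[OF assms(3) that]
    by (auto simp: M_def arcs_def) (auto simp: ends_def doubleton_eq_iff)
  have disj: "internal (N e) \<inter> internal (N d) = {}" if "e \<in> edges H" "d \<in> edges H" "e \<noteq> d" for e d
    using assms(1) that by (auto simp: is_substitution_def disjoint_family_on_def)
  have int: "internal (M p) = internal (N (ends p))" and gr: "ngraph (M p) = ngraph (N (ends p))" for p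
    by (simp_all add: M_def)
  have "verts G = verts H \<union> (\<Union>p\<in>arcs H. internal (M p))"
    "edges G = (\<Union>p\<in>arcs H. edges (ngraph (M p)))"
    using assms(1) unfolding int gr is_substitution_def ends_image_arcs[OF assms(3), symmetric]
    by simp_all
  then have "arc_subst H M G"
    unfolding arc_subst_def using net poles sub(2) disj assms(4)
    by (simp add: int network_species_def arcs_def)
  then show ?thesis using net by blast
qed

lemma substitution_of_arc_subst:
  assumes "arc_subst H M G" "simple_graph H"
  shows "is_substitution H (\<lambda>e. M (arc_of e)) G"
proof -
  note D = arc_substD(1-6)[OF assms(1) arc_of_in_arcs[OF assms(2)]]
  have "{pole0 (M (arc_of e)), pole1 (M (arc_of e))} = e" if "e \<in> edges H" for e
    using D(2,3)[OF that] ends_arc_of[OF assms(2) that] by (simp add: ends_def)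
  moreover have "internal (M (arc_of e)) \<inter> internal (M (arc_of d)) = {}"
    if "e \<in> edges H" "d \<in> edges H" "e \<noteq> d" for e d
    using D(6)[OF that(1) arc_of_in_arcs[OF assms(2) that(2)]] that ends_arc_of[OF assms(2)] by simp
  ultimately show ?thesis
    unfolding is_substitution_def disjoint_family_on_def
    using arc_substD(5)[OF assms(1) arc_of_in_arcs[OF assms(2)]] arc_subst_verts[OF assms]
      arc_subst_edges[OF assms] by simp
qed

section \<open>Decomposition, gluing and existence\<close>

text \<open>Two-connectedness enters the decomposition here: deleting the other pole from the graph
  with the added edge leaves it connected. The version for \<open>pole1\<close> comes from the
  reversed arc.\<close>

lemma path_to_pole0:
  assumes "network N" "v \<in> internal N"
  shows "(v, pole0 N) \<in> {(x, y). {x, y} \<in> edges (ngraph N) \<and> pole1 N \<notin> {x, y}}\<^sup>*"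
proof -
  let ?G = "add_edge (pole0 N) (pole1 N) (ngraph N)"
  have fin: "finite (verts (ngraph N))" and p: "pole0 N \<in> verts ?G" "pole1 N \<in> verts ?G"
    "pole0 N \<noteq> pole1 N" and tc: "two_connected ?G"
    using assms(1) by (auto simp: network_def simple_graph_def add_edge_def)
  have v: "v \<in> verts ?G" "v \<noteq> pole0 N" "v \<noteq> pole1 N"
    using assms(2) by (auto simp: internal_def add_edge_def)
  \<comment> \<open>The internal vertex \<open>v\<close> is a third vertex, which excludes the
    \<open>K_2\<close> case of \<open>two_connected\<close>.\<close>
  have "card {pole0 N, pole1 N, v} \<le> card (verts ?G)"
    using fin p v by (intro card_mono) (auto simp: add_edge_def)
  then have "card (verts ?G) \<noteq> 2" using p(3) v by simp
  then have "graph_connected (del_vertex (pole1 N) ?G)"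
    using tc p(2) by (auto simp: two_connected_def)
  then have "(v, pole0 N) \<in> {(a, b). {a, b} \<in> edges (del_vertex (pole1 N) ?G)}\<^sup>*"
    using p v by (auto simp: graph_connected_def del_vertex_def)
  \<comment> \<open>The added edge contains \<open>pole1 N\<close> and disappears with it, so the
    path runs in the network itself.\<close>
  moreover have "{(a, b). {a, b} \<in> edges (del_vertex (pole1 N) ?G)} =
      {(x, y). {x, y} \<in> edges (ngraph N) \<and> pole1 N \<notin> {x, y}}"
    by (auto simp: del_vertex_def add_edge_def)
  ultimately show ?thesis by simp
qed

text \<open>Following a path inside the network of \<open>p\<close> that avoids the second pole, the image cannot leave
  the network of \<open>q\<close> before the path reaches the first pole.\<close>

lemma image_of_pole:
  assumes M: "arc_subst H M G" and M': "arc_subst H' M' G'" and H: "simple_graph H" "simple_graph H'"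
    and f: "graph_iso f G G'" "graph_iso f H H'"
    and p: "p \<in> arcs H" "v \<in> internal (M p)" and q: "q \<in> arcs H'" "f v \<in> internal (M' q)"
  shows "f (fst p) \<in> ends q"
proof (rule ccontr)
  assume a: "f (fst p) \<notin> ends q"
  have poles: "pole0 (M p) = fst p" "pole1 (M p) = snd p" "network (M p)"
    using arc_substD[OF M] p(1) by auto
  have HG: "verts H \<subseteq> verts G" using arc_substD(7)[OF M] by auto
  have inj: "inj_on f (verts G)" using f(1) by (rule graph_iso_inj)
  have "f x \<in> internal (M' q)"
    if "(v, x) \<in> {(x, y). {x, y} \<in> edges (ngraph (M p)) \<and> pole1 (M p) \<notin> {x, y}}\<^sup>*" for x
    using that
  proof induction
    case base then show ?case using q(2) .
  next
    case (step x y)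
    have e: "{x, y} \<in> edges (ngraph (M p))" "y \<noteq> snd p" using step.hyps(2) poles by auto
    then have "{x, y} \<in> edges G" using arc_substD(8)[OF M] p(1) by auto
    then have "f ` {x, y} \<in> edges G'" using f(1) by (simp only: graph_iso_edges imageI)
    then obtain r where r: "r \<in> arcs H'" "{f x, f y} \<in> edges (ngraph (M' r))"
      using arc_substD(8)[OF M'] by auto
    have rv: "{f x, f y} \<subseteq> verts (ngraph (M' r))"
      using arc_substD(1)[OF M' r(1)] r(2) simple_graph_edge_subset by (fastforce simp: network_def)
    \<comment> \<open>\<open>f x\<close> lies outside the core, and networks of distinct core edges
      meet only in core vertices; so the edge at \<open>f x\<close> belongs to the network of
      \<open>q\<close>.\<close>
    have "f x \<notin> verts H'" using step.IH arc_substD(5)[OF M' q(1)] by auto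
    then have "ends r = ends q"
      using arc_subst_verts_Int[OF M' H(2) r(1) q(1)] rv step.IH ends_subset_verts[OF H(2) q(1)]
        arc_subst_verts_network[OF M' q(1)] by blast
    then have fy: "f y \<in> ends q \<union> internal (M' q)"
      using rv arc_subst_verts_network[OF M' r(1)] arc_subst_same_ends(1)[OF M' r(1) q(1)] by auto
    have y: "y \<in> ends p \<union> internal (M p)"
      using e(1) arc_subst_verts_network[OF M p(1)] simple_graph_edge_subset[of "ngraph (M p)"] poles(3)
      by (auto simp: network_def)
    show ?case
    proof (rule ccontr)
      assume "f y \<notin> internal (M' q)"
      then have fyq: "f y \<in> ends q" using fy by blast
      then have "f y \<in> verts H'" using ends_subset_verts[OF H(2) q(1)] by blast
      then obtain z where z: "z \<in> verts H" "f y = f z" using graph_iso_verts[OF f(2)] by auto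
      have "y \<in> verts G"
        using y ends_subset_verts[OF H(1) p(1)] HG arc_substD(7)[OF M] p(1) by auto
      then have "y = z" using inj z HG by (auto simp: inj_on_def)
      then have "y \<in> ends p" using y z(1) arc_substD(5)[OF M p(1)] by auto
      then have "y = fst p" using e(2) by (auto simp: ends_def)
      then show False using fyq a by simp
    qed
  qed
  \<comment> \<open>The path ends at the first pole, whose image would thus be internal to the
    network of \<open>q\<close>; but an isomorphism of the cores sends it into
    \<open>H'\<close>.\<close>
  then have "f (fst p) \<in> internal (M' q)" using path_to_pole0[OF poles(3) p(2)] poles(1) by simp
  moreover have "f (fst p) \<in> verts H'"
    using arc_in_verts[OF H(1) p(1)] graph_iso_verts[OF f(2)] by auto
  ultimately show False using arc_substD(5)[OF M' q(1)] by auto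
qed

text \<open>An internal vertex sent into the network of \<open>q\<close> drags the first pole of
  \<open>p\<close> to an end of \<open>q\<close>; read on the reversed arc, it does the same with
  the second pole. The two images differ, so they are both ends of \<open>q\<close>, and
  \<open>q\<close> is the image of \<open>p\<close> up to direction.\<close>

lemma image_internal_subset:
  assumes M: "arc_subst H M G" and M': "arc_subst H' M' G'" and H: "simple_graph H" "simple_graph H'"
    and f: "graph_iso f G G'" "graph_iso f H H'" and p: "p \<in> arcs H"
  shows "f ` internal (M p) \<subseteq> internal (M' (map_prod f f p))"
proof safe
  fix v assume v: "v \<in> internal (M p)"
  have HG: "verts H \<subseteq> verts G" using arc_substD(7)[OF M] by auto
  have inj: "inj_on f (verts G)" using f(1) by (rule graph_iso_inj)
  have vG: "v \<in> verts G" using v arc_substD(7)[OF M] p by auto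
  then have "f v \<in> verts G'" using graph_iso_verts[OF f(1)] by auto
  moreover have "f v \<notin> verts H'"
  proof
    assume "f v \<in> verts H'"
    then obtain z where "z \<in> verts H" "f v = f z" using graph_iso_verts[OF f(2)] by auto
    then have "v \<in> verts H" using inj HG vG by (auto simp: inj_on_def)
    then show False using arc_substD(5)[OF M p] v by auto
  qed
  ultimately obtain q where q: "q \<in> arcs H'" "f v \<in> internal (M' q)"
    using arc_substD(7)[OF M'] by auto
  have swap: "prod.swap p \<in> arcs H" "v \<in> internal (M (prod.swap p))"
    using p v arc_substD(4)[OF M p] by simp_all
  have "f (fst p) \<in> ends q" "f (snd p) \<in> ends q"
    using image_of_pole[OF M M' H f p v q] image_of_pole[OF M M' H f swap q] by simp_all
  moreover have "f (fst p) \<noteq> f (snd p)"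
    using inj HG arc_in_verts[OF H(1) p] arc_neq[OF H(1) p] by (auto simp: inj_on_def)
  ultimately have "ends (map_prod f f p) = ends q"
    by (cases p; cases q) (auto simp: ends_def)
  then show "f v \<in> internal (M' (map_prod f f p))"
    using q arc_subst_same_ends(1)[OF M' map_prod_in_arcs[OF f(2) p] q(1)] by simp
qed

text \<open>Internal vertices go to internal vertices under \<open>f\<close> and under its inverse,
  so the interiors correspond exactly. As networks are induced subgraphs, their edges
  follow.\<close>

lemma arc_subst_unique:
  assumes M: "arc_subst H M G" and M': "arc_subst H' M' G'" and H: "simple_graph H"
    and f: "graph_iso f G G'" "graph_iso f H H'" and p: "p \<in> arcs H"
  shows "network_iso f (M p) (M' (map_prod f f p))"
proof -
  let ?q = "map_prod f f p"
  note q = map_prod_in_arcs[OF f(2) p]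
  have H': "simple_graph H'" using graph_iso_simple[OF f(2) H] .
  have G: "simple_graph G" using arc_subst_simple[OF M H] .
  have HG: "verts H \<subseteq> verts G" using arc_substD(7)[OF M] by auto
  have inj: "inj_on f (verts G)" using f(1) by (rule graph_iso_inj)
  let ?g = "inv_into (verts G) f"
  have g: "graph_iso ?g G' G" "graph_iso ?g H' H"
    using graph_iso_inv_into[OF f(1) G] graph_iso_inverse[OF f(2) H, of ?g] inj HG
    by (auto simp: subset_iff)
  have gq: "map_prod ?g ?g ?q = p"
    using arc_in_verts[OF H p] HG inj by (cases p) auto
  have sub: "internal (M p) \<subseteq> verts G" using arc_substD(7)[OF M] p by auto
  have q_sub: "internal (M' ?q) \<subseteq> f ` verts G"
    using arc_substD(7)[OF M'] q graph_iso_verts[OF f(1)] by auto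
  have "?g ` internal (M' ?q) \<subseteq> internal (M p)"
    using image_internal_subset[OF M' M H' H g q] by (simp only: gq)
  then have "f ` ?g ` internal (M' ?q) \<subseteq> f ` internal (M p)" by blast
  then have int: "f ` internal (M p) = internal (M' ?q)"
    using image_internal_subset[OF M M' H H' f p] q_sub by (simp add: image_inv_into_cancel)
  have V: "f ` verts (ngraph (M p)) = verts (ngraph (M' ?q))"
    unfolding arc_subst_verts_network[OF M p] arc_subst_verts_network[OF M' q] image_Un int by simp
  have VG: "verts (ngraph (M p)) \<subseteq> verts G"
    using arc_subst_verts_network[OF M p] sub ends_subset_verts[OF H p] HG by auto
  have "f ` e \<subseteq> f ` verts (ngraph (M p)) \<longleftrightarrow> e \<subseteq> verts (ngraph (M p))" if "e \<in> edges G" for e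
    using inj_on_image_mem_iff[OF inj _ VG] simple_graph_edge_subset[OF G that] by blast
  then have "(\<lambda>e. f ` e) ` {e \<in> edges G. e \<subseteq> verts (ngraph (M p))} =
      {e \<in> edges G'. e \<subseteq> f ` verts (ngraph (M p))}"
    unfolding graph_iso_edges[OF f(1)] by auto
  then have E: "(\<lambda>e. f ` e) ` edges (ngraph (M p)) = edges (ngraph (M' ?q))"
    unfolding arc_subst_edges_induced[OF M H p] arc_subst_edges_induced[OF M' H' q] V .
  have "bij_betw f (verts (ngraph (M p))) (verts (ngraph (M' ?q)))"
    using V inj_on_subset[OF inj VG] by (simp add: bij_betw_def)
  then show ?thesis
    using E arc_substD(2,3)[OF M p] arc_substD(2,3)[OF M' q] by (simp add: network_iso_def graph_iso_def)
qed

text \<open>Isomorphisms of the single networks agree with \<open>s\<close> at the poles, and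
  distinct networks overlap only in core vertices; so they combine with \<open>s\<close> into one
  map.\<close>

lemma arc_subst_glue:
  assumes M: "arc_subst H M G" and M': "arc_subst H' M' G'" and H: "simple_graph H"
    and s: "graph_iso s H H'"
    and iso: "\<And>p. p \<in> arcs H \<Longrightarrow> (M p, M' (map_prod s s p)) \<in> network_iso_rel"
  obtains f where "graph_iso f G G'" "graph_iso f H H'"
proof -
  have H': "simple_graph H'" using graph_iso_simple[OF s H] .
  note arc = arc_of_in_arcs[OF H] and ends = ends_arc_of[OF H]
  let ?q = "\<lambda>e. map_prod s s (arc_of e)"
  have q: "?q e \<in> arcs H'" if "e \<in> edges H" for e using map_prod_in_arcs[OF s arc[OF that]] .
  obtain h where h: "\<And>e. e \<in> edges H \<Longrightarrow> network_iso (h e) (M (arc_of e)) (M' (?q e))"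
  proof -
    have "\<exists>h. network_iso h (M (arc_of e)) (M' (?q e))" if "e \<in> edges H" for e
      using iso[OF arc[OF that]] by (simp add: network_iso_rel_def)
    then show ?thesis using that by metis
  qed
  define owner where "owner x = (SOME e. e \<in> edges H \<and> x \<in> internal (M (arc_of e)))" for x
  define f where "f x = (if x \<in> verts H then s x else h (owner x) x)" for x
  have fH: "f x = s x" if "x \<in> verts H" for x using that by (simp add: f_def)
  have fint: "f x = h e x" if "e \<in> edges H" "x \<in> internal (M (arc_of e))" for e x
  proof -
    have "owner x \<in> edges H \<and> x \<in> internal (M (arc_of (owner x)))"
      unfolding owner_def by (rule someI) (use that in blast)
    then have "owner x = e"
      using arc_substD(6)[OF M arc arc] ends that by blast
    then show ?thesis using that arc_substD(5)[OF M arc[OF that(1)]] by (auto simp: f_def)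
  qed
  have hp: "h e (fst (arc_of e)) = s (fst (arc_of e))" "h e (snd (arc_of e)) = s (snd (arc_of e))"
    if "e \<in> edges H" for e
    using h[OF that] arc_substD(2,3)[OF M arc[OF that]] arc_substD(2,3)[OF M' q[OF that]]
    by (simp_all add: network_iso_def)
  \<comment> \<open>At the two poles \<open>h e\<close> is forced to equal \<open>s\<close>, so the
    glued map restricts to \<open>h e\<close> on the whole network and not merely on its
    interior.\<close>
  have fnet: "f x = h e x" if "e \<in> edges H" "x \<in> verts (ngraph (M (arc_of e)))" for e x
    using that(2) fint[OF that(1)] hp[OF that(1)] fH arc_in_verts[OF H arc[OF that(1)]]
    unfolding arc_subst_verts_network[OF M arc[OF that(1)]] by (auto simp: ends_def)
  have E: "edges H' = (\<lambda>e. s ` e) ` edges H" using graph_iso_edges[OF s] .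
  \<comment> \<open>\<open>s\<close> may carry the chosen arc of \<open>e\<close> to the reverse of
    the chosen arc of its image. Both directions have the same graph and interior, which is all that
    the unions below depend on.\<close>
  have arc_E': "arc_of (s ` e) \<in> arcs H'" "ends (arc_of (s ` e)) = ends (?q e)" if "e \<in> edges H" for e
    using arc_of_in_arcs[OF H', of "s ` e"] ends_arc_of[OF H', of "s ` e"] that ends[OF that] E by auto
  have V': "verts G' = verts H' \<union> (\<Union>e\<in>edges H. internal (M' (?q e)))"
    unfolding arc_subst_verts[OF M' H'] E using arc_subst_same_ends(1)[OF M' arc_E'(1) q arc_E'(2)]
    by simp
  have E': "edges G' = (\<Union>e\<in>edges H. edges (ngraph (M' (?q e))))"
    unfolding arc_subst_edges[OF M' H'] E using arc_subst_same_ends(2)[OF M' arc_E'(1) q arc_E'(2)]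
    by simp
  have bij_int: "bij_betw f (internal (M (arc_of e))) (internal (M' (?q e)))" if "e \<in> edges H" for e
  proof -
    have "bij_betw f (verts (ngraph (M (arc_of e)))) (verts (ngraph (M' (?q e))))"
      using h[OF that] fnet[OF that] by (subst bij_betw_cong[of _ f "h e"]) (auto simp: network_iso_def graph_iso_def)
    moreover have "f ` ends (arc_of e) = ends (?q e)"
      using fH arc_in_verts[OF H arc[OF that]] by (simp add: ends_def)
    moreover have "internal (M (arc_of e)) = verts (ngraph (M (arc_of e))) - ends (arc_of e)"
      "internal (M' (?q e)) = verts (ngraph (M' (?q e))) - ends (?q e)"
      using arc_substD(2,3)[OF M arc[OF that]] arc_substD(2,3)[OF M' q[OF that]]
      by (simp_all add: internal_def ends_def)
    moreover have "ends (arc_of e) \<subseteq> verts (ngraph (M (arc_of e)))"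
      using arc_subst_verts_network[OF M arc[OF that]] by simp
    ultimately show ?thesis
      unfolding bij_betw_def by (metis (no_types, lifting) Diff_subset inj_on_image_set_diff inj_on_subset)
  qed
  have "bij_betw f (\<Union>e\<in>edges H. internal (M (arc_of e))) (\<Union>e\<in>edges H. internal (M' (?q e)))"
  proof (rule bij_betw_UNION_disjoint)
    have "ends (?q e) \<noteq> ends (?q d)" if "e \<in> edges H" "d \<in> edges H" "e \<noteq> d" for e d
      using inj_on_image_eq_iff[OF graph_iso_inj[OF s] simple_graph_edge_subset[OF H] simple_graph_edge_subset[OF H]]
        that ends by simp
    then show "disjoint_family_on (\<lambda>e. internal (M' (?q e))) (edges H)"
      unfolding disjoint_family_on_def using arc_substD(6)[OF M' q q] by blast
  qed (rule bij_int)
  moreover have "bij_betw f (verts H) (verts H')"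
    using s fH by (subst bij_betw_cong[of _ f s]) (auto simp: graph_iso_def)
  moreover have "verts H' \<inter> (\<Union>e\<in>edges H. internal (M' (?q e))) = {}"
    using arc_substD(5)[OF M' q] by blast
  ultimately have bij: "bij_betw f (verts G) (verts G')"
    unfolding V' arc_subst_verts[OF M H] by (intro bij_betw_combine)
  have "(\<lambda>d. f ` d) ` edges (ngraph (M (arc_of e))) = edges (ngraph (M' (?q e)))" if "e \<in> edges H" for e
  proof -
    have "simple_graph (ngraph (M (arc_of e)))"
      using arc_substD(1)[OF M arc[OF that]] by (simp add: network_def)
    then have "f ` d = h e ` d" if "d \<in> edges (ngraph (M (arc_of e)))" for d
      using fnet[OF \<open>e \<in> edges H\<close>] simple_graph_edge_subset[OF _ that] by (intro image_cong) auto
    then show ?thesis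
      using graph_iso_edges[of "h e" "ngraph (M (arc_of e))" "ngraph (M' (?q e))"] h[OF that]
      by (simp add: network_iso_def)
  qed
  then have "(\<lambda>d. f ` d) ` edges G = edges G'"
    unfolding E' arc_subst_edges[OF M H] image_UN by simp
  then have "graph_iso f G G'" using bij by (simp add: graph_iso_def)
  moreover have "graph_iso f H H'" using graph_iso_cong[OF s H, of f] fH by simp
  ultimately show ?thesis by (rule that)
qed

section \<open>Construction of a pair with prescribed network types\<close>

lemma disjoint_copies:
  fixes V :: "'a::infinite set"
  assumes "finite E" "finite V"
  shows "\<exists>A. (\<forall>e\<in>E. finite (A e) \<and> card (A e) = k e \<and> A e \<inter> V = {}) \<and> disjoint_family_on A E"
  using assms(1)
proof induction
  case (insert e E)
  then obtain A where A: "\<forall>e\<in>E. finite (A e) \<and> card (A e) = k e \<and> A e \<inter> V = {}" "disjoint_family_on A E"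
    by blast
  have "infinite (UNIV - (V \<union> (\<Union>e\<in>E. A e)))"
    using insert.hyps(1) assms(2) A(1) by (intro Diff_infinite_finite) (auto simp: infinite_UNIV)
  then obtain B where B: "finite B" "card B = k e" "B \<subseteq> UNIV - (V \<union> (\<Union>e\<in>E. A e))"
    using infinite_arbitrarily_large by meson
  have "disjoint_family_on (A(e := B)) (insert e E)"
    using A(2) B(3) insert.hyps(2) by (auto simp: disjoint_family_on_def)
  moreover have "\<forall>d\<in>insert e E. finite ((A(e := B)) d) \<and> card ((A(e := B)) d) = k d \<and> (A(e := B)) d \<inter> V = {}"
    using A(1) B insert.hyps(2) by auto
  ultimately show ?case by blast
qed (auto simp: disjoint_family_on_def)

lemma arc_subst_exists:
  fixes H :: "'a::infinite graph" and \<phi> :: "'a \<times> 'a \<Rightarrow> 'a network set"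
  assumes H: "simple_graph H" and N: "network_species \<N>" "symmetric_networks \<N>"
    and \<phi>: "\<And>p. p \<in> arcs H \<Longrightarrow> \<phi> p \<in> \<N> // network_iso_rel"
    "\<And>p. p \<in> arcs H \<Longrightarrow> \<phi> (prod.swap p) = opposite ` \<phi> p"
  obtains M G where "arc_subst H M G"
    "\<And>p. p \<in> arcs H \<Longrightarrow> M p \<in> \<N> \<and> network_iso_rel `` {M p} = \<phi> p"
proof -
  note arc = arc_of_in_arcs[OF H] and ends = ends_arc_of[OF H]
  obtain N0 where N0: "\<And>p. p \<in> arcs H \<Longrightarrow> N0 p \<in> \<N> \<and> \<phi> p = network_iso_rel `` {N0 p}"
  proof -
    have "\<exists>N. N \<in> \<N> \<and> \<phi> p = network_iso_rel `` {N}" if "p \<in> arcs H" for p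
      using \<phi>(1)[OF that] by (auto elim: quotientE)
    then show ?thesis using that by metis
  qed
  have net0: "network (N0 p)" if "p \<in> arcs H" for p
    using N0[OF that] N(1) by (auto simp: network_species_def)
  \<comment> \<open>The label type is infinite, so there is room for pairwise disjoint interiors
    away from the core.\<close>
  obtain A where A: "\<And>e. e \<in> edges H \<Longrightarrow> finite (A e) \<and> card (A e) = card (internal (N0 (arc_of e))) \<and> A e \<inter> verts H = {}"
    and disj: "disjoint_family_on A (edges H)"
    using disjoint_copies[OF simple_graph_finite_edges[OF H], of "verts H" "\<lambda>e. card (internal (N0 (arc_of e)))"]
      H that unfolding simple_graph_def by metis
  have "\<exists>L. network L \<and> (N0 (arc_of e), L) \<in> network_iso_rel \<and> pole0 L = fst (arc_of e) \<and>
      pole1 L = snd (arc_of e) \<and> internal L = A e" if "e \<in> edges H" for e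
    using relabel_network[OF net0[OF arc[OF that]], of "A e" "fst (arc_of e)" "snd (arc_of e)"] A[OF that]
      arc_in_verts[OF H arc[OF that]] arc_neq[OF H arc[OF that]]
    unfolding network_iso_rel_def by (auto simp: disjoint_iff) metis
  then obtain L where L: "\<And>e. e \<in> edges H \<Longrightarrow> network (L e) \<and> (N0 (arc_of e), L e) \<in> network_iso_rel \<and>
      pole0 (L e) = fst (arc_of e) \<and> pole1 (L e) = snd (arc_of e) \<and> internal (L e) = A e"
    by metis
  \<comment> \<open>A copy is planted on the chosen arc only and the reverse arc receives its
    opposite; compatibility of \<open>\<phi>\<close> with reversal then makes both types
    correct.\<close>
  define M where "M p = (if p = arc_of (ends p) then L (ends p) else opposite (L (ends p)))" for p
  have e_in: "ends p \<in> edges H" if "p \<in> arcs H" for p using that by (simp add: arcs_def)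
  have LN: "L e \<in> \<N>" "network_iso_rel `` {L e} = \<phi> (arc_of e)" if "e \<in> edges H" for e
  proof -
    show "L e \<in> \<N>" using L[OF that] N0[OF arc[OF that]] N(1) by (auto simp: network_species_def)
    show "network_iso_rel `` {L e} = \<phi> (arc_of e)"
      using L[OF that] N0[OF arc[OF that]] network_iso_rel_class_eq[OF net0[OF arc[OF that]]] by auto
  qed
  have M: "M p \<in> \<N> \<and> network_iso_rel `` {M p} = \<phi> p \<and> pole0 (M p) = fst p \<and> pole1 (M p) = snd p \<and>
      M (prod.swap p) = opposite (M p)" if p: "p \<in> arcs H" for p
  proof -
    have ne: "arc_of (ends p) \<noteq> prod.swap (arc_of (ends p))"
      using arc_neq[OF H arc[OF e_in[OF p]]] by (cases "arc_of (ends p)") auto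
    from H p show ?thesis
    proof (cases rule: arc_cases)
      case 1
      then have "M p = L (ends p)" "M (prod.swap p) = opposite (L (ends p))"
        using ne by (auto simp: M_def)
      then show ?thesis using 1 L[OF e_in[OF p]] LN[OF e_in[OF p]] by simp
    next
      case 2
      have "\<phi> p = opposite ` \<phi> (arc_of (ends p))"
        using \<phi>(2)[OF arc[OF e_in[OF p]]] 2 by simp
      moreover have "p \<noteq> arc_of (ends p)" "prod.swap p = arc_of (ends p)"
        using ne 2 by (metis, metis swap_swap)
      then have "M p = opposite (L (ends p))" "M (prod.swap p) = L (ends p)"
        unfolding M_def ends_swap by simp_all
      moreover have "fst p = snd (arc_of (ends p))" "snd p = fst (arc_of (ends p))"
        using 2 by (metis fst_swap, metis snd_swap)
      ultimately show ?thesis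
        using L[OF e_in[OF p]] LN[OF e_in[OF p]] opposite_class[of "L (ends p)"] N(2)
        by (simp add: symmetric_networks_def)
    qed
  qed
  have int: "internal (M p) = A (ends p)" if "p \<in> arcs H" for p
    using L[OF e_in[OF that]] by (simp add: M_def)
  define G where "G = Graph (verts H \<union> (\<Union>p\<in>arcs H. internal (M p))) (\<Union>p\<in>arcs H. edges (ngraph (M p)))"
  have "arc_subst H M G"
    unfolding arc_subst_def
  proof (intro conjI ballI impI)
    fix p assume p: "p \<in> arcs H"
    show "network (M p)" using M[OF p] N(1) by (simp add: network_species_def)
    show "pole0 (M p) = fst p" "pole1 (M p) = snd p" "M (prod.swap p) = opposite (M p)"
      using M[OF p] by simp_all
    show "internal (M p) \<inter> verts H = {}" using int[OF p] A[OF e_in[OF p]] by simp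
    fix q assume q: "q \<in> arcs H" "ends p \<noteq> ends q"
    show "internal (M p) \<inter> internal (M q) = {}"
      unfolding int[OF p] int[OF q(1)] using disj e_in[OF p] e_in[OF q(1)] q(2)
      by (simp add: disjoint_family_on_def)
  qed (simp_all add: G_def)
  then show ?thesis using M that by blast
qed

section \<open>Colourings of arcs and edge cycles of an automorphism\<close>

lemma automorphismsD:
  assumes "\<sigma> \<in> automorphisms G"
  shows "\<sigma> permutes verts G" "graph_iso \<sigma> G G" "bij \<sigma>"
  using assms by (auto simp: automorphisms_def permutes_bij)

lemma automorphisms_id: "id \<in> automorphisms G"
  by (simp add: automorphisms_def graph_iso_id permutes_id)

lemma automorphisms_comp:
  assumes "\<sigma> \<in> automorphisms G" "\<tau> \<in> automorphisms G"
  shows "\<sigma> \<circ> \<tau> \<in> automorphisms G"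
  using assms graph_iso_comp by (auto simp: automorphisms_def intro: permutes_compose)

lemma automorphisms_inv:
  assumes "\<sigma> \<in> automorphisms G" "simple_graph G"
  shows "inv \<sigma> \<in> automorphisms G"
  using automorphismsD[OF assms(1)] assms(2) graph_iso_inverse[of \<sigma> G G "inv \<sigma>"]
  by (auto simp: automorphisms_def permutes_inv bij_is_inj)

lemma finite_automorphisms:
  assumes "simple_graph G"
  shows "finite (automorphisms G)"
proof -
  have "automorphisms G \<subseteq> {\<sigma>. \<sigma> permutes verts G}" by (auto simp: automorphisms_def)
  moreover have "finite {\<sigma>. \<sigma> permutes verts G}"
    using assms by (intro finite_permutations) (simp add: simple_graph_def)
  ultimately show ?thesis by (rule finite_subset)
qed

lemma map_prod_automorphism_in_arcs:
  assumes "\<sigma> \<in> automorphisms G" "simple_graph G"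
  shows "map_prod \<sigma> \<sigma> p \<in> arcs G \<longleftrightarrow> p \<in> arcs G"
proof
  assume "map_prod \<sigma> \<sigma> p \<in> arcs G"
  then have "map_prod (inv \<sigma>) (inv \<sigma>) (map_prod \<sigma> \<sigma> p) \<in> arcs G"
    using map_prod_in_arcs automorphismsD(2)[OF automorphisms_inv[OF assms]] by blast
  then show "p \<in> arcs G"
    using automorphismsD(3)[OF assms(1)] by (cases p) (simp add: bij_is_inj)
qed (rule map_prod_in_arcs[OF automorphismsD(2)[OF assms(1)]])

text \<open>The value on the opposite arc is the image under \<open>\<tau>\<close>, so a colouring amounts to one
  unconstrained choice per edge.\<close>

definition colourings :: "'a graph \<Rightarrow> 'x set \<Rightarrow> ('x \<Rightarrow> 'x) \<Rightarrow> ('a \<times> 'a \<Rightarrow> 'x) set" where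
  "colourings G X \<tau> =
     {\<phi> \<in> PiE (arcs G) (\<lambda>_. X). \<forall>p\<in>arcs G. \<phi> (prod.swap p) = \<tau> (\<phi> p)}"

definition edge_weight :: "'a graph \<Rightarrow> ('x \<Rightarrow> nat) \<Rightarrow> ('a \<times> 'a \<Rightarrow> 'x) \<Rightarrow> nat" where
  "edge_weight G w \<phi> = (\<Sum>e\<in>edges G. w (\<phi> (arc_of e)))"

text \<open>Composition reverses, \<open>pullback (g \<circ> h) \<phi> = pullback h (pullback g
  \<phi>)\<close>: a right action, in the form required by \<open>burnside\<close>.\<close>

definition pullback :: "('a \<Rightarrow> 'a) \<Rightarrow> ('a \<times> 'a \<Rightarrow> 'x) \<Rightarrow> 'a \<times> 'a \<Rightarrow> 'x" where
  "pullback \<sigma> \<phi> = (\<lambda>p. \<phi> (map_prod \<sigma> \<sigma> p))"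

text \<open>A weight that ignores \<open>\<tau>\<close> does not see the direction of an arc, so
  \<open>edge_weight\<close> does not depend on the choices made by \<open>arc_of\<close>.\<close>

lemma colouring_same_ends:
  assumes "\<phi> \<in> colourings G X \<tau>" "\<And>x. x \<in> X \<Longrightarrow> w (\<tau> x) = w x"
    and "p \<in> arcs G" "q \<in> arcs G" "ends p = ends q"
  shows "w (\<phi> p) = w (\<phi> q)"
  using assms unfolding colourings_def ends_eq_iff by (auto simp: PiE_iff)

lemma swap_map_prod: "prod.swap (map_prod f f p) = map_prod f f (prod.swap p)"
  by (cases p) simp

lemma pullback_in_colourings:
  assumes "\<sigma> \<in> automorphisms G" "simple_graph G" "\<phi> \<in> colourings G X \<tau>"
  shows "pullback \<sigma> \<phi> \<in> colourings G X \<tau>"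
proof -
  note arcs = map_prod_automorphism_in_arcs[OF assms(1,2)]
  have "pullback \<sigma> \<phi> \<in> PiE (arcs G) (\<lambda>_. X)"
    using assms(3) arcs by (fastforce simp: colourings_def pullback_def PiE_iff extensional_def)
  then show ?thesis
    using assms(3) arcs by (simp add: colourings_def pullback_def swap_map_prod[symmetric])
qed

lemma edge_weight_pullback:
  assumes "\<sigma> \<in> automorphisms G" "simple_graph G" "\<phi> \<in> colourings G X \<tau>"
    and "\<And>x. x \<in> X \<Longrightarrow> w (\<tau> x) = w x"
  shows "edge_weight G w (pullback \<sigma> \<phi>) = edge_weight G w \<phi>"
proof -
  note iso = automorphismsD(2)[OF assms(1)]
  have inj: "inj_on (\<lambda>e. \<sigma> ` e) (edges G)"
    using inj_image_eq_iff[OF bij_is_inj[OF automorphismsD(3)[OF assms(1)]]] by (simp add: inj_on_def)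
  have "edge_weight G w (pullback \<sigma> \<phi>) = (\<Sum>e\<in>edges G. w (\<phi> (arc_of (\<sigma> ` e))))"
    unfolding edge_weight_def pullback_def
  proof (rule sum.cong[OF refl])
    fix e assume e: "e \<in> edges G"
    then have e': "\<sigma> ` e \<in> edges G" using iso by (auto simp: graph_iso_def)
    show "w (\<phi> (map_prod \<sigma> \<sigma> (arc_of e))) = w (\<phi> (arc_of (\<sigma> ` e)))"
      by (rule colouring_same_ends[where w = w, OF assms(3,4) map_prod_in_arcs[OF iso arc_of_in_arcs[OF assms(2) e]]
            arc_of_in_arcs[OF assms(2) e']])
        (simp_all add: ends_arc_of[OF assms(2) e] ends_arc_of[OF assms(2) e'])
  qed
  also have "\<dots> = (\<Sum>e\<in>(\<lambda>e. \<sigma> ` e) ` edges G. w (\<phi> (arc_of e)))"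
    using inj by (simp add: sum.reindex)
  finally show ?thesis using iso by (simp add: graph_iso_def edge_weight_def)
qed

section \<open>Edge cycles and their two types\<close>

lemma funpow_map_prod:
  fixes f :: "'a \<Rightarrow> 'a"
  shows "(map_prod f f ^^ n) p = map_prod (f ^^ n) (f ^^ n) p"
  by (induction n; cases p) simp_all

lemma funpow_image:
  fixes f :: "'a \<Rightarrow> 'a"
  shows "((\<lambda>e. f ` e) ^^ n) e = (f ^^ n) ` e"
  by (induction n) (simp_all add: image_comp)

lemma funpow_dvd:
  assumes "(f ^^ l) x = x" "l dvd i"
  shows "(f ^^ i) x = x"
  using assms funpow_mod_eq[of l f x i] by simp

lemma card_orbit_dvd:
  assumes "x \<in> orbit f x" "(f ^^ i) x = x"
  shows "card (orbit f x) dvd i"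
proof -
  let ?l = "funpow_dist1 f x x"
  have card: "card (orbit f x) = ?l"
    by (subst orbit_conv_funpow_dist1[OF assms(1)]) (simp add: card_image inj_on_funpow_dist1[OF assms(1)])
  have "(f ^^ (i mod ?l)) x = x"
    using funpow_mod_eq[OF funpow_dist1_prop[OF assms(1)], of i] assms(2) by simp
  moreover have "i mod ?l < ?l" by simp
  ultimately have "i mod ?l = 0" using funpow_dist1_least[of "i mod ?l" f x x] by fastforce
  then show ?thesis unfolding card by auto
qed

lemma funpow_card_orbit:
  assumes "x \<in> orbit f x"
  shows "(f ^^ card (orbit f x)) x = x"
proof -
  have "card (orbit f x) = funpow_dist1 f x x"
    by (subst orbit_conv_funpow_dist1[OF assms(1)]) (simp add: card_image inj_on_funpow_dist1[OF assms(1)])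
  then show ?thesis using funpow_dist1_prop[OF assms] by simp
qed

locale graph_automorphism =
  fixes G :: "'a graph" and \<sigma> :: "'a \<Rightarrow> 'a"
  assumes simple: "simple_graph G" and aut: "\<sigma> \<in> automorphisms G"
begin

abbreviation "edge_map \<equiv> \<lambda>e. \<sigma> ` e"
abbreviation "arc_map \<equiv> map_prod \<sigma> \<sigma>"

text \<open>Replaces negative powers: \<open>orbit\<close> collects positive iterates only, and a
  step back is \<open>n - 1\<close> steps forward.\<close>

lemma finite_order: obtains n where "n > 0" "\<sigma> ^^ n = id"
proof -
  have "permutation \<sigma>"
    using automorphismsD(1)[OF aut] simple permutation_permutes by (auto simp: simple_graph_def)
  then show ?thesis using permutation_is_nilpotent that by blast
qed

lemma edge_in_orbit: "e \<in> orbit edge_map e"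
proof -
  obtain n where n: "n > 0" "\<sigma> ^^ n = id" by (rule finite_order)
  then have "(edge_map ^^ n) e = e" by (simp add: funpow_image)
  then show ?thesis unfolding orbit_altdef using n(1) by (metis (mono_tags, lifting) mem_Collect_eq)
qed

lemma edge_cycleD:
  assumes "C \<in> edge_cycles G \<sigma>"
  shows "C \<subseteq> edges G" "C \<noteq> {}" "e \<in> C \<Longrightarrow> orbit edge_map e = C" "finite C" "card C \<ge> 1"
proof -
  obtain d where d: "d \<in> edges G" "C = orbit edge_map d" using assms by (auto simp: edge_cycles_def)
  show sub: "C \<subseteq> edges G"
  proof
    fix e assume "e \<in> C"
    then have "e \<in> orbit edge_map d" using d(2) by simp
    then show "e \<in> edges G"
      by induction (use d(1) automorphismsD(2)[OF aut] in \<open>auto simp: graph_iso_def\<close>)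
  qed
  show ne: "C \<noteq> {}" using d(2) edge_in_orbit by auto
  have "cyclic_on edge_map C" unfolding cyclic_on_def using d(2) edge_in_orbit by blast
  then show "orbit edge_map e = C" if "e \<in> C" using that by (auto simp: cyclic_on_alldef)
  show fin: "finite C" using sub simple_graph_finite_edges[OF simple] by (rule finite_subset)
  then show "card C \<ge> 1" using ne by (simp add: Suc_le_eq card_gt_0_iff)
qed

lemma finite_edge_cycles: "finite (edge_cycles G \<sigma>)"
  using simple_graph_finite_edges[OF simple] by (simp add: edge_cycles_def)

lemma orbit_in_edge_cycles: "p \<in> arcs G \<Longrightarrow> orbit edge_map (ends p) \<in> edge_cycles G \<sigma>"
  by (auto simp: edge_cycles_def arcs_def)

definition cycle_arc :: "'a set set \<Rightarrow> 'a \<times> 'a" where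
  "cycle_arc C = arc_of (SOME e. e \<in> C)"

lemma cycle_arc:
  assumes "C \<in> edge_cycles G \<sigma>"
  shows "cycle_arc C \<in> arcs G" "ends (cycle_arc C) \<in> C" "orbit edge_map (ends (cycle_arc C)) = C"
proof -
  have e: "(SOME e. e \<in> C) \<in> C" using edge_cycleD(2)[OF assms] by (auto intro: someI)
  then have "(SOME e. e \<in> C) \<in> edges G" using edge_cycleD(1)[OF assms] by blast
  then show "cycle_arc C \<in> arcs G" and *: "ends (cycle_arc C) \<in> C"
    using arc_of_in_arcs[OF simple] ends_arc_of[OF simple] e by (simp_all add: cycle_arc_def)
  show "orbit edge_map (ends (cycle_arc C)) = C" using edge_cycleD(3)[OF assms *] .
qed

lemma ends_funpow [simp]: "ends ((arc_map ^^ i) p) = (edge_map ^^ i) (ends p)"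
  by (simp add: funpow_map_prod funpow_image)

lemma swap_funpow: "prod.swap ((arc_map ^^ i) p) = (arc_map ^^ i) (prod.swap p)"
  by (simp add: funpow_map_prod swap_map_prod)

lemma reach_edge:
  assumes "C \<in> edge_cycles G \<sigma>" "ends p \<in> C" "ends q \<in> C"
  shows "\<exists>i. q = (arc_map ^^ i) p \<or> q = prod.swap ((arc_map ^^ i) p)"
proof -
  have "ends q \<in> orbit edge_map (ends p)" using assms edge_cycleD(3) by blast
  then obtain i where "ends q = (edge_map ^^ i) (ends p)" by (auto simp: orbit_altdef)
  then have "ends q = ends ((arc_map ^^ i) p)" by simp
  then show ?thesis unfolding ends_eq_iff by blast
qed

lemma arc_map_card_cycle:
  assumes "C \<in> edge_cycles G \<sigma>" "ends p \<in> C"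
  shows "(arc_map ^^ card C) p = p \<or> (arc_map ^^ card C) p = prod.swap p"
proof -
  have "(edge_map ^^ card C) (ends p) = ends p"
    using funpow_card_orbit[OF edge_in_orbit, of "ends p"] edge_cycleD(3)[OF assms] by simp
  then have "ends ((arc_map ^^ card C) p) = ends p" by simp
  then show ?thesis unfolding ends_eq_iff .
qed

text \<open>Powers of \<open>arc_map\<close> commute with each other and with reversal, and each arc
  over the cycle is an iterate of \<open>p\<close> or the reverse of one. So the return map after
  \<open>card C\<close> steps is of one kind on the whole cycle, and its type can be tested on a
  single arc.\<close>

lemma cycle_type_aux:
  assumes C: "C \<in> edge_cycles G \<sigma>" and p: "ends p \<in> C" and q: "ends q \<in> C"
    and t: "(arc_map ^^ card C) p = t p" and "t = id \<or> t = prod.swap"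
  shows "(arc_map ^^ card C) q = t q"
proof -
  obtain i where i: "q = (arc_map ^^ i) p \<or> q = prod.swap ((arc_map ^^ i) p)"
    using reach_edge[OF C p q] by blast
  have key: "(arc_map ^^ card C) ((arc_map ^^ i) p) = t ((arc_map ^^ i) p)"
  proof -
    have "(arc_map ^^ card C) ((arc_map ^^ i) p) = (arc_map ^^ i) ((arc_map ^^ card C) p)"
      by (metis add.commute comp_apply funpow_add)
    also have "\<dots> = t ((arc_map ^^ i) p)"
      unfolding t using assms(5) by (auto simp: swap_funpow)
    finally show ?thesis .
  qed
  have "(arc_map ^^ card C) (prod.swap r) = t (prod.swap r)" if "(arc_map ^^ card C) r = t r" for r
    unfolding swap_funpow[symmetric] that using assms(5) by auto
  from this[OF key] show ?thesis using i key by blast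
qed

lemma cylindrical_iff:
  assumes "C \<in> edge_cycles G \<sigma>" "ends p \<in> C"
  shows "cylindrical \<sigma> C \<longleftrightarrow> (arc_map ^^ card C) p = p"
proof
  assume "cylindrical \<sigma> C"
  then show "(arc_map ^^ card C) p = p"
    using assms(2) unfolding cylindrical_def ends_def by (cases p) (simp add: funpow_map_prod)
next
  assume p: "(arc_map ^^ card C) p = p"
  show "cylindrical \<sigma> C" unfolding cylindrical_def
  proof (intro allI impI)
    fix a b assume "{a, b} \<in> C"
    then have "(arc_map ^^ card C) (a, b) = (a, b)"
      using cycle_type_aux[OF assms, of "(a, b)" id] p by (simp add: ends_def)
    then show "(\<sigma> ^^ card C) a = a \<and> (\<sigma> ^^ card C) b = b" by (simp add: funpow_map_prod)
  qed
qed

lemma moebius_iff: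
  assumes "C \<in> edge_cycles G \<sigma>" "ends p \<in> C"
  shows "moebius \<sigma> C \<longleftrightarrow> (arc_map ^^ card C) p = prod.swap p"
proof
  assume "moebius \<sigma> C"
  then show "(arc_map ^^ card C) p = prod.swap p"
    using assms(2) unfolding moebius_def ends_def by (cases p) (simp add: funpow_map_prod)
next
  assume p: "(arc_map ^^ card C) p = prod.swap p"
  show "moebius \<sigma> C" unfolding moebius_def
  proof (intro allI impI)
    fix a b assume "{a, b} \<in> C"
    then have "(arc_map ^^ card C) (a, b) = (b, a)"
      using cycle_type_aux[OF assms, of "(a, b)" prod.swap] p by (simp add: ends_def)
    then show "(\<sigma> ^^ card C) a = b \<and> (\<sigma> ^^ card C) b = a" by (simp add: funpow_map_prod)
  qed
qed

lemma swap_neq: "p \<in> arcs G \<Longrightarrow> prod.swap p \<noteq> p"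
  using arc_neq[OF simple, of p] by (cases p) auto

text \<open>After \<open>card C\<close> steps each edge is back in place, so an arc over it is fixed
  or reversed, and not both, as there are no loops. Hence each edge cycle contributes exactly one
  factor to the Walsh weight.\<close>

lemma cylindrical_iff_not_moebius:
  assumes "C \<in> edge_cycles G \<sigma>"
  shows "cylindrical \<sigma> C \<longleftrightarrow> \<not> moebius \<sigma> C"
  using cylindrical_iff[OF assms] moebius_iff[OF assms] arc_map_card_cycle[OF assms]
    cycle_arc[OF assms] swap_neq by metis

text \<open>A power taking an arc to its reverse fixes the edge, so its exponent is a multiple of
  \<open>card C\<close>; on a cylindrical cycle such a power would fix the arc as well.\<close>

lemma moebius_if_swap_reached:
  assumes C: "C \<in> edge_cycles G \<sigma>" and p: "p \<in> arcs G" "ends p \<in> C"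
    and swap: "prod.swap p = (arc_map ^^ i) p"
  shows "moebius \<sigma> C"
proof (rule ccontr)
  assume "\<not> moebius \<sigma> C"
  then have cyl: "(arc_map ^^ card C) p = p"
    using cylindrical_iff_not_moebius[OF C] cylindrical_iff[OF C p(2)] by simp
  have "(edge_map ^^ i) (ends p) = ends (prod.swap p)" unfolding swap by simp
  then have "card C dvd i"
    using card_orbit_dvd[OF edge_in_orbit, of i "ends p"] edge_cycleD(3)[OF C p(2)] by simp
  then have "(arc_map ^^ i) p = p" using funpow_dvd[OF cyl] by simp
  then show False using swap swap_neq[OF p(1)] by simp
qed

lemma arc_map_funpow_in_arcs: "(arc_map ^^ i) p \<in> arcs G \<longleftrightarrow> p \<in> arcs G"
  by (induction i) (use map_prod_automorphism_in_arcs[OF aut simple] in auto)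

section \<open>Colourings fixed by an automorphism\<close>

definition fixed_colourings :: "'x set \<Rightarrow> ('x \<Rightarrow> 'x) \<Rightarrow> ('a \<times> 'a \<Rightarrow> 'x) set" where
  "fixed_colourings X \<tau> = {\<phi> \<in> colourings G X \<tau>. pullback \<sigma> \<phi> = \<phi>}"

text \<open>Colours admissible on the base arc: once around a Moebius cycle the colour arrives
  unchanged at the reverse arc, so it must be fixed by \<open>\<tau>\<close>.\<close>

definition cycle_values :: "'x set \<Rightarrow> ('x \<Rightarrow> 'x) \<Rightarrow> 'a set set \<Rightarrow> 'x set" where
  "cycle_values X \<tau> C = (if moebius \<sigma> C then {x \<in> X. \<tau> x = x} else X)"

lemma fixed_colouringsD:
  assumes "\<phi> \<in> fixed_colourings X \<tau>"
  shows "\<phi> \<in> colourings G X \<tau>" "\<phi> ((arc_map ^^ i) p) = \<phi> p"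
proof -
  show "\<phi> \<in> colourings G X \<tau>" using assms by (simp add: fixed_colourings_def)
  have "\<phi> (arc_map q) = \<phi> q" for q
    using assms by (auto simp: fixed_colourings_def pullback_def dest: fun_cong[of _ _ q])
  then show "\<phi> ((arc_map ^^ i) p) = \<phi> p" by (induction i) simp_all
qed

lemma colouringsD:
  assumes "\<phi> \<in> colourings G X \<tau>"
  shows "p \<in> arcs G \<Longrightarrow> \<phi> p \<in> X" "p \<in> arcs G \<Longrightarrow> \<phi> (prod.swap p) = \<tau> (\<phi> p)"
    "p \<notin> arcs G \<Longrightarrow> \<phi> p = undefined"
  using assms PiE_arb[of \<phi> "arcs G"] by (auto simp: colourings_def)

lemma cycle_arc_reaches:
  assumes "p \<in> arcs G"
  obtains i where "p = (arc_map ^^ i) (cycle_arc (orbit edge_map (ends p)))"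
  | i where "p = prod.swap ((arc_map ^^ i) (cycle_arc (orbit edge_map (ends p))))"
  using reach_edge[OF orbit_in_edge_cycles[OF assms] cycle_arc(2)[OF orbit_in_edge_cycles[OF assms]] edge_in_orbit]
  by blast

lemma fixed_colouring_on_cycle:
  assumes "\<phi> \<in> fixed_colourings X \<tau>" "C \<in> edge_cycles G \<sigma>"
  shows "\<phi> (cycle_arc C) \<in> cycle_values X \<tau> C"
proof -
  note col = fixed_colouringsD(1)[OF assms(1)] and arc = cycle_arc[OF assms(2)]
  have "\<tau> (\<phi> (cycle_arc C)) = \<phi> (cycle_arc C)" if "moebius \<sigma> C"
    using moebius_iff[OF assms(2) arc(2)] that colouringsD(2)[OF col arc(1)]
      fixed_colouringsD(2)[OF assms(1), of "card C" "cycle_arc C"] by simp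
  then show ?thesis using colouringsD(1)[OF col arc(1)] by (simp add: cycle_values_def)
qed

text \<open>Each arc is an iterate of the base arc of its cycle, with the same colour, or the
  reverse of an iterate, with the colour under \<open>\<tau>\<close>.\<close>

lemma fixed_colouring_eqI:
  assumes "\<phi> \<in> fixed_colourings X \<tau>" "\<psi> \<in> fixed_colourings X \<tau>"
    and "\<And>C. C \<in> edge_cycles G \<sigma> \<Longrightarrow> \<phi> (cycle_arc C) = \<psi> (cycle_arc C)"
  shows "\<phi> = \<psi>"
proof
  fix p
  show "\<phi> p = \<psi> p"
  proof (cases "p \<in> arcs G")
    case True
    let ?C = "orbit edge_map (ends p)"
    note C = orbit_in_edge_cycles[OF True]
    note D = fixed_colouringsD[OF assms(1)] fixed_colouringsD[OF assms(2)]
    have *: "\<phi> ((arc_map ^^ i) (cycle_arc ?C)) = \<psi> ((arc_map ^^ i) (cycle_arc ?C))" for i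
      by (simp only: D(2,4) assms(3)[OF C])
    have arc: "(arc_map ^^ i) (cycle_arc ?C) \<in> arcs G" for i
      using cycle_arc(1)[OF C] by (simp only: arc_map_funpow_in_arcs)
    from True show ?thesis
    proof (cases rule: cycle_arc_reaches)
      case (1 i) then show ?thesis using *[of i] by simp
    next
      case (2 i)
      show ?thesis
        by (subst (1 2) 2) (simp only: colouringsD(2)[OF D(1) arc] colouringsD(2)[OF D(3) arc] *)
    qed
  next
    case False
    then show ?thesis
      using colouringsD(3) fixed_colouringsD(1)[OF assms(1)] fixed_colouringsD(1)[OF assms(2)] by metis
  qed
qed

text \<open>Arcs reached from the base arc get the prescribed colour, the remaining ones its image
  under \<open>\<tau>\<close>. The rule is invariant under \<open>arc_map\<close> since being
  reached is.\<close>

lemma fixed_colouring_exists: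
  assumes k: "k \<in> PiE (edge_cycles G \<sigma>) (cycle_values X \<tau>)"
    and \<tau>: "\<And>x. x \<in> X \<Longrightarrow> \<tau> x \<in> X" "\<And>x. x \<in> X \<Longrightarrow> \<tau> (\<tau> x) = x"
  shows "\<exists>\<phi>\<in>fixed_colourings X \<tau>. \<forall>C\<in>edge_cycles G \<sigma>. \<phi> (cycle_arc C) = k C"
proof
  let ?C = "\<lambda>p. orbit edge_map (ends p)"
  define reached where "reached p \<longleftrightarrow> (\<exists>i. p = (arc_map ^^ i) (cycle_arc (?C p)))" for p
  define \<phi> where "\<phi> p = (if p \<in> arcs G then if reached p then k (?C p) else \<tau> (k (?C p)) else undefined)" for p
  have kX: "k C \<in> X" if "C \<in> edge_cycles G \<sigma>" for C
    using PiE_mem[OF k that] by (auto simp: cycle_values_def split: if_splits)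
  have kM: "\<tau> (k C) = k C" if "C \<in> edge_cycles G \<sigma>" "moebius \<sigma> C" for C
    using PiE_mem[OF k that(1)] that(2) by (auto simp: cycle_values_def)
  obtain n where n: "n > 0" "\<sigma> ^^ n = id" by (rule finite_order)
  have arc_n: "(arc_map ^^ n) p = p" for p using n(2) by (simp add: funpow_map_prod map_prod.id)
  have C_step: "?C (arc_map p) = ?C p" if "p \<in> arcs G" for p
  proof -
    have "edge_map (ends p) \<in> ?C p" by (rule orbit.base)
    then show ?thesis using edge_cycleD(3)[OF orbit_in_edge_cycles[OF that]] by simp
  qed
  have reached_step: "reached (arc_map p) \<longleftrightarrow> reached p" if p: "p \<in> arcs G" for p
  proof
    assume "reached p"
    then obtain i where "p = (arc_map ^^ i) (cycle_arc (?C p))" by (auto simp: reached_def)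
    then have "arc_map p = (arc_map ^^ Suc i) (cycle_arc (?C (arc_map p)))"
      unfolding C_step[OF p] by simp
    then show "reached (arc_map p)" unfolding reached_def by blast
  next
    assume "reached (arc_map p)"
    then obtain i where i: "arc_map p = (arc_map ^^ i) (cycle_arc (?C p))"
      using C_step[OF p] unfolding reached_def by auto
    \<comment> \<open>With \<open>n\<close> a positive period, \<open>n - 1\<close> further steps
      undo one step.\<close>
    have "p = (arc_map ^^ (n - 1)) (arc_map p)"
      using arc_n[of p] n(1) by (simp flip: funpow_swap1 funpow.simps(2)[THEN fun_cong, unfolded comp_apply])
    also have "\<dots> = (arc_map ^^ (n - 1 + i)) (cycle_arc (?C p))"
      unfolding i by (simp add: funpow_add)
    finally show "reached p" unfolding reached_def by blast
  qed
  have swap: "\<phi> (prod.swap p) = \<tau> (\<phi> p)" if p: "p \<in> arcs G" for p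
  proof -
    note C = orbit_in_edge_cycles[OF p]
    have C_swap: "?C (prod.swap p) = ?C p" by simp
    have ex: "reached p \<or> reached (prod.swap p)"
      using p
    proof (cases rule: cycle_arc_reaches)
      case (2 i)
      then have "prod.swap p = (arc_map ^^ i) (cycle_arc (?C p))" by (metis swap_swap)
      then show ?thesis unfolding reached_def C_swap by blast
    qed (auto simp: reached_def)
    \<comment> \<open>The one possible clash: if both directions are reached, so is the reverse of
      the base arc from the base arc itself. The cycle is then Moebius and the prescribed colour is
      fixed by \<open>\<tau>\<close>.\<close>
    have "moebius \<sigma> (?C p)" if both: "reached p" "reached (prod.swap p)"
    proof -
      obtain i j where ij: "p = (arc_map ^^ i) (cycle_arc (?C p))"
        "prod.swap p = (arc_map ^^ j) (cycle_arc (?C p))"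
        using both unfolding reached_def C_swap by blast
      let ?c = "cycle_arc (?C p)"
      \<comment> \<open>\<open>n * i\<close> is a multiple of the period and at least
        \<open>i\<close>, so \<open>n * i - i\<close> more steps lead from \<open>p\<close> back to
        the base arc.\<close>
      have "prod.swap ?c = prod.swap ((arc_map ^^ (n * i)) ?c)"
        using funpow_dvd[OF arc_n, of "n * i"] by simp
      also have "\<dots> = prod.swap ((arc_map ^^ (n * i - i)) p)"
        using n(1) by (subst ij(1)) (simp flip: funpow_add[THEN fun_cong, unfolded comp_apply])
      also have "\<dots> = (arc_map ^^ (n * i - i)) ((arc_map ^^ j) ?c)"
        unfolding swap_funpow ij(2)[symmetric] ..
      also have "\<dots> = (arc_map ^^ (n * i - i + j)) ?c" by (simp add: funpow_add)
      finally show ?thesis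
        by (rule moebius_if_swap_reached[OF C cycle_arc(1,2)[OF C]])
    qed
    then show ?thesis
      using p ex kM[OF C] kX[OF C] \<tau> unfolding \<phi>_def swap_in_arcs C_swap by auto
  qed
  have "\<phi> \<in> PiE (arcs G) (\<lambda>_. X)"
    using kX[OF orbit_in_edge_cycles] \<tau>(1) by (auto simp: \<phi>_def PiE_iff extensional_def)
  then have "\<phi> \<in> colourings G X \<tau>" using swap by (simp add: colourings_def)
  moreover have "\<phi> (arc_map p) = \<phi> p" for p
    unfolding \<phi>_def map_prod_automorphism_in_arcs[OF aut simple]
    by (cases "p \<in> arcs G") (simp_all only: C_step reached_step if_True if_False)
  then have "pullback \<sigma> \<phi> = \<phi>" by (simp add: pullback_def)
  ultimately show "\<phi> \<in> fixed_colourings X \<tau>" by (simp add: fixed_colourings_def)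
  show "\<forall>C\<in>edge_cycles G \<sigma>. \<phi> (cycle_arc C) = k C"
  proof
    fix C assume C: "C \<in> edge_cycles G \<sigma>"
    have "reached (cycle_arc C)"
      unfolding reached_def cycle_arc(3)[OF C] by (rule exI[of _ 0]) simp
    then show "\<phi> (cycle_arc C) = k C" using cycle_arc[OF C] by (simp add: \<phi>_def)
  qed
qed

lemma fixed_colourings_bij_betw:
  assumes "\<And>x. x \<in> X \<Longrightarrow> \<tau> x \<in> X" "\<And>x. x \<in> X \<Longrightarrow> \<tau> (\<tau> x) = x"
  shows "bij_betw (\<lambda>\<phi>. \<lambda>C\<in>edge_cycles G \<sigma>. \<phi> (cycle_arc C)) (fixed_colourings X \<tau>)
    (PiE (edge_cycles G \<sigma>) (cycle_values X \<tau>))"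
  unfolding bij_betw_def
proof
  show "inj_on (\<lambda>\<phi>. \<lambda>C\<in>edge_cycles G \<sigma>. \<phi> (cycle_arc C)) (fixed_colourings X \<tau>)"
    by (rule inj_onI, rule fixed_colouring_eqI) (assumption | metis restrict_apply')+
  show "(\<lambda>\<phi>. \<lambda>C\<in>edge_cycles G \<sigma>. \<phi> (cycle_arc C)) ` fixed_colourings X \<tau> =
      PiE (edge_cycles G \<sigma>) (cycle_values X \<tau>)" (is "?l = ?r")
  proof
    show "?l \<subseteq> ?r" using fixed_colouring_on_cycle by fastforce
    show "?r \<subseteq> ?l"
    proof
      fix k assume k: "k \<in> ?r"
      then obtain \<phi> where \<phi>: "\<phi> \<in> fixed_colourings X \<tau>" "\<forall>C\<in>edge_cycles G \<sigma>. \<phi> (cycle_arc C) = k C"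
        using fixed_colouring_exists[OF k assms] by blast
      then have "k = (\<lambda>C\<in>edge_cycles G \<sigma>. \<phi> (cycle_arc C))"
        using k by (auto simp: fun_eq_iff PiE_iff extensional_def)
      then show "k \<in> ?l" using \<phi>(1) by blast
    qed
  qed
qed

section \<open>Sizes of fixed colourings and the Walsh weight\<close>

lemma sum_edges_by_cycles: "(\<Sum>e\<in>edges G. f e) = (\<Sum>C\<in>edge_cycles G \<sigma>. \<Sum>e\<in>C. f e)"
proof -
  have "edges G = \<Union>(edge_cycles G \<sigma>)"
    using edge_cycleD(1) edge_in_orbit by (fastforce simp: edge_cycles_def)
  then have "(\<Sum>e\<in>edges G. f e) = sum f (\<Union>(edge_cycles G \<sigma>))" by simp
  also have "\<dots> = (\<Sum>C\<in>edge_cycles G \<sigma>. \<Sum>e\<in>C. f e)"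
  proof (rule sum.Union_disjoint[unfolded comp_def])
    show "\<forall>C\<in>edge_cycles G \<sigma>. \<forall>D\<in>edge_cycles G \<sigma>. C \<noteq> D \<longrightarrow> C \<inter> D = {}"
      using edge_cycleD(3) by blast
  qed (use edge_cycleD(4) in blast)
  finally show ?thesis .
qed

text \<open>Along a cycle a fixed colouring is constant up to \<open>\<tau>\<close>, which
  \<open>w\<close> ignores; so every edge of the cycle weighs as much as the base arc.\<close>

lemma edge_weight_fixed_colouring:
  assumes "\<phi> \<in> fixed_colourings X \<tau>" "\<And>x. x \<in> X \<Longrightarrow> w (\<tau> x) = w x"
  shows "edge_weight G w \<phi> = (\<Sum>C\<in>edge_cycles G \<sigma>. card C * w (\<phi> (cycle_arc C)))"
proof -
  note col = fixed_colouringsD(1)[OF assms(1)]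
  have "w (\<phi> (arc_of e)) = w (\<phi> (cycle_arc C))" if C: "C \<in> edge_cycles G \<sigma>" and e: "e \<in> C" for C e
  proof -
    have eG: "e \<in> edges G" using edge_cycleD(1)[OF C] e by blast
    have "ends (arc_of e) \<in> C" using ends_arc_of[OF simple eG] e by simp
    then obtain i where "arc_of e = (arc_map ^^ i) (cycle_arc C) \<or>
        arc_of e = prod.swap ((arc_map ^^ i) (cycle_arc C))"
      using reach_edge[OF C cycle_arc(2)[OF C]] by blast
    then have "ends (arc_of e) = ends ((arc_map ^^ i) (cycle_arc C))" unfolding ends_eq_iff .
    then have "w (\<phi> (arc_of e)) = w (\<phi> ((arc_map ^^ i) (cycle_arc C)))"
      using arc_of_in_arcs[OF simple eG] cycle_arc(1)[OF C] arc_map_funpow_in_arcs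
      by (intro colouring_same_ends[where w = w, OF col assms(2)]) auto
    then show ?thesis by (simp only: fixed_colouringsD(2)[OF assms(1)])
  qed
  then show ?thesis unfolding edge_weight_def sum_edges_by_cycles by simp
qed

text \<open>The weight groups cycles by length, while colourings are chosen cycle by cycle. The
  vertex cycles collapse to one power of \<open>x\<close>, because their lengths add up to the
  number of vertices.\<close>

lemma walsh_weight_eq:
  "walsh_weight (\<lambda>k. fps_X ^ k) b c G \<sigma> =
    fps_X ^ card (verts G) * (\<Prod>C\<in>edge_cycles G \<sigma>. if moebius \<sigma> C then c (card C) else b (card C))"
proof -
  let ?E = "edge_cycles G \<sigma>"
  let ?f = "\<lambda>C. if moebius \<sigma> C then c (card C) else b (card C)"
  have "(\<Prod>k=1..card (verts G). (fps_X ^ k) ^ cyc k G \<sigma>) = fps_X ^ (\<Sum>k=1..card (verts G). k * cyc k G \<sigma>)"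
    by (simp add: power_sum power_mult)
  also have "\<dots> = fps_X ^ card (verts G)"
    using simple by (subst sum_cyc[OF _ automorphismsD(1)[OF aut]]) (simp_all add: simple_graph_def)
  finally have X: "(\<Prod>k=1..card (verts G). (fps_X ^ k) ^ cyc k G \<sigma>) = fps_X ^ card (verts G)" .
  have "b k ^ cyl k G \<sigma> * c k ^ moeb k G \<sigma> = (\<Prod>C | C \<in> ?E \<and> card C = k. ?f C)" for k
  proof -
    have "(\<Prod>C | C \<in> ?E \<and> card C = k. ?f C) =
        (\<Prod>C | C \<in> ?E \<and> card C = k \<and> moebius \<sigma> C. c k) * (\<Prod>C | C \<in> ?E \<and> card C = k \<and> \<not> moebius \<sigma> C. b k)"
      using finite_edge_cycles
      by (subst prod.If_cases)
        (auto intro!: arg_cong2[of _ _ _ _ "(*)"] arg_cong[of _ _ card] arg_cong[of _ _ "power _"])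
    moreover have "{C \<in> ?E. card C = k \<and> \<not> moebius \<sigma> C} = {C \<in> ?E. card C = k \<and> cylindrical \<sigma> C}"
      using cylindrical_iff_not_moebius by blast
    ultimately show ?thesis by (simp add: cyl_def moeb_def mult.commute)
  qed
  then have "(\<Prod>k=1..card (edges G). b k ^ cyl k G \<sigma> * c k ^ moeb k G \<sigma>) =
      (\<Prod>k=1..card (edges G). \<Prod>C | C \<in> ?E \<and> card C = k. ?f C)" by simp
  also have "\<dots> = (\<Prod>C\<in>?E. ?f C)"
  proof (rule prod.group)
    show "card ` ?E \<subseteq> {1..card (edges G)}"
      using edge_cycleD(1,5) card_mono[OF simple_graph_finite_edges[OF simple]] by force
  qed (use finite_edge_cycles in simp_all)
  finally show ?thesis unfolding walsh_weight_def X by simp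
qed

text \<open>A fixed colouring is an independent choice of one admissible colour per edge cycle, so
  its series is a product over cycles, each factor with sizes scaled by the cycle length.\<close>

lemma gf_fixed_colourings:
  assumes \<tau>: "\<And>x. x \<in> X \<Longrightarrow> \<tau> x \<in> X" "\<And>x. x \<in> X \<Longrightarrow> \<tau> (\<tau> x) = x"
    and pq: "\<And>x. x \<in> X \<Longrightarrow> p (\<tau> x) = p x" "\<And>x. x \<in> X \<Longrightarrow> q (\<tau> x) = q x"
    and fin: "finite_fibres X p q"
  shows "finite_fibres (fixed_colourings X \<tau>) (edge_weight G p) (edge_weight G q)"
    and "gf (fixed_colourings X \<tau>) (\<lambda>\<phi>. card (verts G) + edge_weight G p \<phi>) (edge_weight G q) =
      walsh_weight (\<lambda>k. fps_X ^ k) (\<lambda>k. subst_pow k (gf X p q))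
        (\<lambda>k. subst_pow k (gf {x \<in> X. \<tau> x = x} p q)) G \<sigma>"
proof -
  let ?E = "edge_cycles G \<sigma>" and ?Y = "cycle_values X \<tau>"
  let ?w = "\<lambda>w k. \<Sum>C\<in>?E. card C * w (k C)"
  have finC: "finite_fibres (?Y C) (\<lambda>x. card C * p x) (\<lambda>x. card C * q x)" if "C \<in> ?E" for C
  proof -
    have "{x \<in> ?Y C. card C * p x = n \<and> card C * q x = m} \<subseteq>
        {x \<in> X. p x = n div card C \<and> q x = m div card C}" for n m
      using edge_cycleD(5)[OF that] by (auto simp: cycle_values_def split: if_splits)
    then show ?thesis using fin finite_subset unfolding finite_fibres_def by meson
  qed
  note PiE = gf_PiE[where A = ?Y and p = "\<lambda>C x. card C * p x" and q = "\<lambda>C x. card C * q x",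
      OF finite_edge_cycles finC]
  note bij = fixed_colourings_bij_betw[OF \<tau>]
  have wt: "?w w (\<lambda>C\<in>?E. \<phi> (cycle_arc C)) = edge_weight G w \<phi>"
    if "\<phi> \<in> fixed_colourings X \<tau>" "\<And>x. x \<in> X \<Longrightarrow> w (\<tau> x) = w x" for w \<phi>
    using edge_weight_fixed_colouring[where w = w, OF that] by simp
  show "finite_fibres (fixed_colourings X \<tau>) (edge_weight G p) (edge_weight G q)"
    by (subst finite_fibres_bij_betw[OF bij, of "?w p" _ "?w q"]) (use wt pq PiE(1) in auto)
  have "gf (fixed_colourings X \<tau>) (edge_weight G p) (edge_weight G q) = gf (PiE ?E ?Y) (?w p) (?w q)"
    by (rule gf_bij_betw[OF bij]) (use wt pq in auto)
  also have "\<dots> = (\<Prod>C\<in>?E. gf (?Y C) (\<lambda>x. card C * p x) (\<lambda>x. card C * q x))"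
    by (rule PiE(2))
  also have "\<dots> = (\<Prod>C\<in>?E. if moebius \<sigma> C then subst_pow (card C) (gf {x \<in> X. \<tau> x = x} p q)
      else subst_pow (card C) (gf X p q))"
    using edge_cycleD(5) by (intro prod.cong) (auto simp: subst_pow_gf cycle_values_def)
  finally show "gf (fixed_colourings X \<tau>) (\<lambda>\<phi>. card (verts G) + edge_weight G p \<phi>) (edge_weight G q) =
      walsh_weight (\<lambda>k. fps_X ^ k) (\<lambda>k. subst_pow k (gf X p q))
        (\<lambda>k. subst_pow k (gf {x \<in> X. \<tau> x = x} p q)) G \<sigma>"
    unfolding walsh_weight_eq X_power_mult_gf[symmetric] by simp
qed

end

section \<open>Burnside's lemma for the colourings of one graph\<close>

definition colouring_equiv :: "'a graph \<Rightarrow> ('a \<times> 'a \<Rightarrow> 'x) set \<Rightarrow> (('a \<times> 'a \<Rightarrow> 'x) \<times> ('a \<times> 'a \<Rightarrow> 'x)) set" where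
  "colouring_equiv G \<Phi> = {(\<phi>, \<psi>). \<phi> \<in> \<Phi> \<and> \<psi> \<in> \<Phi> \<and> (\<exists>\<sigma>\<in>automorphisms G. pullback \<sigma> \<phi> = \<psi>)}"

text \<open>Each Walsh weight is the series of the colourings fixed by one automorphism, so their
  average over the group is Burnside's count at a single bidegree; both sizes are preserved by
  automorphisms, which therefore act on \<open>\<Phi> n m\<close>.\<close>

lemma walsh_term_coeff:
  assumes G: "simple_graph G"
    and \<tau>: "\<And>x. x \<in> X \<Longrightarrow> \<tau> x \<in> X" "\<And>x. x \<in> X \<Longrightarrow> \<tau> (\<tau> x) = x"
    and pq: "\<And>x. x \<in> X \<Longrightarrow> p (\<tau> x) = p x" "\<And>x. x \<in> X \<Longrightarrow> q (\<tau> x) = q x"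
    and fin: "finite_fibres X p q"
  defines "\<Phi> \<equiv> \<lambda>n m. {\<phi> \<in> colourings G X \<tau>. card (verts G) + edge_weight G p \<phi> = n \<and> edge_weight G q \<phi> = m}"
  shows "finite (\<Phi> n m)" and "equiv (\<Phi> n m) (colouring_equiv G (\<Phi> n m))"
    and "walsh_term (\<lambda>k. fps_X ^ k) (\<lambda>k. subst_pow k (gf X p q))
        (\<lambda>k. subst_pow k (gf {x \<in> X. \<tau> x = x} p q)) G $ n $ m =
      of_nat (card (\<Phi> n m // colouring_equiv G (\<Phi> n m)))"
proof -
  let ?A = "automorphisms G"
  have loc: "graph_automorphism G \<sigma>" if "\<sigma> \<in> ?A" for \<sigma>
    using G that by (simp add: graph_automorphism_def)
  \<comment> \<open>The identity fixes every colouring, so finiteness for all colourings is a case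
    of the result on fixed ones.\<close>
  interpret i: graph_automorphism G id using loc[OF automorphisms_id] .
  have "i.fixed_colourings X \<tau> = colourings G X \<tau>"
    by (auto simp: i.fixed_colourings_def pullback_def map_prod.id)
  then have "finite_fibres (colourings G X \<tau>) (edge_weight G p) (edge_weight G q)"
    using i.gf_fixed_colourings(1)[OF \<tau> pq fin] by simp
  \<comment> \<open>Truncated subtraction is harmless: for \<open>n < card (verts G)\<close> the
    left side is empty.\<close>
  moreover have "\<Phi> n m \<subseteq> {\<phi> \<in> colourings G X \<tau>. edge_weight G p \<phi> = n - card (verts G) \<and> edge_weight G q \<phi> = m}"
    by (auto simp: \<Phi>_def)
  ultimately show fin\<Phi>: "finite (\<Phi> n m)" unfolding finite_fibres_def by (meson finite_subset)
  have act_in: "pullback \<sigma> \<phi> \<in> \<Phi> n m" if "\<sigma> \<in> ?A" "\<phi> \<in> \<Phi> n m" for \<sigma> \<phi>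
    using that pullback_in_colourings[OF that(1) G, of \<phi> X \<tau>]
      edge_weight_pullback[OF that(1) G, of \<phi> X \<tau>] pq
    by (simp add: \<Phi>_def)
  have pid: "pullback id \<phi> = \<phi>" for \<phi> :: "'a \<times> 'a \<Rightarrow> 'x" by (simp add: pullback_def map_prod.id)
  have pcomp: "pullback (g \<circ> h) \<phi> = pullback h (pullback g \<phi>)" for g h :: "'a \<Rightarrow> 'a" and \<phi> :: "'a \<times> 'a \<Rightarrow> 'x"
    by (auto simp: pullback_def fun_eq_iff)
  note burn = burnside[of ?A "\<Phi> n m" pullback, OF finite_automorphisms[OF G] fin\<Phi> automorphisms_id
      automorphisms_comp automorphisms_inv[OF _ G] automorphismsD(3) act_in pid pcomp,
      folded colouring_equiv_def]
  show "equiv (\<Phi> n m) (colouring_equiv G (\<Phi> n m))" by (rule burn(1))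
  have coeff: "walsh_weight (\<lambda>k. fps_X ^ k) (\<lambda>k. subst_pow k (gf X p q))
        (\<lambda>k. subst_pow k (gf {x \<in> X. \<tau> x = x} p q)) G \<sigma> $ n $ m =
      of_nat (card {\<phi> \<in> \<Phi> n m. pullback \<sigma> \<phi> = \<phi>})" if "\<sigma> \<in> ?A" for \<sigma>
  proof -
    interpret s: graph_automorphism G \<sigma> using loc[OF that] .
    have "walsh_weight (\<lambda>k. fps_X ^ k) (\<lambda>k. subst_pow k (gf X p q))
        (\<lambda>k. subst_pow k (gf {x \<in> X. \<tau> x = x} p q)) G \<sigma> =
      gf (s.fixed_colourings X \<tau>) (\<lambda>\<phi>. card (verts G) + edge_weight G p \<phi>) (edge_weight G q)"
      by (rule s.gf_fixed_colourings(2)[where p = p and q = q, OF \<tau> pq fin, symmetric])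
    moreover have "{\<phi> \<in> s.fixed_colourings X \<tau>. card (verts G) + edge_weight G p \<phi> = n \<and> edge_weight G q \<phi> = m} =
        {\<phi> \<in> \<Phi> n m. pullback \<sigma> \<phi> = \<phi>}"
      by (auto simp: s.fixed_colourings_def \<Phi>_def)
    ultimately show ?thesis by (simp only: gf_nth)
  qed
  have "?A \<noteq> {}" using automorphisms_id by auto
  then have "card ?A \<noteq> 0" using finite_automorphisms[OF G] by simp
  moreover have "walsh_term (\<lambda>k. fps_X ^ k) (\<lambda>k. subst_pow k (gf X p q))
        (\<lambda>k. subst_pow k (gf {x \<in> X. \<tau> x = x} p q)) G $ n $ m =
      1 / of_nat (card ?A) * of_nat (\<Sum>\<sigma>\<in>?A. card {\<phi> \<in> \<Phi> n m. pullback \<sigma> \<phi> = \<phi>})"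
    by (simp add: walsh_term_def fps_sum_nth coeff)
  ultimately show "walsh_term (\<lambda>k. fps_X ^ k) (\<lambda>k. subst_pow k (gf X p q))
        (\<lambda>k. subst_pow k (gf {x \<in> X. \<tau> x = x} p q)) G $ n $ m =
      of_nat (card (\<Phi> n m // colouring_equiv G (\<Phi> n m)))"
    by (simp only: burn(2)[symmetric] of_nat_mult) simp
qed

section \<open>Isomorphism types of networks and realised colourings\<close>

abbreviation class_internal :: "'a network set \<Rightarrow> nat" where
  "class_internal K \<equiv> card (internal (SOME N. N \<in> K))"

abbreviation class_edges :: "'a network set \<Rightarrow> nat" where
  "class_edges K \<equiv> card (edges (ngraph (SOME N. N \<in> K)))"

lemma network_class_sizes:
  assumes "network N"
  shows "class_internal (network_iso_rel `` {N}) = card (internal N)"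
    and "class_edges (network_iso_rel `` {N}) = card (edges (ngraph N))"
proof -
  have "N \<in> network_iso_rel `` {N}" using network_iso_rel_refl by blast
  then have "(SOME M. M \<in> network_iso_rel `` {N}) \<in> network_iso_rel `` {N}" by (rule someI)
  then obtain f where "network_iso f N (SOME M. M \<in> network_iso_rel `` {N})"
    by (auto simp: network_iso_rel_def)
  from network_iso_card[OF this assms]
  show "class_internal (network_iso_rel `` {N}) = card (internal N)"
    and "class_edges (network_iso_rel `` {N}) = card (edges (ngraph N))" .
qed

lemma network_gf_eq:
  assumes "\<And>N. N \<in> \<N> \<Longrightarrow> network N"
  shows "network_gf \<N> = gf (\<N> // network_iso_rel) class_internal class_edges"
  unfolding network_gf_def
proof (rule class_gf_eq_gf)
  show "(N, N) \<in> network_iso_rel" for N :: "'a network" by (rule network_iso_rel_refl)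
  show "card (internal M) = card (internal N) \<and> card (edges (ngraph M)) = card (edges (ngraph N))"
    if "N \<in> \<N>" "(N, M) \<in> network_iso_rel" for N M
    using network_iso_card[OF _ assms[OF that(1)]] that(2) by (auto simp: network_iso_rel_def)
qed

text \<open>Every type with \<open>n\<close> internal vertices has a copy on one fixed set of
  \<open>n + 2\<close> vertices with fixed poles, and that set carries finitely many edge
  sets.\<close>

lemma finite_fibres_network_classes:
  fixes \<N> :: "'a::infinite network set"
  assumes "\<And>N. N \<in> \<N> \<Longrightarrow> network N"
  shows "finite_fibres (\<N> // network_iso_rel) class_internal class_edges"
  unfolding finite_fibres_def
proof (intro allI)
  fix n m
  obtain V :: "'a set" where V: "finite V" "card V = Suc (Suc n)"
    using infinite_arbitrarily_large[OF infinite_UNIV] by blast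
  obtain a B where B: "V = insert a B" "a \<notin> B" "card B = Suc n"
    using card_Suc_eq[THEN iffD1, OF V(2)] by blast
  obtain b A where A: "B = insert b A" "b \<notin> A" "card A = n"
    using card_Suc_eq[THEN iffD1, OF B(3)] by blast
  have finA: "finite A" using V(1) A(1) B(1) by simp
  have "{K \<in> \<N> // network_iso_rel. class_internal K = n \<and> class_edges K = m} \<subseteq>
      (\<lambda>E. network_iso_rel `` {Network (Graph V E) a b}) ` Pow (Pow V)"
  proof
    fix K assume "K \<in> {K \<in> \<N> // network_iso_rel. class_internal K = n \<and> class_edges K = m}"
    then obtain N where N: "N \<in> \<N>" "K = network_iso_rel `` {N}" "class_internal K = n"
      by (auto elim: quotientE)
    then have n: "card (internal N) = n" using network_class_sizes(1)[OF assms[OF N(1)]] by simp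
    obtain M f where M: "network M" "network_iso f N M" "pole0 M = a" "pole1 M = b"
        "verts (ngraph M) = V"
    proof (rule relabel_network[OF assms[OF N(1)] finA])
      show "card A = card (internal N)" "a \<notin> A" "b \<notin> A" "a \<noteq> b"
        using A B n by auto
    qed (use A(1) B(1) in blast)
    have "K = network_iso_rel `` {M}"
      using N(2) M(2) network_iso_rel_class_eq[OF assms[OF N(1)]] by (auto simp: network_iso_rel_def)
    moreover have "M = Network (Graph V (edges (ngraph M))) a b"
      using M(3-5) by (cases M; cases "ngraph M") auto
    moreover have "edges (ngraph M) \<in> Pow (Pow V)"
      using M(1,5) by (auto simp: network_def simple_graph_def)
    ultimately show "K \<in> (\<lambda>E. network_iso_rel `` {Network (Graph V E) a b}) ` Pow (Pow V)"
      by (metis (no_types, lifting) image_eqI)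
  qed
  then show "finite {K \<in> \<N> // network_iso_rel. class_internal K = n \<and> class_edges K = m}"
    by (rule finite_subset) (simp add: V(1))
qed

section \<open>Isomorphisms of pairs\<close>

lemma core_iso_rel_sym:
  assumes "((G, H), (G', H')) \<in> core_iso_rel" "simple_graph G" "simple_graph H" "verts H \<subseteq> verts G"
  shows "((G', H'), (G, H)) \<in> core_iso_rel"
proof -
  obtain f where f: "graph_iso f G G'" "graph_iso f H H'" using assms(1) by (auto simp: core_iso_rel_def)
  have "inv_into (verts G) f (f v) = v" if "v \<in> verts G" for v
    using graph_iso_inj[OF f(1)] that by simp
  then show ?thesis
    using graph_iso_inverse[OF f(1) assms(2), of "inv_into (verts G) f"]
      graph_iso_inverse[OF f(2) assms(3), of "inv_into (verts G) f"] assms(4)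
    by (auto simp: core_iso_rel_def)
qed

lemma core_iso_rel_trans:
  assumes "(s, t) \<in> core_iso_rel" "(t, u) \<in> core_iso_rel"
  shows "(s, u) \<in> core_iso_rel"
  using assms graph_iso_comp unfolding core_iso_rel_def by fast

text \<open>\<open>graph_iso\<close> leaves a map arbitrary off the vertices, whereas
  \<open>automorphisms\<close> demands the identity there so that the group is finite and correctly
  counted.\<close>

lemma automorphism_of_graph_iso:
  assumes "graph_iso s G G" "simple_graph G"
  shows "(\<lambda>x. if x \<in> verts G then s x else x) \<in> automorphisms G"
proof -
  let ?s = "\<lambda>x. if x \<in> verts G then s x else x"
  have iso: "graph_iso ?s G G" using graph_iso_cong[OF assms, of ?s] by simp
  then have "?s permutes verts G" by (intro bij_imp_permutes) (auto simp: graph_iso_def)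
  then show ?thesis using iso by (simp add: automorphisms_def)
qed

section \<open>Types of networks as colours\<close>

locale network_classes =
  fixes \<N> :: "'a::infinite network set"
  assumes species: "network_species \<N>" and symmetric: "symmetric_networks \<N>"
begin

definition classes :: "'a network set set" where
  "classes = \<N> // network_iso_rel"

abbreviation cls :: "'a network \<Rightarrow> 'a network set" where
  "cls N \<equiv> network_iso_rel `` {N}"

lemma networks: "N \<in> \<N> \<Longrightarrow> network N"
  using species by (simp add: network_species_def)

lemma cls_in_classes: "N \<in> \<N> \<Longrightarrow> cls N \<in> classes"
  unfolding classes_def by (rule quotientI)

lemma classesE:
  assumes "K \<in> classes"
  obtains N where "N \<in> \<N>" "K = cls N"
  using assms unfolding classes_def by (rule quotientE)

lemma opposite_in_classes: "K \<in> classes \<Longrightarrow> opposite ` K \<in> classes"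
  using symmetric cls_in_classes by (auto simp: opposite_class symmetric_networks_def elim!: classesE)

lemma opposite_opposite_class: "opposite ` opposite ` K = K"
  by (simp add: image_comp comp_def)

lemma opposite_class_sizes:
  assumes "K \<in> classes"
  shows "class_internal (opposite ` K) = class_internal K" "class_edges (opposite ` K) = class_edges K"
proof -
  obtain N where N: "N \<in> \<N>" "K = cls N" using assms by (rule classesE)
  note net = networks[OF N(1)]
  show "class_internal (opposite ` K) = class_internal K" "class_edges (opposite ` K) = class_edges K"
    by (simp_all only: N(2) opposite_class network_class_sizes[OF net]
        network_class_sizes[OF network_opposite[OF net]] opposite_simps)
qed

lemma finite_fibres_classes: "finite_fibres classes class_internal class_edges"
  unfolding classes_def using networks by (rule finite_fibres_network_classes)

lemma network_gf_classes: "network_gf \<N> = gf classes class_internal class_edges"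
  unfolding classes_def using networks by (rule network_gf_eq)

text \<open>A type is fixed by the exchange of poles exactly if its networks are self-opposite, so
  the colours admissible on Moebius cycles are the types in
  \<open>self_opposite \<N>\<close>.\<close>

lemma self_opposite_gf_classes:
  "network_gf (self_opposite \<N>) = gf {K \<in> classes. opposite ` K = K} class_internal class_edges"
proof -
  have "opposite ` cls N = cls N \<longleftrightarrow> (opposite N, N) \<in> network_iso_rel" if "N \<in> \<N>" for N
    unfolding opposite_class using network_iso_rel_class_eq[OF network_opposite[OF networks[OF that]]] .
  then have "self_opposite \<N> // network_iso_rel = {K \<in> classes. opposite ` K = K}"
    unfolding self_opposite_def classes_def quotient_def by blast
  then show ?thesis
    using network_gf_eq[of "self_opposite \<N>"] networks by (simp add: self_opposite_def)
qed

lemma subst_classE: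
  assumes "(G, H) \<in> \<G> \<up> \<N>" "graph_species \<G>"
  obtains M where "H \<in> \<G>" "simple_graph H" "arc_subst H M G" "\<And>p. p \<in> arcs H \<Longrightarrow> M p \<in> \<N>"
    "simple_graph G" "verts H \<subseteq> verts G"
proof -
  obtain N where H: "H \<in> \<G>" and N: "\<And>e. e \<in> edges H \<Longrightarrow> N e \<in> \<N>" and sub: "is_substitution H N G"
    using assms(1) by (auto simp: subst_class_def)
  have simple: "simple_graph H" using H assms(2) by (simp add: graph_species_def)
  obtain M where M: "arc_subst H M G" "\<forall>p\<in>arcs H. M p \<in> \<N>"
    using arc_subst_of_substitution[OF sub N simple species symmetric] by blast
  show ?thesis
    using that[OF H simple M(1)] M(2) arc_subst_simple[OF M(1) simple] arc_substD(7)[OF M(1)] by blast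
qed

lemma core_iso_rel_class_eq:
  assumes "s \<in> \<G> \<up> \<N>" "graph_species \<G>"
  shows "core_iso_rel `` {s} = core_iso_rel `` {s'} \<longleftrightarrow> (s, s') \<in> core_iso_rel"
proof -
  obtain G H where s: "s = (G, H)" by (cases s)
  obtain M where "simple_graph H" "simple_graph G" "verts H \<subseteq> verts G"
    using assms(1)[unfolded s] assms(2) by (rule subst_classE)
  then have "(s', s) \<in> core_iso_rel" if "(s, s') \<in> core_iso_rel"
    using core_iso_rel_sym that unfolding s by (cases s') blast
  moreover have "(s', s') \<in> core_iso_rel"
    using graph_iso_id by (cases s') (auto simp: core_iso_rel_def)
  ultimately show ?thesis using core_iso_rel_trans by blast
qed

text \<open>The identification \<open>g\<close> of \<open>G0\<close> with the core is existentially
  quantified: different choices give colourings in the same orbit, so the orbit and not the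
  colouring is an invariant of the pair.\<close>

definition realizes :: "'a graph \<Rightarrow> 'a graph \<times> 'a graph \<Rightarrow> ('a \<times> 'a \<Rightarrow> 'a network set) \<Rightarrow> bool" where
  "realizes G0 s \<phi> \<longleftrightarrow> (\<exists>g M. graph_iso g G0 (snd s) \<and> arc_subst (snd s) M (fst s) \<and>
     (\<forall>p\<in>arcs (snd s). M p \<in> \<N>) \<and> (\<forall>p\<in>arcs G0. \<phi> p = cls (M (map_prod g g p))))"

lemma realizes_card:
  assumes "simple_graph G0" "realizes G0 (G, H) \<phi>"
  shows "card (verts G) = card (verts G0) + edge_weight G0 class_internal \<phi>"
    and "card (edges G) = edge_weight G0 class_edges \<phi>"
proof -
  obtain g M where g: "graph_iso g G0 H" and M: "arc_subst H M G" "\<And>p. p \<in> arcs H \<Longrightarrow> M p \<in> \<N>"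
    and \<phi>: "\<And>p. p \<in> arcs G0 \<Longrightarrow> \<phi> p = cls (M (map_prod g g p))"
    using assms(2) by (auto simp: realizes_def)
  have H: "simple_graph H" using graph_iso_simple[OF g assms(1)] .
  have inj: "inj_on (\<lambda>e. g ` e) (edges G0)"
    using inj_on_image_eq_iff[OF graph_iso_inj[OF g]] simple_graph_edge_subset[OF assms(1)]
    by (simp add: inj_on_def)
  \<comment> \<open>\<open>g\<close> may carry a chosen arc to the reverse of a chosen arc, so only
    quantities blind to direction can be transported.\<close>
  have reindex: "(\<Sum>e\<in>edges G0. w (M (map_prod g g (arc_of e)))) = (\<Sum>e\<in>edges H. w (M (arc_of e)))"
    if w: "\<And>p q. p \<in> arcs H \<Longrightarrow> q \<in> arcs H \<Longrightarrow> ends p = ends q \<Longrightarrow> w (M p) = w (M q)"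
    for w :: "'a network \<Rightarrow> nat"
    unfolding graph_iso_edges[OF g] sum.reindex[OF inj] comp_def
  proof (rule sum.cong[OF refl], rule w)
    fix e assume e: "e \<in> edges G0"
    then have e': "g ` e \<in> edges H" by (simp add: graph_iso_edges[OF g])
    show "map_prod g g (arc_of e) \<in> arcs H"
      using map_prod_in_arcs[OF g arc_of_in_arcs[OF assms(1) e]] .
    show "arc_of (g ` e) \<in> arcs H" using arc_of_in_arcs[OF H e'] .
    show "ends (map_prod g g (arc_of e)) = ends (arc_of (g ` e))"
      using ends_arc_of[OF assms(1) e] ends_arc_of[OF H e'] by simp
  qed
  have arc: "arc_of e \<in> arcs G0" "M (map_prod g g (arc_of e)) \<in> \<N>" if "e \<in> edges G0" for e
    using arc_of_in_arcs[OF assms(1) that] M(2) map_prod_in_arcs[OF g] by auto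
  have "edge_weight G0 class_internal \<phi> = (\<Sum>e\<in>edges G0. card (internal (M (map_prod g g (arc_of e)))))"
    unfolding edge_weight_def
    by (intro sum.cong refl) (simp only: \<phi>[OF arc(1)] network_class_sizes(1)[OF networks[OF arc(2)]])
  also have "\<dots> = (\<Sum>e\<in>edges H. card (internal (M (arc_of e))))"
    by (rule reindex) (rule arg_cong[OF arc_subst_same_ends(1)[OF M(1)]])
  finally show "card (verts G) = card (verts G0) + edge_weight G0 class_internal \<phi>"
    using arc_subst_card(1)[OF M(1) H] graph_iso_verts[OF g] card_image[OF graph_iso_inj[OF g]] by simp
  have "edge_weight G0 class_edges \<phi> = (\<Sum>e\<in>edges G0. card (edges (ngraph (M (map_prod g g (arc_of e))))))"
    unfolding edge_weight_def
    by (intro sum.cong refl) (simp only: \<phi>[OF arc(1)] network_class_sizes(2)[OF networks[OF arc(2)]])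
  also have "\<dots> = (\<Sum>e\<in>edges H. card (edges (ngraph (M (arc_of e)))))"
    by (rule reindex) (rule arg_cong[OF arc_subst_same_ends(2)[OF M(1)]])
  finally show "card (edges G) = edge_weight G0 class_edges \<phi>"
    using arc_subst_card(2)[OF M(1) H] by simp
qed

lemma realizes_total:
  assumes "graph_species \<G>" "simple_graph G0" "(G, H) \<in> \<G> \<up> \<N>" "(G0, H) \<in> graph_iso_rel"
  shows "\<exists>\<phi>\<in>colourings G0 classes (image opposite). realizes G0 (G, H) \<phi>"
proof -
  obtain M where M: "arc_subst H M G" "\<And>p. p \<in> arcs H \<Longrightarrow> M p \<in> \<N>"
    using subst_classE[OF assms(3,1)] by blast
  obtain g where g: "graph_iso g G0 H" using assms(4) by (auto simp: graph_iso_rel_def)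
  define \<phi> where "\<phi> p = (if p \<in> arcs G0 then cls (M (map_prod g g p)) else undefined)" for p
  note gp = map_prod_in_arcs[OF g]
  have "\<phi> (prod.swap p) = opposite ` \<phi> p" if "p \<in> arcs G0" for p
    using that arc_substD(4)[OF M(1) gp[OF that]]
    by (simp add: \<phi>_def opposite_class swap_map_prod[symmetric])
  moreover have "\<phi> \<in> PiE (arcs G0) (\<lambda>_. classes)"
  proof
    show "\<phi> p \<in> classes" if "p \<in> arcs G0" for p
      using that cls_in_classes[OF M(2)[OF gp[OF that]]] by (simp add: \<phi>_def)
  qed (simp add: \<phi>_def)
  ultimately have "\<phi> \<in> colourings G0 classes (image opposite)"
    by (simp add: colourings_def)
  moreover have "realizes G0 (G, H) \<phi>"
    unfolding realizes_def using g M by (intro exI[of _ g] exI[of _ M]) (simp add: \<phi>_def)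
  ultimately show ?thesis by blast
qed

text \<open>The networks can be planted on \<open>G0\<close> itself, with the identity as
  identification of the cores.\<close>

lemma realizes_surj:
  assumes "G0 \<in> \<G>" "simple_graph G0" "\<phi> \<in> colourings G0 classes (image opposite)"
  shows "\<exists>G. (G, G0) \<in> \<G> \<up> \<N> \<and> realizes G0 (G, G0) \<phi>"
proof -
  have \<phi>: "\<phi> p \<in> \<N> // network_iso_rel" "\<phi> (prod.swap p) = opposite ` \<phi> p" if "p \<in> arcs G0" for p
    using assms(3) that PiE_mem[of \<phi>] by (auto simp: colourings_def classes_def)
  obtain M G where M: "arc_subst G0 M G" "\<And>p. p \<in> arcs G0 \<Longrightarrow> M p \<in> \<N> \<and> cls (M p) = \<phi> p"
    using arc_subst_exists[OF assms(2) species symmetric, of \<phi>, OF \<phi>] by blast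
  have "\<forall>e\<in>edges G0. M (arc_of e) \<in> \<N>"
    using M(2) arc_of_in_arcs[OF assms(2)] by blast
  then have "(G, G0) \<in> \<G> \<up> \<N>"
    unfolding subst_class_def mem_Collect_eq prod.case
    using assms(1) substitution_of_arc_subst[OF M(1) assms(2)]
    by (intro conjI exI[of _ "\<lambda>e. M (arc_of e)"])
  moreover have "realizes G0 (G, G0) \<phi>"
    unfolding realizes_def using M graph_iso_id[of G0]
    by (intro exI[of _ id] exI[of _ M]) (auto simp: map_prod.id)
  ultimately show ?thesis by blast
qed

text \<open>The automorphism is \<open>g'\<close> followed by the inverse of
  \<open>f \<circ> g\<close>, going around the square of the two identifications and the core
  isomorphism. Uniqueness of the networks, \<open>arc_subst_unique\<close>, makes the types
  agree.\<close>

lemma realizes_equiv_if_iso: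
  assumes G0: "simple_graph G0"
    and \<phi>: "\<phi> \<in> colourings G0 classes \<tau>" "realizes G0 (G, H) \<phi>"
    and \<psi>: "\<psi> \<in> colourings G0 classes \<tau>" "realizes G0 (G', H') \<psi>"
    and iso: "((G, H), (G', H')) \<in> core_iso_rel"
  shows "\<exists>\<sigma>\<in>automorphisms G0. pullback \<sigma> \<phi> = \<psi>"
proof -
  obtain g M where g: "graph_iso g G0 H" and M: "arc_subst H M G" "\<And>p. p \<in> arcs H \<Longrightarrow> M p \<in> \<N>"
    and \<phi>_eq: "\<And>p. p \<in> arcs G0 \<Longrightarrow> \<phi> p = cls (M (map_prod g g p))"
    using \<phi>(2) by (auto simp: realizes_def)
  obtain g' M' where g': "graph_iso g' G0 H'" and M': "arc_subst H' M' G'"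
    and \<psi>_eq: "\<And>p. p \<in> arcs G0 \<Longrightarrow> \<psi> p = cls (M' (map_prod g' g' p))"
    using \<psi>(2) by (auto simp: realizes_def)
  obtain f where f: "graph_iso f G G'" "graph_iso f H H'" using iso by (auto simp: core_iso_rel_def)
  have H: "simple_graph H" using graph_iso_simple[OF g G0] .
  note fg = graph_iso_comp[OF g f(2)]
  let ?i = "inv_into (verts G0) (f \<circ> g)"
  define \<sigma> where "\<sigma> x = (if x \<in> verts G0 then (?i \<circ> g') x else x)" for x
  have \<sigma>: "\<sigma> \<in> automorphisms G0"
    unfolding \<sigma>_def
    by (rule automorphism_of_graph_iso[OF graph_iso_comp[OF g' graph_iso_inv_into[OF fg G0]] G0])
  have fg\<sigma>: "f (g (\<sigma> x)) = g' x" if "x \<in> verts G0" for x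
  proof -
    have "g' x \<in> (f \<circ> g) ` verts G0"
      using that graph_iso_verts[OF g'] graph_iso_verts[OF fg] by blast
    then show ?thesis using f_inv_into_f[of "g' x" "f \<circ> g" "verts G0"] that by (simp add: \<sigma>_def)
  qed
  have "\<phi> (map_prod \<sigma> \<sigma> p) = \<psi> p" for p
  proof (cases "p \<in> arcs G0")
    case True
    then have \<sigma>p: "map_prod \<sigma> \<sigma> p \<in> arcs G0" using map_prod_automorphism_in_arcs[OF \<sigma> G0] by simp
    let ?q = "map_prod g g (map_prod \<sigma> \<sigma> p)"
    have q: "?q \<in> arcs H" using map_prod_in_arcs[OF g \<sigma>p] .
    have "map_prod f f ?q = map_prod g' g' p"
      using fg\<sigma> arc_in_verts[OF G0 True] by (cases p) simp
    then have "(M ?q, M' (map_prod g' g' p)) \<in> network_iso_rel"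
      using arc_subst_unique[OF M(1) M' H f q] by (auto simp: network_iso_rel_def)
    then show ?thesis
      unfolding \<phi>_eq[OF \<sigma>p] \<psi>_eq[OF True] using network_iso_rel_class_eq[OF networks[OF M(2)[OF q]]] by simp
  next
    case False
    then have "map_prod \<sigma> \<sigma> p \<notin> arcs G0" using map_prod_automorphism_in_arcs[OF \<sigma> G0] by simp
    then show ?thesis
      using False \<phi>(1) \<psi>(1) PiE_arb[of \<phi> "arcs G0" "\<lambda>_. classes" "map_prod \<sigma> \<sigma> p"]
        PiE_arb[of \<psi> "arcs G0" "\<lambda>_. classes" p]
      by (simp add: colourings_def)
  qed
  then have "pullback \<sigma> \<phi> = \<psi>" by (simp only: pullback_def)
  then show ?thesis using \<sigma> ..
qed

text \<open>Going from \<open>H\<close> back to \<open>G0\<close> by the inverse of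
  \<open>g \<circ> \<sigma>\<close> and on to \<open>H'\<close> by \<open>g'\<close> gives a core
  isomorphism that respects network types; \<open>arc_subst_glue\<close> extends it to the whole
  graphs.\<close>

lemma iso_if_realizes_equiv:
  assumes G0: "simple_graph G0" and \<phi>: "realizes G0 (G, H) \<phi>" and \<psi>: "realizes G0 (G', H') \<psi>"
    and \<sigma>: "\<sigma> \<in> automorphisms G0" "pullback \<sigma> \<phi> = \<psi>"
  shows "((G, H), (G', H')) \<in> core_iso_rel"
proof -
  obtain g M where g: "graph_iso g G0 H" and M: "arc_subst H M G" "\<And>p. p \<in> arcs H \<Longrightarrow> M p \<in> \<N>"
    and \<phi>_eq: "\<And>p. p \<in> arcs G0 \<Longrightarrow> \<phi> p = cls (M (map_prod g g p))"
    using \<phi> by (auto simp: realizes_def)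
  obtain g' M' where g': "graph_iso g' G0 H'" and M': "arc_subst H' M' G'"
    and \<psi>_eq: "\<And>p. p \<in> arcs G0 \<Longrightarrow> \<psi> p = cls (M' (map_prod g' g' p))"
    using \<psi> by (auto simp: realizes_def)
  have H: "simple_graph H" using graph_iso_simple[OF g G0] .
  let ?r = "inv \<sigma> \<circ> inv_into (verts G0) g"
  have r: "graph_iso ?r H G0"
    using graph_iso_comp[OF graph_iso_inv_into[OF g G0] automorphismsD(2)[OF automorphisms_inv[OF \<sigma>(1) G0]]] .
  have r_inverse: "g (\<sigma> (?r x)) = x" if "x \<in> verts H" for x
    using that graph_iso_verts[OF g] automorphismsD(3)[OF \<sigma>(1)]
    by (simp add: surj_f_inv_f bij_is_surj f_inv_into_f)
  have "(M p, M' (map_prod (g' \<circ> ?r) (g' \<circ> ?r) p)) \<in> network_iso_rel" if p: "p \<in> arcs H" for p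
  proof -
    let ?q = "map_prod ?r ?r p"
    have q: "?q \<in> arcs G0" using map_prod_in_arcs[OF r p] .
    have \<sigma>q: "map_prod \<sigma> \<sigma> ?q \<in> arcs G0" using map_prod_automorphism_in_arcs[OF \<sigma>(1) G0] q by simp
    have "map_prod g g (map_prod \<sigma> \<sigma> ?q) = p"
      using r_inverse arc_in_verts[OF H p] by (cases p) simp
    then have "cls (M p) = \<phi> (map_prod \<sigma> \<sigma> ?q)" using \<phi>_eq[OF \<sigma>q] by simp
    also have "\<dots> = \<psi> ?q" using \<sigma>(2) by (auto simp: pullback_def)
    also have "\<dots> = cls (M' (map_prod g' g' ?q))" using \<psi>_eq[OF q] .
    also have "map_prod g' g' ?q = map_prod (g' \<circ> ?r) (g' \<circ> ?r) p" by (cases p) simp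
    finally show ?thesis using network_iso_rel_class_eq[OF networks[OF M(2)[OF p]]] by simp
  qed
  then obtain f where "graph_iso f G G'" "graph_iso f H H'"
    using arc_subst_glue[OF M(1) M' H graph_iso_comp[OF r g']] by blast
  then show ?thesis by (auto simp: core_iso_rel_def)
qed

section \<open>Counting pairs over one core\<close>

definition sized_substs :: "'a graph set \<Rightarrow> nat \<Rightarrow> nat \<Rightarrow> ('a graph \<times> 'a graph) set" where
  "sized_substs \<G> n m = {s \<in> \<G> \<up> \<N>. card (verts (fst s)) = n \<and> card (edges (fst s)) = m}"

text \<open>Through \<open>realizes\<close>, types of pairs of the given size whose core is a copy
  of \<open>G0\<close> match orbits of colourings of that size.\<close>

lemma card_substs_over_core:
  fixes n m :: nat
  assumes \<G>: "graph_species \<G>" "G0 \<in> \<G>"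
  defines "S \<equiv> {s \<in> sized_substs \<G> n m. (G0, snd s) \<in> graph_iso_rel}"
  shows "finite (S // core_iso_rel)"
    and "of_nat (card (S // core_iso_rel)) =
      walsh_term (\<lambda>k. fps_X ^ k) (\<lambda>k. subst_pow k (network_gf \<N>))
        (\<lambda>k. subst_pow k (network_gf (self_opposite \<N>))) G0 $ n $ m"
proof -
  have G0: "simple_graph G0" using \<G> by (simp add: graph_species_def)
  define \<Phi> where "\<Phi> = {\<phi> \<in> colourings G0 classes (image opposite).
    card (verts G0) + edge_weight G0 class_internal \<phi> = n \<and> edge_weight G0 class_edges \<phi> = m}"
  let ?Q = "colouring_equiv G0 \<Phi>"
  note walsh = walsh_term_coeff[where p = class_internal and q = class_edges and \<tau> = "image opposite",
      OF G0 opposite_in_classes opposite_opposite_class opposite_class_sizes finite_fibres_classes,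
      of n m, folded \<Phi>_def]
  have "\<exists>h. bij_betw h (S // core_iso_rel) (\<Phi> // ?Q)"
  proof (rule quotient_bij_of_relation[where \<rho> = "realizes G0"])
    show "core_iso_rel `` {s} = core_iso_rel `` {s'} \<longleftrightarrow> (s, s') \<in> core_iso_rel" if "s \<in> S" for s s'
      using core_iso_rel_class_eq[OF _ \<G>(1)] that by (simp add: S_def sized_substs_def)
    show "?Q `` {\<phi>} = ?Q `` {\<psi>} \<longleftrightarrow> (\<phi>, \<psi>) \<in> ?Q" if "\<phi> \<in> \<Phi>" "\<psi> \<in> \<Phi>" for \<phi> \<psi>
      using eq_equiv_class_iff[OF walsh(2) that] .
    show "\<exists>\<phi>\<in>\<Phi>. realizes G0 s \<phi>" if "s \<in> S" for s
      using that realizes_total[OF \<G>(1) G0] realizes_card[OF G0]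
      by (cases s) (fastforce simp: S_def sized_substs_def \<Phi>_def)
    show "\<exists>s\<in>S. realizes G0 s \<phi>" if "\<phi> \<in> \<Phi>" for \<phi>
    proof -
      obtain G where G: "(G, G0) \<in> \<G> \<up> \<N>" "realizes G0 (G, G0) \<phi>"
        using realizes_surj[OF \<G>(2) G0] \<open>\<phi> \<in> \<Phi>\<close> by (auto simp: \<Phi>_def)
      then have "(G, G0) \<in> S"
        using realizes_card[OF G0 G(2)] that graph_iso_rel_refl[of G0]
        by (simp add: S_def sized_substs_def \<Phi>_def)
      then show ?thesis using G(2) by blast
    qed
    show "(s, s') \<in> core_iso_rel \<longleftrightarrow> (\<phi>, \<psi>) \<in> ?Q"
      if "s \<in> S" "\<phi> \<in> \<Phi>" "s' \<in> S" "\<psi> \<in> \<Phi>" "realizes G0 s \<phi>" "realizes G0 s' \<psi>" for s \<phi> s' \<psi>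
    proof -
      have "\<phi> \<in> colourings G0 classes (image opposite)" "\<psi> \<in> colourings G0 classes (image opposite)"
        using that by (auto simp: \<Phi>_def)
      then show ?thesis
        using realizes_equiv_if_iso[OF G0] iso_if_realizes_equiv[OF G0] that
        by (cases s; cases s') (unfold colouring_equiv_def, blast)
    qed
  qed
  then obtain h where h: "bij_betw h (S // core_iso_rel) (\<Phi> // ?Q)" ..
  have "finite (\<Phi> // ?Q)"
    using walsh(1) equiv_type[OF walsh(2)] by (rule finite_quotient)
  then show "finite (S // core_iso_rel)" using bij_betw_finite[OF h] by simp
  show "of_nat (card (S // core_iso_rel)) =
      walsh_term (\<lambda>k. fps_X ^ k) (\<lambda>k. subst_pow k (network_gf \<N>))
        (\<lambda>k. subst_pow k (network_gf (self_opposite \<N>))) G0 $ n $ m"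
    unfolding network_gf_classes self_opposite_gf_classes bij_betw_same_card[OF h]
    by (rule walsh(3)[symmetric])
qed

end

text \<open>The term of a graph with more than \<open>n\<close> vertices is divisible by a higher
  power of \<open>x\<close> than the \<open>n\<close>th, so only finitely many terms reach this
  coefficient of the \<open>x\<close>-adic sum.\<close>

lemma walsh_index_nth:
  fixes \<G> :: "'a::infinite graph set"
  assumes \<G>: "graph_species \<G>" and dvd: "\<And>k. k \<ge> 1 \<Longrightarrow> fps_X ^ k dvd a k"
  shows "walsh_index \<G> a b c $ n =
    (\<Sum>G | G \<in> graph_reps \<G> \<and> card (verts G) \<le> n. walsh_term a b c G $ n)"
proof -
  let ?t = "walsh_term a b c" and ?R = "graph_reps \<G>"
  have "{G. G \<in> ?R \<and> card (verts G) \<le> n} = (\<Union>i\<le>n. {G \<in> ?R. card (verts G) = i})" by auto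
  then have fin: "finite {G. G \<in> ?R \<and> card (verts G) \<le> n}" using finite_graph_reps[OF \<G>] by simp
  have zero: "?t G $ n = 0" if "n < card (verts G)" for G
  proof -
    have "finite (verts G)" using that by (intro card_ge_0_finite) simp
    from X_power_dvd_walsh_term[where a = a and b = b and c = c, OF this dvd]
    show ?thesis using that by (auto elim!: dvdE simp: fps_X_power_mult_nth)
  qed
  have "(?t has_sum walsh_index \<G> a b c) ?R"
    unfolding walsh_index_def by (rule has_sum_infsum[OF walsh_term_summable[OF \<G> dvd]])
  from has_sum_fpsD(2)[OF this, of n] show ?thesis
    using zero fin by (simp, intro sum.mono_neutral_left) (auto simp: not_le[symmetric])
qed

section \<open>Representatives of the cores and summation over them\<close>

lemma graph_reps_in:
  assumes "graph_species \<G>" "G \<in> graph_reps \<G>"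
  shows "G \<in> \<G>"
proof -
  obtain C where C: "C \<in> \<G> // graph_iso_rel" "G = (SOME H. H \<in> C)"
    using assms(2) by (auto simp: graph_reps_def)
  obtain H where "H \<in> \<G>" "simple_graph H" "(H, G) \<in> graph_iso_rel"
    using graph_reps_props[OF assms(1) C(1)] C(2) by metis
  then show ?thesis
    using assms(1) graph_iso_simple unfolding graph_species_def graph_iso_rel_def by blast
qed

lemma graph_reps_exists:
  assumes "graph_species \<G>" "H \<in> \<G>"
  shows "\<exists>G\<in>graph_reps \<G>. (G, H) \<in> graph_iso_rel"
proof -
  have H: "simple_graph H" using assms by (simp add: graph_species_def)
  let ?C = "graph_iso_rel `` {H}"
  have "H \<in> ?C" using graph_iso_rel_refl by blast
  then have "(SOME G. G \<in> ?C) \<in> ?C" by (rule someI)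
  then have "(H, SOME G. G \<in> ?C) \<in> graph_iso_rel" by blast
  then have "(SOME G. G \<in> ?C, H) \<in> graph_iso_rel" using graph_iso_rel_sym H by blast
  moreover have "(SOME G. G \<in> ?C) \<in> graph_reps \<G>"
    unfolding graph_reps_def using quotientI[OF assms(2)] by blast
  ultimately show ?thesis by blast
qed

text \<open>The element picked by SOME depends on the isomorphism class alone, and isomorphic
  representatives come from one class.\<close>

lemma graph_reps_unique:
  assumes "graph_species \<G>" "G \<in> graph_reps \<G>" "H \<in> graph_reps \<G>" "(G, H) \<in> graph_iso_rel"
  shows "G = H"
proof -
  obtain C where C: "C \<in> \<G> // graph_iso_rel" "G = (SOME H. H \<in> C)"
    using assms(2) by (auto simp: graph_reps_def)
  obtain D where D: "D \<in> \<G> // graph_iso_rel" "H = (SOME H. H \<in> D)"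
    using assms(3) by (auto simp: graph_reps_def)
  obtain G' where G': "simple_graph G'" "C = graph_iso_rel `` {G'}" "(G', G) \<in> graph_iso_rel"
    using graph_reps_props[OF assms(1) C(1)] C(2) by metis
  obtain H' where H': "simple_graph H'" "D = graph_iso_rel `` {H'}" "(H', H) \<in> graph_iso_rel"
    using graph_reps_props[OF assms(1) D(1)] D(2) by metis
  have "(G', H') \<in> graph_iso_rel"
    using G'(3) assms(4) graph_iso_rel_sym[OF H'(3,1)] graph_iso_rel_trans by blast
  then have "C = D"
    using graph_iso_rel_sym[OF _ G'(1)] graph_iso_rel_trans unfolding G'(2) H'(2) by blast
  then show ?thesis using C(2) D(2) by simp
qed

theorem theorem4:
  fixes \<G> :: "'a::infinite graph set" and \<N> :: "'a network set"
  assumes "graph_species \<G>"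
    and "network_species \<N>"
    and "symmetric_networks \<N>"
  shows "subst_gf (\<G> \<up> \<N>) =
           walsh_index \<G>
             (\<lambda>k. fps_X ^ k)
             (\<lambda>k. subst_pow k (network_gf \<N>))
             (\<lambda>k. subst_pow k (network_gf (self_opposite \<N>)))"
proof (intro fps_ext)
  fix n m
  interpret network_classes \<N> using assms(2,3) by unfold_locales
  let ?F = "{G. G \<in> graph_reps \<G> \<and> card (verts G) \<le> n}"
  let ?t = "walsh_term (\<lambda>k. fps_X ^ k) (\<lambda>k. subst_pow k (network_gf \<N>))
    (\<lambda>k. subst_pow k (network_gf (self_opposite \<N>)))"
  let ?S = "\<lambda>G0. {s \<in> sized_substs \<G> n m. (G0, snd s) \<in> graph_iso_rel}"
  have "?F = (\<Union>i\<le>n. {G \<in> graph_reps \<G>. card (verts G) = i})" by auto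
  then have finF: "finite ?F" using finite_graph_reps[OF assms(1)] by simp
  have "sized_substs \<G> n m \<subseteq> (\<Union>G0\<in>?F. ?S G0)"
  proof
    fix s assume s: "s \<in> sized_substs \<G> n m"
    obtain G H where GH: "s = (G, H)" by (cases s)
    have sub: "(G, H) \<in> \<G> \<up> \<N>" "card (verts G) = n" using s by (auto simp: GH sized_substs_def)
    obtain M where H: "H \<in> \<G>" "simple_graph G" "verts H \<subseteq> verts G"
      using sub(1) assms(1) by (rule subst_classE)
    obtain G0 where G0: "G0 \<in> graph_reps \<G>" "(G0, H) \<in> graph_iso_rel"
      using graph_reps_exists[OF assms(1) H(1)] by blast
    \<comment> \<open>The core lies inside \<open>G\<close>, which has \<open>n\<close> vertices;
      this is the cut-off of \<open>walsh_index_nth\<close>.\<close>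
    have "card (verts G0) \<le> n"
      using graph_iso_rel_card[OF G0(2)] card_mono[OF _ H(3)] H(2) sub(2) by (simp add: simple_graph_def)
    then show "s \<in> (\<Union>G0\<in>?F. ?S G0)" using G0 s GH by auto
  qed
  then have "sized_substs \<G> n m = (\<Union>G0\<in>?F. ?S G0)" by blast
  \<comment> \<open>Classes are taken in the unrestricted \<open>core_iso_rel\<close>, so a pair has
    the same class in a part as in the whole, and quotients commute with unions.\<close>
  then have "sized_substs \<G> n m // core_iso_rel = (\<Union>G0\<in>?F. ?S G0 // core_iso_rel)"
    unfolding quotient_def by blast
  also have "card \<dots> = (\<Sum>G0\<in>?F. card (?S G0 // core_iso_rel))"
  proof (rule card_UN_disjoint[OF finF])
    show "\<forall>G0\<in>?F. finite (?S G0 // core_iso_rel)"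
      using card_substs_over_core(1)[OF assms(1) graph_reps_in[OF assms(1)]] by blast
    show "\<forall>G0\<in>?F. \<forall>G1\<in>?F. G0 \<noteq> G1 \<longrightarrow> ?S G0 // core_iso_rel \<inter> ?S G1 // core_iso_rel = {}"
    proof (intro ballI impI, rule ccontr)
      fix G0 G1 assume G: "G0 \<in> ?F" "G1 \<in> ?F" "G0 \<noteq> G1"
        and "?S G0 // core_iso_rel \<inter> ?S G1 // core_iso_rel \<noteq> {}"
      then obtain s t where st: "s \<in> ?S G0" "t \<in> ?S G1" "core_iso_rel `` {s} = core_iso_rel `` {t}"
        by (auto elim!: quotientE)
      \<comment> \<open>Isomorphic pairs have isomorphic cores, so two representatives that share a
        type of pair are isomorphic and hence equal.\<close>
      then have "(s, t) \<in> core_iso_rel"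
        using core_iso_rel_class_eq[OF _ assms(1), of s t] by (simp add: sized_substs_def)
      then have "(snd s, snd t) \<in> graph_iso_rel"
        by (auto simp: core_iso_rel_def graph_iso_rel_def)
      then have "(G0, snd t) \<in> graph_iso_rel"
        using st(1) graph_iso_rel_trans by blast
      moreover have "(snd t, G1) \<in> graph_iso_rel"
        using st(2) graph_iso_rel_sym graph_reps_in[OF assms(1)] G(2) assms(1)
        unfolding graph_species_def by blast
      ultimately have "G0 = G1"
        using G(1,2) graph_reps_unique[OF assms(1)] graph_iso_rel_trans by blast
      then show False using G(3) by simp
    qed
  qed
  finally have card: "card (sized_substs \<G> n m // core_iso_rel) = (\<Sum>G0\<in>?F. card (?S G0 // core_iso_rel))" .
  have "subst_gf (\<G> \<up> \<N>) $ n $ m = of_nat (card (sized_substs \<G> n m // core_iso_rel))"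
    by (simp add: subst_gf_def class_gf_def sized_substs_def case_prod_unfold)
  also have "\<dots> = (\<Sum>G0\<in>?F. ?t G0 $ n $ m)"
    unfolding card of_nat_sum
    using card_substs_over_core(2)[OF assms(1) graph_reps_in[OF assms(1)]] by (intro sum.cong) auto
  also have "\<dots> = walsh_index \<G> (\<lambda>k. fps_X ^ k) (\<lambda>k. subst_pow k (network_gf \<N>))
      (\<lambda>k. subst_pow k (network_gf (self_opposite \<N>))) $ n $ m"
    by (simp add: walsh_index_nth[OF assms(1)] fps_sum_nth)
  finally show "subst_gf (\<G> \<up> \<N>) $ n $ m = walsh_index \<G> (\<lambda>k. fps_X ^ k)
      (\<lambda>k. subst_pow k (network_gf \<N>)) (\<lambda>k. subst_pow k (network_gf (self_opposite \<N>))) $ n $ m" .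
qed

end
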